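(* Assume the standing hypotheses (H), (L) and (g) below. Let $u\in W^{1,1}(0,T;X)$ and $x_0\in X$ be such that $x_0\in Z(g(0,u(0),u(0)-x_0))$. Then there exists a unique solution $\xi\in\Omega_{x_0}(u)$ of the state-dependent sweeping process with input $u$ and initial condition $x_0$.
   Context: $T>0$. $X$ is a real Hilbert space with inner product $\langle\cdot,\cdot\rangle$ and norm $|x|=\sqrt{\langle x,x\rangle}$; $W$ is a real Banach space with norm $|\cdot|_W$, dual $W'$ (norm $|\cdot|_{W'}$), duality pairing $\langle v,f\rangle_W$; $\mathcal L(X,W)$ is the space of bounded linear operators with operator norm. $G:X\times W\to[0,\infty)$ is locally Lipschitz continuous and $Z(w):=\{x\in X: G(x,w)\le 1\}$; $\partial Z(w)$ is its boundary, $\mathrm{dist}(x,S)=\inf_{s\in S}|x-s|$. Partial gradients: $\nabla_xG(x,w)\in X$ with $\langle\nabla_xG(x,w),y\rangle=\lim_{t\to0}\frac1t(G(x+ty,w)-G(x,w))$ for all $y\in X$; $\nabla_wG(x,w)\in W'$ with $\langle v,\nabla_wG(x,w)\rangle_W=\lim_{t\to0}\frac1t(G(x,w+tv)-G(x,w))$ for all $v\in W$. (H): $\nabla_xG(x,w)$ exists for all $(x,w)$, and there are positive constants $\lambda,c,L$ and functions $\mu_1:W\times[0,\infty)\to[0,\infty)$, $\mu_2:[0,\infty)\to[0,\infty)$ with $\mu_1(w,0)=\mu_2(0)=0$, $\lim_{s\to\infty}\mu_1(w,s)=\lim_{s\to\infty}\mu_2(s)=\infty$ for every $w$, such that for all $x,y,z\in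 X$, $w,w'\in W$: (i) $G(x,w)=1\Rightarrow|\nabla_xG(x,w)|\ge c$; (ii) $|\nabla_xG(x,w)-\nabla_xG(y,w)|\le\mu_1(w,|x-y|)$ if $x,y\in Z(w)$; (iii) $\langle\nabla_xG(x,w)-\nabla_xG(z,w),x-z\rangle\ge-\lambda|x-z|^2$ if $x\in\partial Z(w)$, $z\in Z(w)$; (iv) $|G(x,w)-G(x,w')|\le L|w-w'|_W$; (v) for $\rho>0$, $\mathrm{dist}(x,Z(w))\ge\rho\Rightarrow G(x,w)-1\ge\mu_2(\rho)$. Set $r:=c/\lambda$. (L): $\nabla_xG,\nabla_wG$ exist on all of $X\times W$ and there are positive constants $K_0,K_1,C_0,C_1$ with $|\nabla_xG|\le K_0$, $|\nabla_wG|_{W'}\le K_1$, $|\nabla_xG(x,w)-\nabla_xG(x',w')|\le C_0(|x-x'|+|w-w'|_W)$, $|\nabla_wG(x,w)-\nabla_wG(x',w')|_{W'}\le C_1(|x-x'|+|w-w'|_W)$. (g): $g:[0,T]\times X\times X\to W$ is continuous, its partial derivatives $\partial_tg$, $\partial_ug$, $\partial_\xi g$ exist, and there are $a,b\in L^1(0,T)$ and constants $\gamma,\omega,C_\xi,C_u>0$ such that for all $u,v,\xi,\eta\in X$ and a.e. $t\in(0,T)$: $|\partial_\xi g(t,u,\xi)|_{\mathcal L(X,W)}\le\gamma$, $|\partial_ug(t,u,\xi)|_{\mathcal L(X,W)}\le\omega$, $|\partial_tg(t,u,\xi)|_W\le a(t)$, $|\partial_\xi g(t,u,\xi)-\partial_\xi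 g(t,v,\eta)|_{\mathcal L(X,W)}\le C_\xi(|u-v|+|\xi-\eta|)$, $|\partial_ug(t,u,\xi)-\partial_ug(t,v,\eta)|_{\mathcal L(X,W)}\le C_u(|u-v|+|\xi-\eta|)$, $|\partial_tg(t,u,\xi)-\partial_tg(t,v,\eta)|_W\le b(t)(|u-v|+|\xi-\eta|)$; moreover $\delta:=K_1\gamma/c<1$. State-dependent sweeping process: given $u\in W^{1,1}(0,T;X)$ and $x_0\in X$ with $x_0\in Z(g(0,u(0),u(0)-x_0))$, a function $\xi\in W^{1,1}(0,T;X)$ is a solution with input $u$ and initial condition $x_0$ if, with $x:=u-\xi$: $x(t)\in Z(g(t,u(t),\xi(t)))$ for all $t\in[0,T]$; $\langle x(t)-z,\dot\xi(t)\rangle+\frac{|\dot\xi(t)|}{2r}|x(t)-z|^2\ge0$ for all $z\in Z(g(t,u(t),\xi(t)))$, a.e. $t$; $x(0)=x_0$. For such $u,x_0$: $\Omega_{x_0}(u)$ is the set of $\eta\in W^{1,1}(0,T;X)$ with $\eta(0)=u(0)-x_0$ and $|\dot\eta(t)|\le\frac1{1-\delta}\big((1+\frac{\omega K_1}{c})|\dot u(t)|+\frac{K_1}{c}a(t)\big)$ for a.e. $t\in(0,T)$. *)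

theory Defs
  imports "HOL-Analysis.Analysis"
begin

text \<open>Sobolev space W^{1,1}(0,T;E): absolutely continuous functions on [0,T]
  given as indefinite integrals of an integrable derivative f', which is also
  the pointwise derivative almost everywhere.\<close>
definition W11 :: "real \<Rightarrow> (real \<Rightarrow> 'a::banach) \<Rightarrow> bool" where
  "W11 T f \<longleftrightarrow> (\<exists>f'. f' integrable_on {0..T} \<and> (\<lambda>t. norm (f' t)) integrable_on {0..T}
      \<and> (\<forall>t\<in>{0..T}. f t = f 0 + integral {0..t} f')
      \<and> (AE t in lebesgue. t \<in> {0<..<T} \<longrightarrow> (f has_vector_derivative f' t) (at t)))"

text \<open>time derivative (meaningful a.e. for W^{1,1} functions)\<close>
definition dot :: "(real \<Rightarrow> 'a::real_normed_vector) \<Rightarrow> real \<Rightarrow> 'a" where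
  "dot f t = vector_derivative f (at t)"

definition Zset :: "('x \<Rightarrow> 'w \<Rightarrow> real) \<Rightarrow> 'w \<Rightarrow> 'x set" where
  "Zset G w = {x. G x w \<le> 1}"

definition loc_lipschitz2 :: "('x::metric_space \<Rightarrow> 'w::metric_space \<Rightarrow> real) \<Rightarrow> bool" where
  "loc_lipschitz2 G \<longleftrightarrow> (\<forall>x w. \<exists>e>0. \<exists>K. \<forall>x1 w1 x2 w2.
      dist (x1, w1) (x, w) < e \<and> dist (x2, w2) (x, w) < e \<longrightarrow>
      \<bar>G x1 w1 - G x2 w2\<bar> \<le> K * dist (x1, w1) (x2, w2))"

definition is_grad_x :: "('x::real_inner \<Rightarrow> 'w \<Rightarrow> real) \<Rightarrow> ('x \<Rightarrow> 'w \<Rightarrow> 'x) \<Rightarrow> bool" where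
  "is_grad_x G Gx \<longleftrightarrow> (\<forall>x w y. ((\<lambda>t. (G (x + t *\<^sub>R y) w - G x w) / t) \<longlongrightarrow> inner (Gx x w) y) (at 0))"

definition is_grad_w :: "('x \<Rightarrow> 'w::real_normed_vector \<Rightarrow> real) \<Rightarrow> ('x \<Rightarrow> 'w \<Rightarrow> ('w \<Rightarrow>\<^sub>L real)) \<Rightarrow> bool" where
  "is_grad_w G Gw \<longleftrightarrow> (\<forall>x w v. ((\<lambda>t. (G x (w + t *\<^sub>R v) - G x w) / t) \<longlongrightarrow> blinfun_apply (Gw x w) v) (at 0))"

definition hyp_H :: "('x::{real_inner,banach} \<Rightarrow> 'w::banach \<Rightarrow> real) \<Rightarrow> ('x \<Rightarrow> 'w \<Rightarrow> 'x)
    \<Rightarrow> real \<Rightarrow> real \<Rightarrow> real \<Rightarrow> bool" where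
  "hyp_H G Gx lam c L \<longleftrightarrow> is_grad_x G Gx \<and> lam > 0 \<and> c > 0 \<and> L > 0 \<and>
    (\<exists>(\<mu>1 :: 'w \<Rightarrow> real \<Rightarrow> real) (\<mu>2 :: real \<Rightarrow> real).
      (\<forall>w s. s \<ge> 0 \<longrightarrow> \<mu>1 w s \<ge> 0) \<and> (\<forall>s. s \<ge> 0 \<longrightarrow> \<mu>2 s \<ge> 0) \<and>
      (\<forall>w. \<mu>1 w 0 = 0) \<and> \<mu>2 0 = 0 \<and>
      (\<forall>w. filterlim (\<mu>1 w) at_top at_top) \<and> filterlim \<mu>2 at_top at_top \<and>
      (\<forall>x w. G x w = 1 \<longrightarrow> norm (Gx x w) \<ge> c) \<and>
      (\<forall>x y w. x \<in> Zset G w \<and> y \<in> Zset G w \<longrightarrow> norm (Gx x w - Gx y w) \<le> \<mu>1 w (norm (x - y))) \<and>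
      (\<forall>x z w. x \<in> frontier (Zset G w) \<and> z \<in> Zset G w \<longrightarrow>
          inner (Gx x w - Gx z w) (x - z) \<ge> - lam * (norm (x - z))\<^sup>2) \<and>
      (\<forall>x w w'. \<bar>G x w - G x w'\<bar> \<le> L * norm (w - w')) \<and>
      (\<forall>x w \<rho>. \<rho> > 0 \<and> (\<forall>z\<in>Zset G w. dist x z \<ge> \<rho>) \<longrightarrow> G x w - 1 \<ge> \<mu>2 \<rho>))"

definition hyp_L :: "('x::{real_inner,banach} \<Rightarrow> 'w::banach \<Rightarrow> real) \<Rightarrow> ('x \<Rightarrow> 'w \<Rightarrow> 'x)
    \<Rightarrow> ('x \<Rightarrow> 'w \<Rightarrow> ('w \<Rightarrow>\<^sub>L real)) \<Rightarrow> real \<Rightarrow> real \<Rightarrow> real \<Rightarrow> real \<Rightarrow> bool" where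
  "hyp_L G Gx Gw K0 K1 C0 C1 \<longleftrightarrow> is_grad_x G Gx \<and> is_grad_w G Gw \<and>
    K0 > 0 \<and> K1 > 0 \<and> C0 > 0 \<and> C1 > 0 \<and>
    (\<forall>x w. norm (Gx x w) \<le> K0) \<and> (\<forall>x w. norm (Gw x w) \<le> K1) \<and>
    (\<forall>x w x' w'. norm (Gx x w - Gx x' w') \<le> C0 * (norm (x - x') + norm (w - w'))) \<and>
    (\<forall>x w x' w'. norm (Gw x w - Gw x' w') \<le> C1 * (norm (x - x') + norm (w - w')))"

definition hyp_g :: "real \<Rightarrow> (real \<Rightarrow> 'x::{real_inner,banach} \<Rightarrow> 'x \<Rightarrow> 'w::banach)
    \<Rightarrow> (real \<Rightarrow> 'x \<Rightarrow> 'x \<Rightarrow> 'w) \<Rightarrow> (real \<Rightarrow> 'x \<Rightarrow> 'x \<Rightarrow> ('x \<Rightarrow>\<^sub>L 'w)) \<Rightarrow> (real \<Rightarrow> 'x \<Rightarrow> 'x \<Rightarrow> ('x \<Rightarrow>\<^sub>L 'w))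
    \<Rightarrow> (real \<Rightarrow> real) \<Rightarrow> (real \<Rightarrow> real) \<Rightarrow> real \<Rightarrow> real \<Rightarrow> real \<Rightarrow> real \<Rightarrow> real \<Rightarrow> real \<Rightarrow> bool" where
  "hyp_g T g gt gu gxi a b \<gamma> \<omega> Cxi Cu c K1 \<longleftrightarrow>
    continuous_on ({0..T} \<times> UNIV \<times> UNIV) (\<lambda>(t, u, \<xi>). g t u \<xi>) \<and>
    (\<forall>t\<in>{0..T}. \<forall>u \<xi>. ((\<lambda>s. g s u \<xi>) has_vector_derivative gt t u \<xi>) (at t within {0..T})) \<and>
    (\<forall>t\<in>{0..T}. \<forall>u \<xi>. ((\<lambda>v. g t v \<xi>) has_derivative blinfun_apply (gu t u \<xi>)) (at u)) \<and>
    (\<forall>t\<in>{0..T}. \<forall>u \<xi>. ((\<lambda>\<eta>. g t u \<eta>) has_derivative blinfun_apply (gxi t u \<xi>)) (at \<xi>)) \<and>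
    a absolutely_integrable_on {0..T} \<and> b absolutely_integrable_on {0..T} \<and>
    \<gamma> > 0 \<and> \<omega> > 0 \<and> Cxi > 0 \<and> Cu > 0 \<and>
    (AE t in lebesgue. t \<in> {0<..<T} \<longrightarrow> (\<forall>u v \<xi> \<eta>.
       norm (gxi t u \<xi>) \<le> \<gamma> \<and> norm (gu t u \<xi>) \<le> \<omega> \<and> norm (gt t u \<xi>) \<le> a t \<and>
       norm (gxi t u \<xi> - gxi t v \<eta>) \<le> Cxi * (norm (u - v) + norm (\<xi> - \<eta>)) \<and>
       norm (gu t u \<xi> - gu t v \<eta>) \<le> Cu * (norm (u - v) + norm (\<xi> - \<eta>)) \<and>
       norm (gt t u \<xi> - gt t v \<eta>) \<le> b t * (norm (u - v) + norm (\<xi> - \<eta>)))) \<and>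
    K1 * \<gamma> / c < 1"

text \<open>Solution of the state-dependent sweeping process, with r = c / lam.\<close>
definition sweeping_solution :: "real \<Rightarrow> ('x::{real_inner,banach} \<Rightarrow> 'w::banach \<Rightarrow> real)
    \<Rightarrow> (real \<Rightarrow> 'x \<Rightarrow> 'x \<Rightarrow> 'w) \<Rightarrow> real \<Rightarrow> (real \<Rightarrow> 'x) \<Rightarrow> 'x \<Rightarrow> (real \<Rightarrow> 'x) \<Rightarrow> bool" where
  "sweeping_solution T G g r u x0 \<xi> \<longleftrightarrow> W11 T \<xi> \<and>
    (\<forall>t\<in>{0..T}. u t - \<xi> t \<in> Zset G (g t (u t) (\<xi> t))) \<and>
    (AE t in lebesgue. t \<in> {0<..<T} \<longrightarrow> (\<forall>z\<in>Zset G (g t (u t) (\<xi> t)).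
        inner (u t - \<xi> t - z) (dot \<xi> t) + norm (dot \<xi> t) / (2 * r) * (norm (u t - \<xi> t - z))\<^sup>2 \<ge> 0)) \<and>
    u 0 - \<xi> 0 = x0"

definition Omega :: "real \<Rightarrow> real \<Rightarrow> real \<Rightarrow> real \<Rightarrow> real \<Rightarrow> (real \<Rightarrow> real)
    \<Rightarrow> (real \<Rightarrow> 'x::{real_inner,banach}) \<Rightarrow> 'x \<Rightarrow> (real \<Rightarrow> 'x) set" where
  "Omega T \<delta> \<omega> K1 c a u x0 = {\<eta>. W11 T \<eta> \<and> \<eta> 0 = u 0 - x0 \<and>
     (AE t in lebesgue. t \<in> {0<..<T} \<longrightarrow>
        norm (dot \<eta> t) \<le> 1 / (1 - \<delta>) * ((1 + \<omega> * K1 / c) * norm (dot u t) + K1 / c * a t))}"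

end

theory Submission
  imports Defs
begin

text \<open>Along a solution the level \<open>G(x, w)\<close> with \<open>x = u - \<xi>\<close>, \<open>w = g(t, u, \<xi>)\<close> stays below 1, and \<open>\<xi>'\<close> is
  a nonnegative multiple of \<open>\<nabla>\<^sub>x G\<close> that vanishes where the level is below 1. Writing
  \<open>\<xi>' = m \<nabla>\<^sub>x G / |\<nabla>\<^sub>x G|\<^sup>2\<close>, the derivative of the level is \<open>f - m\<close>, where the drift f depends on \<open>\<xi>\<close>
  and, through the state dependence of w, on m. Hence m is the density of the scalar Skorokhod reflection
  at 1 of the primitive of f. The reflection map is a contraction from \<open>L\<^sup>1\<close> densities to \<open>L\<^sup>1\<close> densities, and f
  depends on m with Lipschitz constant \<open>\<delta> = K1 \<gamma> / c < 1\<close> and on \<open>\<xi>\<close> with an integrable Lipschitz weight. So the map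
  sending \<open>(\<xi>, m)\<close> to the reflection density of its drift and the corresponding primitive is a contraction in
  an exponentially weighted norm; its unique fixed point is the unique solution. That a fixed point satisfies
  the variational inequality with the sharp radius \<open>r = c / \<lambda>\<close> is the prox-regularity of \<open>Z(w)\<close>, obtained from
  hypomonotonicity of the gradient by Ekeland's variational principle. Derivatives are Henstock--Kurzweil
  integrable functions, since the spaces need not be separable.\<close>

section \<open>Integration on an interval\<close>

text \<open>The unknown velocity enters its own equation: w contributes up to K1 \<gamma> |\<xi>'|,
  against a reflection term |\<nabla>G| |\<xi>'| with |\<nabla>G| at least c. With the inner product
  m of \<nabla>G and \<xi>' as unknown in place of |\<xi>'|, this weight becomes exactly \<delta>;
  measuring m in L1, where reflection is nonexpansive, loses no further factor, so \<delta> < 1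
  suffices and what remains is of Volterra type in \<xi>. Iterates need not keep x in Z(w), and away
  from the level set the gradient may vanish. Hence the truncated field, and hence a separate proof
  that at a fixed point the true level and the reflected path coincide. In infinite dimension Z(w)
  need not contain nearest points, so almost minimizers replace projections. The partial derivatives
  of g come without measurability along curves. Integrability of the drift is obtained from
  difference quotients of continuous functions, and the velocities produced are always a scalar L1
  density times a continuous field.\<close>

lemma AE_lebesgue_iff_negligible:
  "(AE x in lebesgue. P x) \<longleftrightarrow> negligible {x. \<not> P x}" for P :: "'a::euclidean_space \<Rightarrow> bool"
  by (simp add: negligible_iff_null_sets AE_iff_null_sets completion.AE_iff_null_sets)

text \<open>\<open>integrable_ccontinuous_explicit\<close> averages over boxes that have x as lower
  corner, which is the right derivative only. The same result for the reflected function supplies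
  the left derivative. Extension by zero makes the integrand integrable on every box, as that
  theorem asks.\<close>

lemma lebesgue_differentiation_real:
  fixes f :: "real \<Rightarrow> real"
  assumes "f integrable_on {a..b}"
  shows "AE t in lebesgue. t \<in> {a<..<b} \<longrightarrow>
    ((\<lambda>t. integral {a..t} f) has_vector_derivative f t) (at t)"
proof -
  define h where "h t = (if t \<in> {a..b} then f t else 0)" for t
  have h: "h integrable_on cbox p q" for p q
    using assms unfolding h_def integrable_restrict_UNIV[of "{a..b}" f, symmetric]
    using integrable_on_subcbox by blast
  have hr: "(\<lambda>t. h (- t)) integrable_on cbox p q" for p q
    using h[of "-q" "-p"] Henstock_Kurzweil_Integration.integrable_reflect_real[of h "-p" "-q"] by simp
  obtain N1 where N1: "negligible N1" "\<And>x e. \<lbrakk>x \<notin> N1; 0 < e\<rbrakk> \<Longrightarrow>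
      \<exists>d>0. \<forall>k. 0 < k \<and> k < d \<longrightarrow> norm(integral (cbox x (x + k *\<^sub>R One)) h /\<^sub>R k ^ DIM(real) - h x) < e"
    using integrable_ccontinuous_explicit[OF h] by blast
  obtain N2 where N2: "negligible N2" "\<And>x e. \<lbrakk>x \<notin> N2; 0 < e\<rbrakk> \<Longrightarrow>
      \<exists>d>0. \<forall>k. 0 < k \<and> k < d \<longrightarrow>
        norm(integral (cbox x (x + k *\<^sub>R One)) (\<lambda>t. h (- t)) /\<^sub>R k ^ DIM(real) - h (- x)) < e"
    using integrable_ccontinuous_explicit[OF hr] by blast
  have "negligible (uminus ` N2)"
    using N2(1) by (intro negligible_differentiable_image_negligible) (auto intro!: derivative_intros)
  with N1(1) have neg: "negligible (N1 \<union> uminus ` N2)" by simp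
  have key: "((\<lambda>t. integral {a..t} f) has_vector_derivative f t) (at t)"
    if t: "t \<in> {a<..<b}" "t \<notin> N1 \<union> uminus ` N2" for t
  proof -
    have ht: "h t = f t" using t by (simp add: h_def)
    have t1: "t \<notin> N1" and t2: "- t \<notin> N2" using t(2) by (auto simp: image_iff)
    have "((\<lambda>s. (integral {a..s} f - integral {a..t} f) /\<^sub>R (s - t)) \<longlongrightarrow> f t) (at t)"
      unfolding LIM_eq
    proof (intro allI impI)
      fix e :: real assume "0 < e"
      obtain d1 where d1: "d1 > 0" "\<And>k. 0 < k \<Longrightarrow> k < d1 \<Longrightarrow> norm (integral {t..t+k} h /\<^sub>R k - h t) < e"
        using N1(2)[OF t1 \<open>0 < e\<close>] by auto
      obtain d2 where d2: "d2 > 0"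
        "\<And>k. 0 < k \<Longrightarrow> k < d2 \<Longrightarrow> norm (integral {-t..-t+k} (\<lambda>t. h (-t)) /\<^sub>R k - h t) < e"
        using N2(2)[OF t2 \<open>0 < e\<close>] by auto
      define d where "d = Min {d1, d2, t - a, b - t}"
      have d: "d > 0" "d \<le> d1" "d \<le> d2" "d \<le> t - a" "d \<le> b - t" 
        using d1 d2 t by (auto simp: d_def)
      have "norm ((integral {a..s} f - integral {a..t} f) /\<^sub>R (s - t) - f t) < e"
        if s: "s \<noteq> t \<and> norm (s - t) < d" for s
      proof (cases "s > t")
        case True
        have "integral {a..t} f + integral {t..s} f = integral {a..s} f"
          using True d s t by (intro Henstock_Kurzweil_Integration.integral_combine
              integrable_subinterval_real[OF assms]) auto
        moreover have "integral {t..s} f = integral {t..t + (s-t)} h"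
          using True d s t by (auto intro!: integral_cong simp: h_def)
        ultimately have "integral {a..s} f - integral {a..t} f = integral {t..t+(s-t)} h" by linarith
        moreover have "norm (integral {t..t+(s-t)} h /\<^sub>R (s-t) - h t) < e"
          using True s d by (intro d1) auto
        ultimately show ?thesis by (simp only: ht)
      next
        case False
        have "integral {a..s} f + integral {s..t} f = integral {a..t} f"
          using False d s t by (intro Henstock_Kurzweil_Integration.integral_combine
              integrable_subinterval_real[OF assms]) auto
        moreover have "integral {s..t} f = integral {s..t} h"
          using False d s t by (auto intro!: integral_cong simp: h_def)
        moreover have "integral {s..t} h = integral {-t..-t+(t-s)} (\<lambda>t. h (-t))"
          using Henstock_Kurzweil_Integration.integral_reflect_real[of "t" "s" h] by simp
        ultimately have "integral {a..t} f - integral {a..s} f = integral {-t..-t+(t-s)} (\<lambda>t. h (-t))"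
          by linarith
        moreover have "norm (integral {-t..-t+(t-s)} (\<lambda>t. h (-t)) /\<^sub>R (t-s) - h t) < e"
          using False s d by (intro d2) auto
        ultimately have "norm ((integral {a..t} f - integral {a..s} f) /\<^sub>R (t - s) - f t) < e"
          by (simp only: ht)
        moreover have "(integral {a..t} f - integral {a..s} f) /\<^sub>R (t - s) =
           (integral {a..s} f - integral {a..t} f) /\<^sub>R (s - t)"
          using nonzero_inverse_minus_eq[of "s - t"] s(1) by (simp add: algebra_simps)
        ultimately show ?thesis by (simp only:)
      qed
      with d(1) show "\<exists>d>0. \<forall>s. s \<noteq> t \<and> norm (s - t) < d \<longrightarrow>
          norm ((integral {a..s} f - integral {a..t} f) /\<^sub>R (s - t) - f t) < e"
        by (intro exI[of _ d] conjI allI impI)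
    qed
    then show ?thesis
      by (simp only: has_real_derivative_iff_has_vector_derivative[symmetric] has_field_derivative_iff
          real_scaleR_def divide_inverse_commute)
  qed
  show ?thesis
    unfolding AE_lebesgue_iff_negligible
  proof (rule negligible_subset[OF neg], rule subsetI, rule ccontr)
    fix t assume "t \<in> {t. \<not> (t \<in> {a<..<b} \<longrightarrow> ((\<lambda>t. integral {a..t} f) has_vector_derivative f t) (at t))}"
      "t \<notin> N1 \<union> uminus ` N2"
    then show False using key[of t] by simp
  qed
qed

lemma AE_interior_obtain_negligible:
  fixes a b :: real
  assumes "AE t in lebesgue. t \<in> {a<..<b} \<longrightarrow> P t"
  obtains N where "negligible N" "\<And>t. t \<in> {a..b} - N \<Longrightarrow> t \<in> {a<..<b} \<and> P t"
proof
  show "negligible ({t. \<not> (t \<in> {a<..<b} \<longrightarrow> P t)} \<union> {a, b})"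
    using assms by (simp add: AE_lebesgue_iff_negligible)
qed (auto simp: less_le)

text \<open>The Henstock lemma, applied to the dominating function set to zero on the exceptional null
  set, controls the increments of the primitive at the tags where it is not differentiable.\<close>
lemma has_integral_derivative_AE:
  fixes F :: "real \<Rightarrow> 'a::real_normed_vector"
  assumes "a \<le> b" and phi: "\<phi> integrable_on {a..b}"
    and le: "\<And>s t. a \<le> s \<Longrightarrow> s \<le> t \<Longrightarrow> t \<le> b \<Longrightarrow> norm (F t - F s) \<le> integral {s..t} \<phi>"
    and der: "AE t in lebesgue. t \<in> {a<..<b} \<longrightarrow> (F has_vector_derivative f t) (at t)"
  shows "(f has_integral (F b - F a)) {a..b}"
proof -
  obtain N where N: "negligible N"
    "\<And>t. t \<in> {a..b} - N \<Longrightarrow> t \<in> {a<..<b} \<and> (F has_vector_derivative f t) (at t)"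
    using AE_interior_obtain_negligible[OF der] by metis
  define f0 where "f0 t = (if t \<in> N then 0 else f t)" for t
  define p0 where "p0 t = (if t \<in> N then 0 else \<phi> t)" for t
  have p0: "p0 integrable_on cbox a b" 
    using integrable_spike[OF phi N(1), of p0] by (simp add: p0_def)
  have p0_int: "integral {s..t} p0 = integral {s..t} \<phi>" for s t
    by (rule integral_spike[OF N(1)]) (auto simp: p0_def)
  have "(f0 has_integral (F b - F a)) (cbox a b)"
    unfolding has_integral
  proof (intro allI impI)
    fix e :: real assume "e > 0"
    define e1 where "e1 = e / 2 / (b - a + 1)"
    have e1: "e1 > 0" "e1 * (b - a) < e / 2" using \<open>e > 0\<close> \<open>a \<le> b\<close> 
       by (auto simp: e1_def divide_simps)
    obtain \<gamma> where \<gamma>: "gauge \<gamma>" "\<And>p. \<lbrakk>p tagged_partial_division_of (cbox a b); \<gamma> fine p\<rbrakk> \<Longrightarrow>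
             sum (\<lambda>(x,k). norm(measure lborel k *\<^sub>R p0 x - integral k p0)) p < e / 2"
      using Henstock_lemma[OF p0, of "e/2"] \<open>e > 0\<close> by auto
    have "\<exists>d>0. t \<in> {a..b} - N \<longrightarrow> (\<forall>y. \<bar>y - t\<bar> < d \<longrightarrow> norm (F y - F t - (y - t) *\<^sub>R f t) \<le> e1 * \<bar>y - t\<bar>)" for t
    proof (cases "t \<in> {a..b} - N")
      case True
      then have "(F has_derivative (\<lambda>x. x *\<^sub>R f t)) (at t)"
        using N(2) by (simp add: has_vector_derivative_def)
      then show ?thesis using e1(1) unfolding has_derivative_within_alt by auto
    qed (auto intro: zero_less_one)
    then obtain d where d: "\<And>t. d t > 0"
      "\<And>t y. t \<in> {a..b} - N \<Longrightarrow> \<bar>y - t\<bar> < d t \<Longrightarrow> norm (F y - F t - (y - t) *\<^sub>R f t) \<le> e1 * \<bar>y - t\<bar>"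
      by metis
    define \<delta> where "\<delta> x = \<gamma> x \<inter> ball x (d x)" for x
    have "gauge \<delta>" unfolding \<delta>_def using \<gamma>(1) d(1) by (intro gauge_Int gauge_ball_dependent) auto
    moreover have "norm ((\<Sum>(x,k)\<in>p. measure lborel k *\<^sub>R f0 x) - (F b - F a)) < e"
      if asm: "p tagged_division_of cbox a b \<and> \<delta> fine p" for p
    proof -
      have p: "p tagged_division_of cbox a b" and fine: "\<delta> fine p" using asm by auto
      have fin: "finite p" using p by blast
      have "\<gamma> fine p" using fine unfolding \<delta>_def by (simp add: fine_Int)
      have bl: "k \<subseteq> ball x (d x)" if "(x,k) \<in> p" for x k
        using fine that unfolding \<delta>_def fine_def by blast
      have tele: "(\<Sum>(x,k)\<in>p. F (Sup k) - F (Inf k)) = F b - F a"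
        using additive_tagged_division_1[OF \<open>a \<le> b\<close>, of p F] p by simp
      have each: "norm (measure lborel k *\<^sub>R f0 x - (F (Sup k) - F (Inf k))) \<le>
          e1 * measure lborel k + norm (measure lborel k *\<^sub>R p0 x - integral k p0)" if xk: "(x,k) \<in> p" for x k
      proof -
        obtain s t where k: "k = cbox s t" using tagged_division_ofD(4)[OF p xk] by blast
        have xin: "x \<in> k" and sub: "k \<subseteq> cbox a b" using tagged_division_ofD(2,3)[OF p xk] by auto
        then have st: "s \<le> x" "x \<le> t" "a \<le> s" "t \<le> b" by (auto simp: k)
        then have ksi: "Sup k = t" "Inf k = s" "measure lborel k = t - s" by (auto simp: k)
        show ?thesis
        proof (cases "x \<in> N")
          case True
          have "norm (F t - F s) \<le> integral {s..t} \<phi>" using st by (intro le) auto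
          also have "\<dots> = integral k p0" by (simp add: p0_int k)
          also have "\<dots> \<le> norm (measure lborel k *\<^sub>R p0 x - integral k p0)" using True by (simp add: p0_def)
          finally show ?thesis using True e1(1) st by (auto simp: f0_def ksi norm_minus_commute intro: add_increasing)
        next
          case False
          have x: "x \<in> {a..b} - N" using False sub xin by auto
          \<comment> \<open>Straddle estimate: the tag x lies between s and t, so the errors on both
            sides of it add up to \<open>e1 * (t - s)\<close>.\<close>
          have "s \<in> k" "t \<in> k" using st by (auto simp: k)
          then have "\<bar>s - x\<bar> < d x" "\<bar>t - x\<bar> < d x" using bl[OF xk] by (auto simp: dist_real_def subset_iff abs_minus_commute)
          then have "norm (F s - F x - (s - x) *\<^sub>R f x) \<le> e1 * \<bar>s - x\<bar>" 
                    "norm (F t - F x - (t - x) *\<^sub>R f x) \<le> e1 * \<bar>t - x\<bar>" using d(2)[OF x] by blast+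
          moreover have "(t - s) *\<^sub>R f x - (F t - F s) =
             (F s - F x - (s - x) *\<^sub>R f x) - (F t - F x - (t - x) *\<^sub>R f x)"
            by (simp add: algebra_simps)
          ultimately have "norm ((t - s) *\<^sub>R f x - (F t - F s)) \<le> e1 * \<bar>s - x\<bar> + e1 * \<bar>t - x\<bar>"
            by (metis norm_triangle_le_diff add_mono)
          also have "\<dots> = e1 * (t - s)" using st by (simp add: algebra_simps)
          finally show ?thesis using False by (simp add: f0_def ksi add_increasing2)
        qed
      qed
      have "norm ((\<Sum>(x,k)\<in>p. measure lborel k *\<^sub>R f0 x) - (F b - F a))
          = norm (\<Sum>(x,k)\<in>p. measure lborel k *\<^sub>R f0 x - (F (Sup k) - F (Inf k)))"
        unfolding tele[symmetric] by (simp add: sum_subtractf case_prod_unfold)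
      also have "\<dots> \<le> (\<Sum>(x,k)\<in>p. e1 * measure lborel k + norm (measure lborel k *\<^sub>R p0 x - integral k p0))"
        by (intro sum_norm_le) (use each in \<open>force simp del: real_norm_def\<close>)
      also have "\<dots> = e1 * (\<Sum>(x,k)\<in>p. measure lborel k) + (\<Sum>(x,k)\<in>p. norm (measure lborel k *\<^sub>R p0 x - integral k p0))"
        by (simp add: case_prod_unfold sum.distrib sum_distrib_left)
      also have "(\<Sum>(x,k)\<in>p. measure lborel k) = b - a"
        using additive_content_tagged_division[OF p] \<open>a \<le> b\<close> by simp
      also have "e1 * (b - a) + (\<Sum>(x,k)\<in>p. norm (measure lborel k *\<^sub>R p0 x - integral k p0)) < e / 2 + e / 2"
        using \<gamma>(2)[OF p[unfolded tagged_division_of_def, THEN conjunct1] \<open>\<gamma> fine p\<close>] e1 by linarith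
      finally show ?thesis by simp
    qed
    ultimately show "\<exists>\<gamma>. gauge \<gamma> \<and> (\<forall>\<D>. \<D> tagged_division_of cbox a b \<and> \<gamma> fine \<D> \<longrightarrow>
        norm ((\<Sum>(x, k)\<in>\<D>. measure lborel k *\<^sub>R f0 x) - (F b - F a)) < e)"
      by (intro exI[of _ \<delta>] conjI allI impI)
  qed
  then have "(f0 has_integral (F b - F a)) {a..b}" by simp
  then show ?thesis
    by (rule has_integral_spike[OF N(1), rotated]) (auto simp: f0_def)
qed

text \<open>On a fine partition the Riemann sums of f and g differ by at most e times a Riemann sum
  of h, which stays near the integral of h. Thus f inherits the Cauchy criterion from its
  approximants g. The argument is free of measurability, so it works in any Banach space.\<close>

lemma integrable_on_approx_dominated:
  fixes f :: "real \<Rightarrow> 'a::banach"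
  assumes h: "h integrable_on {a..b}"
    and approx: "\<And>e. e > 0 \<Longrightarrow> \<exists>g. g integrable_on {a..b} \<and> (\<forall>x\<in>{a..b}. norm (f x - g x) \<le> e * h x)"
  shows "f integrable_on {a..b}"
proof -
  have "f integrable_on cbox a b"
    unfolding integrable_Cauchy
  proof (intro allI impI)
    fix e :: real assume "e > 0"
    define I where "I = integral {a..b} h"
    define e1 where "e1 = e / 4 / (\<bar>I\<bar> + 1)"
    have e1: "e1 > 0" "e1 * (\<bar>I\<bar> + 1) = e / 4"
      using \<open>e > 0\<close> by (auto simp: e1_def field_simps)
    obtain g where g: "g integrable_on cbox a b" "\<And>x. x \<in> cbox a b \<Longrightarrow> norm (f x - g x) \<le> e1 * h x"
      using approx[OF e1(1)] by auto
    obtain \<gamma>1 where \<gamma>1: "gauge \<gamma>1" "\<And>p q. p tagged_division_of cbox a b \<Longrightarrow> \<gamma>1 fine p \<Longrightarrow>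
        q tagged_division_of cbox a b \<Longrightarrow> \<gamma>1 fine q \<Longrightarrow>
        norm ((\<Sum>(x,K)\<in>p. measure lborel K *\<^sub>R g x) - (\<Sum>(x,K)\<in>q. measure lborel K *\<^sub>R g x)) < e / 2"
      using g(1)[unfolded integrable_Cauchy, rule_format, of "e/2"] \<open>e > 0\<close> by auto
    have "(h has_integral I) (cbox a b)" using h by (simp add: I_def integrable_integral)
    then obtain \<gamma>2 where \<gamma>2: "gauge \<gamma>2" "\<And>p. p tagged_division_of cbox a b \<Longrightarrow> \<gamma>2 fine p \<Longrightarrow>
        norm ((\<Sum>(x,K)\<in>p. measure lborel K *\<^sub>R h x) - I) < 1"
      unfolding has_integral by (metis zero_less_one)
    define \<gamma> where "\<gamma> x = \<gamma>1 x \<inter> \<gamma>2 x" for x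
    have part: "norm ((\<Sum>(x,K)\<in>p. measure lborel K *\<^sub>R f x) - (\<Sum>(x,K)\<in>p. measure lborel K *\<^sub>R g x)) \<le> e / 4"
      if p: "p tagged_division_of cbox a b" "\<gamma>2 fine p" for p
    proof -
      have "norm ((\<Sum>(x,K)\<in>p. measure lborel K *\<^sub>R f x) - (\<Sum>(x,K)\<in>p. measure lborel K *\<^sub>R g x))
         = norm (\<Sum>(x,K)\<in>p. measure lborel K *\<^sub>R (f x - g x))"
        by (simp add: sum_subtractf[symmetric] case_prod_unfold scaleR_diff_right)
      also have "\<dots> \<le> (\<Sum>(x,K)\<in>p. e1 * (measure lborel K *\<^sub>R h x))"
      proof (intro sum_norm_le, clarify)
        fix x K assume "(x,K) \<in> p"
        then have "x \<in> cbox a b" using tagged_division_ofD(2,3)[OF p(1)] by blast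
        then have "measure lborel K * norm (f x - g x) \<le> measure lborel K * (e1 * h x)"
          by (intro mult_left_mono g(2)) auto
        then show "norm (measure lborel K *\<^sub>R (f x - g x)) \<le> e1 * (measure lborel K *\<^sub>R h x)"
          by (simp add: mult.left_commute)
      qed
      also have "\<dots> = e1 * (\<Sum>(x,K)\<in>p. measure lborel K *\<^sub>R h x)"
        by (simp add: sum_distrib_left case_prod_unfold)
      also have "\<dots> \<le> e1 * (\<bar>I\<bar> + 1)"
        using \<gamma>2(2)[OF p] e1(1) by (intro mult_left_mono) (auto simp: abs_if split: if_splits)
      finally show ?thesis using e1(2) by simp
    qed
    have "norm ((\<Sum>(x,K)\<in>p. measure lborel K *\<^sub>R f x) - (\<Sum>(x,K)\<in>q. measure lborel K *\<^sub>R f x)) < e"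
      if pq: "p tagged_division_of cbox a b \<and> \<gamma> fine p \<and> q tagged_division_of cbox a b \<and> \<gamma> fine q" for p q
    proof -
      have pq': "p tagged_division_of cbox a b" "q tagged_division_of cbox a b"
        "\<gamma>1 fine p" "\<gamma>2 fine p" "\<gamma>1 fine q" "\<gamma>2 fine q"
        using pq unfolding \<gamma>_def by (auto simp: fine_Int)
      have tri: "norm (A - B) < e" if "norm (A - A') \<le> e/4" "norm (B - B') \<le> e/4" "norm (A' - B') < e/2"
        for A B A' B' :: 'a
      proof -
        have "norm (A - B) \<le> norm (A - A') + norm (A' - B') + norm (B - B')"
          using norm_triangle_ineq4[of "(A - A') + (A' - B')" "B - B'"]
            norm_triangle_ineq[of "A - A'" "A' - B'"] by simp
        then show ?thesis using that by linarith
      qed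
      show ?thesis
        by (rule tri[OF part part \<gamma>1(2)]) (use pq' in auto)
    qed
    moreover have "gauge \<gamma>" unfolding \<gamma>_def using \<gamma>1(1) \<gamma>2(1) by (rule gauge_Int)
    ultimately show "\<exists>\<gamma>. gauge \<gamma> \<and> (\<forall>\<D>1 \<D>2. \<D>1 tagged_division_of cbox a b \<and> \<gamma> fine \<D>1 \<and>
       \<D>2 tagged_division_of cbox a b \<and> \<gamma> fine \<D>2 \<longrightarrow>
       norm ((\<Sum>(x,K)\<in>\<D>1. measure lborel K *\<^sub>R f x) - (\<Sum>(x,K)\<in>\<D>2. measure lborel K *\<^sub>R f x)) < e)"
      by (intro exI[of _ \<gamma>] conjI allI impI)
  qed
  then show ?thesis by simp
qed

text \<open>On a short interval around x the curve v is close to the constant v x, and m times a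
  constant vector is integrable. Bolzano's bisection principle glues these local approximants into
  one on the whole interval, with error at most e times the absolute value of m.\<close>

lemma integrable_on_scaleR_continuous:
  fixes m :: "real \<Rightarrow> real" and v :: "real \<Rightarrow> 'a::banach"
  assumes m: "m absolutely_integrable_on {a..b}" and v: "continuous_on {a..b} v"
  shows "(\<lambda>t. m t *\<^sub>R v t) integrable_on {a..b}"
proof (cases "a \<le> b")
  case True
  have mi: "m integrable_on {a..b}" and mabs: "(\<lambda>t. \<bar>m t\<bar>) integrable_on {a..b}"
    using m by (auto simp: absolutely_integrable_on_def)
  show ?thesis
  proof (rule integrable_on_approx_dominated[OF mabs])
    fix e :: real assume "e > 0"
    define P where "P s t \<longleftrightarrow> (a \<le> s \<and> t \<le> b \<longrightarrow> (\<exists>g. g integrable_on {s..t} \<and>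
       (\<forall>x\<in>{s..t}. norm (m x *\<^sub>R v x - g x) \<le> e * \<bar>m x\<bar>)))" for s t
    have "P a b" using \<open>a \<le> b\<close>
    proof (induction rule: Bolzano)
      case (trans p q r)
      show ?case unfolding P_def
      proof (intro impI)
        assume "a \<le> p \<and> r \<le> b"
        then obtain g1 g2 where g1: "g1 integrable_on {p..q}" "\<And>x. x\<in>{p..q} \<Longrightarrow> norm (m x *\<^sub>R v x - g1 x) \<le> e * \<bar>m x\<bar>"
          and g2: "g2 integrable_on {q..r}" "\<And>x. x\<in>{q..r} \<Longrightarrow> norm (m x *\<^sub>R v x - g2 x) \<le> e * \<bar>m x\<bar>"
          using trans unfolding P_def by fastforce
        define g where "g x = (if x \<le> q then g1 x else g2 x)" for x
        have "g integrable_on {p..q}" by (rule integrable_eq[OF g1(1)]) (auto simp: g_def)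
        moreover have "g integrable_on {q..r}"
          by (rule integrable_spike_finite[of "{q}", OF _ _ g2(1)]) (auto simp: g_def)
        ultimately have "g integrable_on {p..r}"
          using trans by (intro Henstock_Kurzweil_Integration.integrable_combine[of p q r]) auto
        moreover have "\<forall>x\<in>{p..r}. norm (m x *\<^sub>R v x - g x) \<le> e * \<bar>m x\<bar>"
          using g1(2) g2(2) by (auto simp: g_def)
        ultimately show "\<exists>g. g integrable_on {p..r} \<and> (\<forall>x\<in>{p..r}. norm (m x *\<^sub>R v x - g x) \<le> e * \<bar>m x\<bar>)"
          by blast
      qed
    next
      case (local x)
      then have "x \<in> {a..b}" by simp
      then obtain d where d: "d > 0" "\<And>y. y \<in> {a..b} \<Longrightarrow> dist y x < d \<Longrightarrow> dist (v y) (v x) < e"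
        using v \<open>e > 0\<close> unfolding continuous_on_iff by metis
      have "P p q" if pq: "p \<le> x" "x \<le> q" "q - p < d" for p q
        unfolding P_def
      proof (intro impI exI[of _ "\<lambda>t. m t *\<^sub>R v x"] conjI ballI)
        assume ab: "a \<le> p \<and> q \<le> b"
        have "m integrable_on {p..q}" using mi ab by (rule_tac integrable_subinterval_real) auto
        then show "(\<lambda>t. m t *\<^sub>R v x) integrable_on {p..q}"
          by (rule integrable_on_scaleR_left)
        fix y assume y: "y \<in> {p..q}"
        then have "norm (v y - v x) < e" using d(2)[of y] pq ab by (auto simp: dist_norm)
        moreover have "m y *\<^sub>R v y - m y *\<^sub>R v x = m y *\<^sub>R (v y - v x)" by (simp add: scaleR_diff_right)
        ultimately show "norm (m y *\<^sub>R v y - m y *\<^sub>R v x) \<le> e * \<bar>m y\<bar>"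
          using mult_right_mono[of "norm (v y - v x)" e "\<bar>m y\<bar>"] by (simp add: mult.commute)
      qed
      then show ?case using d(1) by (intro exI[of _ d]) auto
    qed
    then show "\<exists>g. g integrable_on {a..b} \<and> (\<forall>x\<in>{a..b}. norm (m x *\<^sub>R v x - g x) \<le> e * \<bar>m x\<bar>)"
      by (simp add: P_def)
  qed
qed auto

text \<open>Increments of B are O(|s - t|), so a remainder that is o of them is o(|s - t|). It is
  applied with B the primitive of an L1 weight: a remainder controlled only through such a weight
  has derivative zero wherever that primitive is differentiable.\<close>

lemma has_vector_derivative_zero_dominated:
  fixes R :: "real \<Rightarrow> 'a::real_normed_vector" and B :: "real \<Rightarrow> real"
  assumes B: "(B has_vector_derivative B') (at t)"
    and le: "\<And>e. e > 0 \<Longrightarrow> \<forall>\<^sub>F s in at t. norm (R s - R t) \<le> e * \<bar>B s - B t\<bar>"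
  shows "(R has_vector_derivative 0) (at t)"
proof -
  have "\<exists>d>0. \<forall>s. \<bar>s - t\<bar> < d \<longrightarrow> norm (R s - R t) \<le> e * \<bar>s - t\<bar>" if "e > 0" for e
  proof -
    have "(B has_derivative (\<lambda>x. x *\<^sub>R B')) (at t)" using B by (simp add: has_vector_derivative_def)
    then obtain d1 where d1: "d1 > 0" "\<And>s. \<bar>s - t\<bar> < d1 \<Longrightarrow> norm (B s - B t - (s - t) *\<^sub>R B') \<le> 1 * \<bar>s - t\<bar>"
      unfolding has_derivative_within_alt by (metis UNIV_I real_norm_def zero_less_one)
    define e1 where "e1 = e / (\<bar>B'\<bar> + 1)"
    have e1: "e1 > 0" "e1 * (\<bar>B'\<bar> + 1) = e" using \<open>e > 0\<close> by (auto simp: e1_def add_nonneg_eq_0_iff)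
    obtain d2 where d2: "d2 > 0" "\<And>s. s \<noteq> t \<Longrightarrow> \<bar>s - t\<bar> < d2 \<Longrightarrow> norm (R s - R t) \<le> e1 * \<bar>B s - B t\<bar>"
      using le[OF e1(1)] unfolding eventually_at by (auto simp: dist_real_def)
    have "norm (R s - R t) \<le> e * \<bar>s - t\<bar>" if s: "\<bar>s - t\<bar> < min d1 d2" for s
    proof (cases "s = t")
      case False
      have "norm (B s - B t - (s - t) *\<^sub>R B') \<le> 1 * \<bar>s - t\<bar>" using d1(2) s by simp
      then have "\<bar>B s - B t\<bar> \<le> \<bar>s - t\<bar> + \<bar>(s - t) * B'\<bar>" by simp
      also have "\<dots> = (\<bar>B'\<bar> + 1) * \<bar>s - t\<bar>" by (simp add: abs_mult distrib_left mult.commute)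
      finally have "e1 * \<bar>B s - B t\<bar> \<le> e1 * ((\<bar>B'\<bar> + 1) * \<bar>s - t\<bar>)" using e1(1) by (intro mult_left_mono) auto
      also have "\<dots> = e * \<bar>s - t\<bar>" using e1(2) by (simp flip: mult.assoc)
      finally show ?thesis using d2(2)[of s] False s by auto
    qed auto
    then show ?thesis using d1(1) d2(1) by (intro exI[of _ "min d1 d2"]) auto
  qed
  then show ?thesis
    unfolding has_vector_derivative_def has_derivative_within_alt by (auto intro: bounded_linear_zero)
qed

lemma integral_diff_interval:
  fixes f :: "real \<Rightarrow> 'a::banach"
  assumes "f integrable_on {a..b}" "a \<le> s" "s \<le> t" "t \<le> b"
  shows "integral {a..t} f - integral {a..s} f = integral {s..t} f"
  using Henstock_Kurzweil_Integration.integral_combine[of a s t f] assms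
    integrable_subinterval_real[OF assms(1), of a t] by (simp add: algebra_simps)

text \<open>Reduction to two scalar facts, differentiability at t of the primitives of m and of its
  absolute value. Freezing v at t leaves a scalar primitive times a fixed vector; the remainder R is
  dominated by the primitive of the absolute value, because v is continuous at t.\<close>

lemma primitive_scaleR_has_vector_derivative_AE:
  fixes m :: "real \<Rightarrow> real" and v :: "real \<Rightarrow> 'a::banach"
  assumes m: "m absolutely_integrable_on {a..b}" and v: "continuous_on {a..b} v"
  shows "AE t in lebesgue. t \<in> {a<..<b} \<longrightarrow>
    ((\<lambda>t. integral {a..t} (\<lambda>s. m s *\<^sub>R v s)) has_vector_derivative m t *\<^sub>R v t) (at t)"
proof -
  have mi: "m integrable_on {a..b}" and mabs: "(\<lambda>t. \<bar>m t\<bar>) integrable_on {a..b}"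
    using m by (auto simp: absolutely_integrable_on_def)
  have mv: "(\<lambda>t. m t *\<^sub>R v t) integrable_on {a..b}" by (rule integrable_on_scaleR_continuous[OF m v])
  let ?A = "\<lambda>t. integral {a..t} m" and ?B = "\<lambda>t. integral {a..t} (\<lambda>s. \<bar>m s\<bar>)"
  let ?I = "\<lambda>t. integral {a..t} (\<lambda>s. m s *\<^sub>R v s)"
  show ?thesis
    using lebesgue_differentiation_real[OF mi] lebesgue_differentiation_real[OF mabs]
  proof eventually_elim
    case (elim t)
    show ?case
    proof
      assume t: "t \<in> {a<..<b}"
      have A: "(?A has_vector_derivative m t) (at t)" and B: "(?B has_vector_derivative \<bar>m t\<bar>) (at t)"
        using elim t by auto
      define R where "R s = ?I s - ?A s *\<^sub>R v t" for s
      have bound: "norm (R q - R p) \<le> e * \<bar>?B q - ?B p\<bar>"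
        if pq: "a \<le> p" "p \<le> q" "q \<le> b" and e: "\<And>s. s \<in> {p..q} \<Longrightarrow> norm (v s - v t) \<le> e" for p q e
      proof -
        have i1: "(\<lambda>s. m s *\<^sub>R v s) integrable_on {p..q}" "m integrable_on {p..q}" "(\<lambda>s. \<bar>m s\<bar>) integrable_on {p..q}"
          using mv mi mabs pq by (auto intro: integrable_subinterval_real)
        have i2: "(\<lambda>s. m s *\<^sub>R v t) integrable_on {p..q}"
          using i1(2) by (rule integrable_on_scaleR_left)
        have "R q - R p = (?I q - ?I p) - (?A q - ?A p) *\<^sub>R v t"
          by (simp add: R_def scaleR_diff_left)
        also have "\<dots> = integral {p..q} (\<lambda>s. m s *\<^sub>R v s) - integral {p..q} m *\<^sub>R v t"
          using pq by (simp add: integral_diff_interval[OF mv] integral_diff_interval[OF mi])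
        also have "integral {p..q} m *\<^sub>R v t = integral {p..q} (\<lambda>s. m s *\<^sub>R v t)"
          by (rule integral_unique[symmetric]) (intro has_integral_scaleR_left integrable_integral i1(2))
        also have "integral {p..q} (\<lambda>s. m s *\<^sub>R v s) - \<dots> = integral {p..q} (\<lambda>s. m s *\<^sub>R v s - m s *\<^sub>R v t)"
          using i1 i2 by (simp add: Henstock_Kurzweil_Integration.integral_diff)
        finally have eq: "R q - R p = integral {p..q} (\<lambda>s. m s *\<^sub>R v s - m s *\<^sub>R v t)" .
        have "norm (R q - R p) \<le> integral {p..q} (\<lambda>s. e * \<bar>m s\<bar>)"
          unfolding eq
        proof (rule integral_norm_bound_integral)
          fix s assume "s \<in> {p..q}"
          then show "norm (m s *\<^sub>R v s - m s *\<^sub>R v t) \<le> e * \<bar>m s\<bar>"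
            using mult_right_mono[OF e, of s "\<bar>m s\<bar>"] by (simp flip: scaleR_diff_right add: mult.commute)
        qed (use i1 i2 in \<open>auto intro: integrable_diff integrable_on_mult_right\<close>)
        also have "\<dots> = e * (?B q - ?B p)" using pq by (simp add: integral_diff_interval[OF mabs])
        also have "?B q - ?B p = \<bar>?B q - ?B p\<bar>"
          using pq i1(3) by (simp add: integral_diff_interval[OF mabs] Henstock_Kurzweil_Integration.integral_nonneg)
        finally show ?thesis .
      qed
      have "(R has_vector_derivative 0) (at t)"
      proof (rule has_vector_derivative_zero_dominated[OF B])
        fix e :: real assume "e > 0"
        obtain d where d: "d > 0" "\<And>s. s \<in> {a..b} \<Longrightarrow> dist s t < d \<Longrightarrow> dist (v s) (v t) < e"
          using v \<open>e > 0\<close> t unfolding continuous_on_iff by (metis greaterThanLessThan_iff atLeastAtMost_iff less_imp_le)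
        have "norm (R s - R t) \<le> e * \<bar>?B s - ?B t\<bar>"
          if s: "dist s t < Min {d, t - a, b - t}" for s
        proof (cases "t \<le> s")
          case True
          show ?thesis using True s t d(2) by (intro bound) (auto simp: dist_real_def dist_norm less_imp_le)
        next
          case False
          have "norm (R t - R s) \<le> e * \<bar>?B t - ?B s\<bar>"
            using False s t d(2) by (intro bound) (auto simp: dist_real_def dist_norm less_imp_le)
          then show ?thesis by (simp add: norm_minus_commute abs_minus_commute)
        qed
        moreover have "Min {d, t - a, b - t} > 0" using d t by simp
        ultimately show "\<forall>\<^sub>F s in at t. norm (R s - R t) \<le> e * \<bar>?B s - ?B t\<bar>"
          unfolding eventually_at by blast
      qed
      moreover have "((\<lambda>s. ?A s *\<^sub>R v t) has_vector_derivative m t *\<^sub>R v t) (at t)"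
        using A by (auto intro!: derivative_eq_intros has_vector_derivative_scaleR
            simp: has_real_derivative_iff_has_vector_derivative)
      ultimately have "((\<lambda>s. R s + ?A s *\<^sub>R v t) has_vector_derivative 0 + m t *\<^sub>R v t) (at t)"
        by (rule has_vector_derivative_add)
      then show "(?I has_vector_derivative m t *\<^sub>R v t) (at t)" by (simp add: R_def)
    qed
  qed
qed

section \<open>The scalar Skorokhod reflection\<close>

lemma integral_le_off_negligible:
  fixes f g :: "'a::euclidean_space \<Rightarrow> real"
  assumes "f integrable_on S" "g integrable_on S" "negligible N" "\<And>x. x \<in> S - N \<Longrightarrow> f x \<le> g x"
  shows "integral S f \<le> integral S g"
proof -
  define f' where "f' x = (if x \<in> N then g x else f x)" for x
  have "f' integrable_on S" by (rule integrable_spike[OF assms(1,3)]) (auto simp: f'_def)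
  moreover have "integral S f' = integral S f" by (rule integral_spike[OF assms(3)]) (auto simp: f'_def)
  moreover have "f' x \<le> g x" if "x \<in> S" for x using assms(4) that by (auto simp: f'_def)
  ultimately show ?thesis using integral_le[of f' S g] assms(2) by simp
qed

text \<open>Every point chooses a rational in the gap to its right, and disjoint gaps give distinct
  rationals. It makes the exceptional times of the reflection arguments countable, hence
  null.\<close>

lemma countable_right_isolated:
  fixes C :: "real set"
  assumes "\<And>s. s \<in> C \<Longrightarrow> \<exists>d>0. \<forall>t\<in>C. \<not> (s < t \<and> t < s + d)"
  shows "countable C"
proof -
  obtain d where d: "\<And>s. s \<in> C \<Longrightarrow> d s > 0" "\<And>s t. s \<in> C \<Longrightarrow> t \<in> C \<Longrightarrow> \<not> (s < t \<and> t < s + d s)"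
    using assms by metis
  have "\<exists>q\<in>\<rat>. s < q \<and> q < s + d s" if "s \<in> C" for s
    using Rats_dense_in_real[of s "s + d s"] d(1)[OF that] by simp
  then obtain q where q: "\<And>s. s \<in> C \<Longrightarrow> q s \<in> \<rat> \<and> s < q s \<and> q s < s + d s" by metis
  have "inj_on q C"
  proof (rule linorder_inj_onI)
    fix x y assume "x < y" "x \<in> C" "y \<in> C"
    then show "q x \<noteq> q y" using d(2)[of x y] q[of x] q[of y] by auto
  qed auto
  moreover have "countable (q ` C)"
    by (rule countable_subset[OF _ countable_rat]) (use q in auto)
  ultimately show ?thesis by (rule countable_image_inj_on[rotated])
qed

text \<open>The Skorokhod problem in terms of densities: m pushes the path down, only while it sits
  at the barrier 1. The conditions are imposed at every time and not almost everywhere, so that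
  arguments by sign can be made pointwise; representatives of m must therefore be chosen with
  care.\<close>

definition skorokhod :: "real \<Rightarrow> real \<Rightarrow> (real \<Rightarrow> real) \<Rightarrow> (real \<Rightarrow> real) \<Rightarrow> bool" where
  "skorokhod T y0 f m \<longleftrightarrow> m absolutely_integrable_on {0..T} \<and>
     (\<forall>t\<in>{0..T}. 0 \<le> m t \<and> y0 + integral {0..t} f - integral {0..t} m \<le> 1 \<and>
        (m t \<noteq> 0 \<longrightarrow> y0 + integral {0..t} f - integral {0..t} m = 1))"

text \<open>k is the running maximum of the positive part of y. Off contact it is locally constant.
  At a contact time it follows y to the right, while on the left it may have been flat although y
  arrives with positive slope; then the one-sided derivatives disagree, and \<open>noflat\<close>
  excludes exactly this.\<close>

lemma running_max_has_derivative:
  fixes y k :: "real \<Rightarrow> real"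
  assumes t: "t \<in> {0<..<T}" and der: "(y has_vector_derivative f) (at t)"
    and ub: "\<And>s t. 0 \<le> s \<Longrightarrow> s \<le> t \<Longrightarrow> t \<le> T \<Longrightarrow> y s \<le> k t"
    and nn: "\<And>t. t \<in> {0..T} \<Longrightarrow> 0 \<le> k t"
    and att: "\<And>t. t \<in> {0..T} \<Longrightarrow> \<exists>s\<in>{0..t}. k t = max 0 (y s)"
    and mono: "\<And>s t. 0 \<le> s \<Longrightarrow> s \<le> t \<Longrightarrow> t \<le> T \<Longrightarrow> k s \<le> k t"
    and noflat: "\<And>s. f > 0 \<Longrightarrow> y t = k t \<Longrightarrow> s \<in> {0..<t} \<Longrightarrow> k s < k t"
  shows "(k has_vector_derivative (if y t = k t then max 0 f else 0)) (at t)"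
proof (cases "y t = k t")
  case False
  then have lt: "y t < k t" using ub[of t t] t by auto
  have "(y \<longlongrightarrow> y t) (nhds t)"
    using has_vector_derivative_continuous[OF der] by (simp add: isCont_def tendsto_at_iff_tendsto_nhds)
  then have "\<forall>\<^sub>F s in nhds t. y s < k t \<and> s \<in> {0<..<T}"
    using lt t by (intro eventually_conj order_tendstoD(2) eventually_nhds_in_open) auto
  then obtain d where d: "d > 0" "\<And>s. dist s t < d \<Longrightarrow> y s < k t \<and> s \<in> {0<..<T}"
    unfolding eventually_nhds_metric by blast
  have const: "k t = k s" if s: "s \<in> ball t d" for s
  proof -
    have s': "s \<in> {0<..<T}" using d(2)[of s] s by (simp add: dist_commute)
    show ?thesis
    proof (cases "t \<le> s")
      case True
      obtain r where r: "r \<in> {0..s}" "k s = max 0 (y r)" using att[of s] s' by auto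
      have "k s \<le> k t"
      proof (cases "r \<le> t")
        case True then show ?thesis using r ub[of r t] nn[of t] t by auto
      next
        case False
        then have "dist r t < d" using r s by (auto simp: dist_real_def)
        then have "y r < k t" using d(2) by blast
        then show ?thesis using r nn[of t] t by auto
      qed
      then show ?thesis using mono[of t s] True s' t by auto
    next
      case False
      obtain r where r: "r \<in> {0..t}" "k t = max 0 (y r)" using att[of t] t by auto
      have "k t \<le> k s"
      proof (cases "r \<le> s")
        case True then show ?thesis using r ub[of r s] nn[of s] s' by auto
      next
        case F: False
        then have "dist r t < d" using r s False by (auto simp: dist_real_def)
        then have "y r < k t" using d(2) by blast
        then have "k t = 0" using r by auto
        then show ?thesis using nn[of s] s' by auto
      qed
      then show ?thesis using mono[of s t] False s' t by auto
    qed
  qed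
  have "(k has_vector_derivative 0) (at t)"
  proof (rule has_vector_derivative_transform_within_open[where S="ball t d"])
    show "((\<lambda>_. k t) has_vector_derivative 0) (at t)" by (rule has_vector_derivative_const)
    show "t \<in> ball t d" using d(1) by simp
  qed (fact open_ball const)+
  then show ?thesis using False by simp
next
  case True
  have yd: "\<exists>d>0. \<forall>s. \<bar>s - t\<bar> < d \<longrightarrow> \<bar>y s - y t - (s - t) * f\<bar> \<le> e * \<bar>s - t\<bar>" if "e > 0" for e
    using der that unfolding has_vector_derivative_def has_derivative_within_alt by auto
  \<comment> \<open>A negative slope would put y above its contact value \<open>k t\<close> shortly
    before t.\<close>
  have "f \<ge> 0"
  proof (rule ccontr)
    assume "\<not> f \<ge> 0"
    then obtain d where d: "d > 0" "\<And>s. \<bar>s - t\<bar> < d \<Longrightarrow> \<bar>y s - y t - (s - t) * f\<bar> \<le> (-f/2) * \<bar>s - t\<bar>"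
      using yd[of "-f/2"] by auto
    define s where "s = t - min (d/2) t"
    have s: "s < t" "0 \<le> s" "\<bar>s - t\<bar> < d" using d(1) t by (auto simp: s_def)
    have "\<bar>y s - y t - (s - t) * f\<bar> \<le> (-f/2) * (t - s)" using d(2)[OF s(3)] s(1) by simp
    moreover have "y s \<le> y t" using ub[of s t] True s t by auto
    moreover have "(t - s) * f < 0" using s(1) \<open>\<not> f \<ge> 0\<close> by (simp add: mult_pos_neg)
    moreover have "(s - t) * f = - ((t - s) * f)" "(-f/2) * (t - s) = - ((t - s) * f) / 2"
      by (simp_all add: field_simps)
    ultimately show False by argo
  qed
  have "\<exists>d>0. \<forall>s. \<bar>s - t\<bar> < d \<longrightarrow> \<bar>k s - k t - (s - t) * f\<bar> \<le> e * \<bar>s - t\<bar>" if e: "e > 0" for e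
  proof -
    obtain d0 where d0: "d0 > 0" "\<And>s. \<bar>s - t\<bar> < d0 \<Longrightarrow> \<bar>y s - y t - (s - t) * f\<bar> \<le> e * \<bar>s - t\<bar>"
      using yd[OF e] by auto
    define d where "d = Min {d0, t, T - t}"
    have d: "d > 0" "d \<le> d0" "d \<le> t" "d \<le> T - t" using d0 t by (auto simp: d_def)
    have up: "y r \<le> y t + (f + e) * (r - t)" "y r \<ge> y t + (f - e) * (r - t)" if "t \<le> r" "r - t < d" for r
      using d0(2)[of r] d(2) that by (auto simp: abs_le_iff algebra_simps)
    have dn: "y t - y r \<le> (f + e) * (t - r)" "y t - y r \<ge> (f - e) * (t - r)" if "r \<le> t" "t - r < d" for r
      using d0(2)[of r] d(2) that by (auto simp: abs_le_iff algebra_simps)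
    have right: "\<bar>k s - k t - (s - t) * f\<bar> \<le> e * \<bar>s - t\<bar>" if s: "t \<le> s" "s - t < d" for s
    proof -
      have sT: "s \<le> T" "0 \<le> s" using s d t by auto
      have 1: "k s \<ge> y t + (f - e) * (s - t)" using up(2)[OF s] ub[of s s] sT by linarith
      obtain r where r: "r \<in> {0..s}" "k s = max 0 (y r)" using att[of s] sT by auto
      have pos: "(f + e) * (s - t) \<ge> 0" using \<open>f \<ge> 0\<close> e s by simp
      have 2: "k s \<le> k t + (f + e) * (s - t)"
      proof (cases "r \<le> t")
        case True then show ?thesis using r ub[of r t] nn[of t] t pos by auto
      next
        case False
        have "y r \<le> y t + (f + e) * (r - t)" using up(1)[of r] False r s by auto
        also have "\<dots> \<le> y t + (f + e) * (s - t)" using \<open>f \<ge> 0\<close> e r by (simp add: mult_left_mono)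
        finally show ?thesis using r nn[of t] True t pos by auto
      qed
      show ?thesis using 1 2 s True by (simp add: abs_le_iff algebra_simps)
    qed
    have left1: "k t - k s \<le> (f + e) * (t - s)" if s: "s \<le> t" "t - s < d" for s
      using dn(1)[OF s] ub[of s s] s d t True by auto
    have "\<exists>d'>0. \<forall>s. s \<le> t \<longrightarrow> t - s < d' \<longrightarrow> k t - k s \<ge> (f - e) * (t - s)"
    proof (cases "e < f")
      case False
      have "k t - k s \<ge> (f - e) * (t - s)" if "s \<le> t" "t - s < d" for s
      proof -
        have "(f - e) * (t - s) \<le> 0" using False that by (simp add: mult_nonpos_nonneg)
        moreover have "k s \<le> k t" using that d t by (intro mono) auto
        ultimately show ?thesis by linarith
      qed
      then show ?thesis using d(1) by blast
    next
      case ef: True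
      \<comment> \<open>A maximizer r of y on {0..s} lies before or after s1. Before,
        \<open>k s\<close> is at most \<open>k s1\<close>, and \<open>d'\<close> is so small that
        the fixed gap \<open>k t - k s1\<close> exceeds \<open>(f - e) * (t - s)\<close>. After, the
        slope estimate for y at r applies.\<close>
      define s1 where "s1 = t - d/2"
      have s1: "s1 \<in> {0..<t}" using d by (auto simp: s1_def)
      have gap: "k s1 < k t" using noflat[OF _ True s1] ef e by auto
      define d' where "d' = min (d/2) ((k t - k s1) / (f - e))"
      have "k t - k s \<ge> (f - e) * (t - s)" if s: "s \<le> t" "t - s < d'" for s
      proof -
        have s0: "0 \<le> s" "s \<le> T" "s1 < s" using s d t by (auto simp: d'_def s1_def)
        obtain r where r: "r \<in> {0..s}" "k s = max 0 (y r)" using att[of s] s0 by auto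
        have "(f - e) * (t - s) \<le> (f - e) * ((k t - k s1) / (f - e))"
          using s ef by (intro mult_left_mono) (auto simp: d'_def)
        then have g: "(f - e) * (t - s) \<le> k t - k s1" using ef by simp
        show ?thesis
        proof (cases "r \<le> s1 \<or> k s = 0")
          case True
          then have "k s \<le> k s1" using r ub[of r s1] nn[of s1] s1 t by auto
          then show ?thesis using g by linarith
        next
          case False
          then have "y t - y r \<ge> (f - e) * (t - r)" using r s by (intro dn(2)) (auto simp: s1_def)
          moreover have "(f - e) * (t - r) \<ge> (f - e) * (t - s)" using ef r by (intro mult_left_mono) auto
          moreover have "k s = y r" using False r by auto
          ultimately show ?thesis using True by linarith
        qed
      qed
      moreover have "d' > 0" using d gap ef by (auto simp: d'_def)
      ultimately show ?thesis by blast
    qed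
    then obtain d' where d': "d' > 0" "\<And>s. s \<le> t \<Longrightarrow> t - s < d' \<Longrightarrow> k t - k s \<ge> (f - e) * (t - s)" by blast
    have "\<bar>k s - k t - (s - t) * f\<bar> \<le> e * \<bar>s - t\<bar>" if s: "\<bar>s - t\<bar> < min d d'" for s
    proof (cases "t \<le> s")
      case True then show ?thesis using right[of s] s by auto
    next
      case False
      then show ?thesis using left1[of s] d'(2)[of s] s by (simp add: abs_le_iff algebra_simps)
    qed
    then show ?thesis using d(1) d'(1) by (intro exI[of _ "min d d'"]) auto
  qed
  then have "(k has_vector_derivative f) (at t)"
    unfolding has_vector_derivative_def has_derivative_within_alt by (auto intro: bounded_linear_mult_left)
  then show ?thesis using True \<open>f \<ge> 0\<close> by simp
qed

text \<open>The push is the running maximum k of the excess y over the barrier. Its increments are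
  bounded by those of the primitive of |f|, so k is the integral of its derivative m, which is the
  positive part of f at contact and 0 elsewhere. The bound of m by |f| is what later reproduces the
  a priori bound \<open>M\<close>.\<close>

lemma skorokhod_exists:
  fixes f :: "real \<Rightarrow> real"
  assumes "T > 0" and f: "f absolutely_integrable_on {0..T}" and y0: "y0 \<le> 1"
  obtains m where "skorokhod T y0 f m" "\<And>t. 0 \<le> m t" "\<And>t. m t \<le> \<bar>f t\<bar>"
proof -
  have fi: "f integrable_on {0..T}" and fa: "(\<lambda>t. \<bar>f t\<bar>) integrable_on {0..T}"
    using f by (auto simp: absolutely_integrable_on_def)
  define y where "y t = y0 + integral {0..t} f - 1" for t
  define k where "k t = Sup ((\<lambda>s. max 0 (y s)) ` {0..t})" for t
  have ycont: "continuous_on {0..T} y"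
    unfolding y_def by (intro continuous_intros indefinite_integral_continuous_1 fi)
  have att: "\<exists>s\<in>{0..t}. k t = max 0 (y s) \<and> (\<forall>r\<in>{0..t}. max 0 (y r) \<le> k t)" if "t \<in> {0..T}" for t
  proof -
    have "continuous_on {0..t} (\<lambda>s. max 0 (y s))"
      by (intro continuous_intros continuous_on_subset[OF ycont]) (use that in auto)
    then have "\<exists>s\<in>{0..t}. \<forall>r\<in>{0..t}. max 0 (y r) \<le> max 0 (y s)"
      using that by (intro continuous_attains_sup) auto
    then obtain s where s: "s \<in> {0..t}" "\<And>r. r \<in> {0..t} \<Longrightarrow> max 0 (y r) \<le> max 0 (y s)" by blast
    have "k t = max 0 (y s)" unfolding k_def
      by (rule cSup_eq_maximum) (use s in auto)
    then show ?thesis using s by auto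
  qed
  have att1: "\<exists>s\<in>{0..t}. k t = max 0 (y s)" and att2: "\<And>r. r \<in> {0..t} \<Longrightarrow> max 0 (y r) \<le> k t"
    if "t \<in> {0..T}" for t using att[OF that] by blast+
  have ub: "y s \<le> k t" if "0 \<le> s" "s \<le> t" "t \<le> T" for s t
    using att2[of t s] that by simp
  have nn: "0 \<le> k t" if "t \<in> {0..T}" for t using att2[OF that, of t] that by simp
  have mono: "k s \<le> k t" if st: "0 \<le> s" "s \<le> t" "t \<le> T" for s t
  proof -
    obtain r where "r \<in> {0..s}" "k s = max 0 (y r)" using att1[of s] st by auto
    then show ?thesis using ub[of r t] nn[of t] st by auto
  qed
  have yincr: "y t - y s \<le> integral {s..t} (\<lambda>t. \<bar>f t\<bar>)" if "0 \<le> s" "s \<le> t" "t \<le> T" for s t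
  proof -
    have "y t - y s = integral {s..t} f" using that by (simp add: y_def integral_diff_interval[OF fi])
    also have "\<dots> \<le> integral {s..t} (\<lambda>t. \<bar>f t\<bar>)"
      using that by (intro integral_le integrable_subinterval_real[OF fi] integrable_subinterval_real[OF fa]) auto
    finally show ?thesis .
  qed
  have incr: "norm (k t - k s) \<le> integral {s..t} (\<lambda>t. \<bar>f t\<bar>)" if st: "0 \<le> s" "s \<le> t" "t \<le> T" for s t
  proof -
    obtain r where r: "r \<in> {0..t}" "k t = max 0 (y r)" using att1[of t] st by auto
    have int: "integral {s..t} (\<lambda>t. \<bar>f t\<bar>) \<ge> 0"
      using that by (intro Henstock_Kurzweil_Integration.integral_nonneg integrable_subinterval_real[OF fa]) auto
    have "k t - k s \<le> integral {s..t} (\<lambda>t. \<bar>f t\<bar>)"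
    proof (cases "r \<le> s")
      case True then show ?thesis using r ub[of r s] nn[of s] that int by auto
    next
      case False
      have "y r - y s \<le> integral {s..r} (\<lambda>t. \<bar>f t\<bar>)" using False r that by (intro yincr) auto
      also have "\<dots> \<le> integral {s..t} (\<lambda>t. \<bar>f t\<bar>)"
        using r that by (intro integral_subset_le integrable_subinterval_real[OF fa]) auto
      finally show ?thesis using r ub[of s s] nn[of s] that int by auto
    qed
    then show ?thesis using mono[OF that] by simp
  qed
  define m where "m t = (if y t = k t then max 0 (f t) else 0)" for t
  \<comment> \<open>Contact times with positive slope that end a flat stretch of k. Inside the flat
    stretch before t there is no other such time r: right after r the path y would exceed
    \<open>k r = k t\<close>. So C is isolated from the left, and reflection turns this into
    isolation from the right.\<close>
  define C where "C = {t \<in> {0<..<T}. (y has_vector_derivative f t) (at t) \<and> f t > 0 \<and> y t = k t \<and> (\<exists>s\<in>{0..<t}. k s = k t)}"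
  have "countable (uminus ` C)"
  proof (rule countable_right_isolated)
    fix t' assume "t' \<in> uminus ` C"
    then obtain t where t: "t \<in> C" "t' = - t" by auto
    then obtain s where s: "s \<in> {0..<t}" "k s = k t" by (auto simp: C_def)
    have "\<not> (- t < r' \<and> r' < - t + (t - s))" if r': "r' \<in> uminus ` C" for r'
    proof
      assume lt: "- t < r' \<and> r' < - t + (t - s)"
      obtain r where r: "r \<in> C" "r' = - r" using r' by auto
      have rt: "s < r" "r < t" using lt r by auto
      have tT: "t < T" using t by (auto simp: C_def)
      have eq: "k t = k r" using mono[of s r] mono[of r t] s rt tT by auto
      have "(y has_vector_derivative f r) (at r)" "f r > 0" "y r = k r" using r by (auto simp: C_def)
      then have "(y has_real_derivative f r) (at r)" "f r > 0"
        by (auto simp: has_real_derivative_iff_has_vector_derivative)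
      then obtain d where d: "d > 0" "\<And>h. 0 < h \<Longrightarrow> h < d \<Longrightarrow> y r < y (r + h)"
        using DERIV_pos_inc_right by blast
      define h where "h = min (d/2) (t - r)"
      have "0 < h" "h < d" "r + h \<le> t" using d rt by (auto simp: h_def)
      then have "y r < k t" using d(2)[of h] ub[of "r+h" t] rt s tT by auto
      then show False using eq \<open>y r = k r\<close> by simp
    qed
    then show "\<exists>d>0. \<forall>r\<in>uminus ` C. \<not> (t' < r \<and> r < t' + d)"
      using s t(2) by (intro exI[of _ "t - s"]) auto
  qed
  then have "countable C"
    by (metis countable_image_inj_on[of uminus C] inj_on_def neg_equal_iff_equal)
  then have negC: "negligible C"
    by (simp add: negligible_iff_null_sets null_sets_completionI countable_imp_null_set_lborel)
  have der: "AE t in lebesgue. t \<in> {0<..<T} \<longrightarrow> (k has_vector_derivative m t) (at t)"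
    using lebesgue_differentiation_real[OF fi] negC[unfolded negligible_iff_null_sets, THEN AE_not_in]
  proof eventually_elim
    case (elim t)
    show ?case
    proof
      assume t: "t \<in> {0<..<T}"
      have yder: "(y has_vector_derivative f t) (at t)"
        unfolding y_def using elim t by (auto intro!: derivative_eq_intros)
      show "(k has_vector_derivative m t) (at t)"
        unfolding m_def
      proof (rule running_max_has_derivative[OF t yder ub nn _ mono])
        show "k s < k t" if "f t > 0" "y t = k t" "s \<in> {0..<t}" for s
          using elim(2) t that yder mono[of s t] unfolding C_def by force
      qed (assumption | fact att1)+
    qed
  qed
  have k0: "k 0 = 0" using att1[of 0] \<open>T > 0\<close> y0 by (auto simp: y_def)
  have mint: "(m has_integral k t) {0..t}" if "t \<in> {0..T}" for t
  proof -
    have "(m has_integral k t - k 0) {0..t}"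
    proof (rule has_integral_derivative_AE[where \<phi>="\<lambda>t. \<bar>f t\<bar>"])
      show "AE s in lebesgue. s \<in> {0<..<t} \<longrightarrow> (k has_vector_derivative m s) (at s)"
        using der by eventually_elim (use that in auto)
    qed (use that incr fa in \<open>auto intro: integrable_subinterval_real\<close>)
    then show ?thesis using k0 by simp
  qed
  have m0: "0 \<le> m t" "m t \<le> \<bar>f t\<bar>" for t by (auto simp: m_def)
  have "m absolutely_integrable_on {0..T}"
    using mint[of T] \<open>T > 0\<close> m0 by (intro nonnegative_absolutely_integrable_1) (auto simp: integrable_on_def)
  moreover have "y0 + integral {0..t} f - integral {0..t} m \<le> 1 \<and>
        (m t \<noteq> 0 \<longrightarrow> y0 + integral {0..t} f - integral {0..t} m = 1)" if t: "t \<in> {0..T}" for t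
  proof -
    have "y0 + integral {0..t} f - integral {0..t} m = y t - k t + 1"
      using integral_unique[OF mint[OF t]] by (simp add: y_def)
    moreover have "y t \<le> k t" using ub[of t t] t by auto
    ultimately show ?thesis by (auto simp: m_def split: if_splits)
  qed
  ultimately have "skorokhod T y0 f m" unfolding skorokhod_def using m0 by blast
  then show thesis using that m0 by blast
qed

text \<open>With h the difference of the reflected paths, |h| is differentiated. Where h > 0 the
  second path is below 1, so m2 vanishes and the densities enter the derivative with the favourable
  sign; h < 0 is symmetric. Where h = 0 its derivative is almost everywhere 0, so both differences
  agree. Since |h| starts at 0 and is nonnegative, integration gives the estimate with constant
  1.\<close>

lemma skorokhod_contraction:
  assumes f1: "f1 absolutely_integrable_on {0..T}" and f2: "f2 absolutely_integrable_on {0..T}"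
    and s1: "skorokhod T y0 f1 m1" and s2: "skorokhod T y0 f2 m2" and t: "t \<in> {0..T}"
  shows "integral {0..t} (\<lambda>s. \<bar>m1 s - m2 s\<bar>) \<le> integral {0..t} (\<lambda>s. \<bar>f1 s - f2 s\<bar>)"
proof -
  have m1: "m1 absolutely_integrable_on {0..T}" and m2: "m2 absolutely_integrable_on {0..T}"
    using s1 s2 by (auto simp: skorokhod_def)
  define \<eta> where "\<eta> s = f1 s - f2 s - (m1 s - m2 s)" for s
  define h where "h s = integral {0..s} \<eta>" for s
  have \<eta>: "\<eta> absolutely_integrable_on {0..T}"
    unfolding \<eta>_def by (intro set_integral_diff f1 f2 m1 m2)
  then have \<eta>i: "\<eta> integrable_on {0..T}" and \<eta>a: "(\<lambda>s. \<bar>\<eta> s\<bar>) integrable_on {0..T}"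
    by (auto simp: absolutely_integrable_on_def)
  have sub: "g absolutely_integrable_on {0..T} \<Longrightarrow> s \<in> {0..T} \<Longrightarrow> g integrable_on {0..s}" for g :: "real \<Rightarrow> real" and s
    by (auto simp: absolutely_integrable_on_def intro: integrable_subinterval_real)
  have h_eq: "h s = (y0 + integral {0..s} f1 - integral {0..s} m1) - (y0 + integral {0..s} f2 - integral {0..s} m2)"
    if "s \<in> {0..T}" for s
    unfolding h_def \<eta>_def using sub[OF f1 that] sub[OF f2 that] sub[OF m1 that] sub[OF m2 that]
    by (simp add: Henstock_Kurzweil_Integration.integral_diff integrable_diff)
  \<comment> \<open>Zeros of h with nonzero derivative are isolated, hence countable. Outside them
    and the null set of nondifferentiability, h = 0 forces \<eta> = 0.\<close>
  define C where "C = {s. h s = 0 \<and> (\<exists>D. D \<noteq> 0 \<and> (h has_real_derivative D) (at s))}"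
  have "countable C"
  proof (rule countable_right_isolated)
    fix s assume "s \<in> C"
    then obtain D where D: "h s = 0" "D \<noteq> 0" "(h has_real_derivative D) (at s)" by (auto simp: C_def)
    have "\<exists>d>0. \<forall>e>0. e < d \<longrightarrow> h (s + e) \<noteq> 0"
    proof (cases "D > 0")
      case True
      then show ?thesis using DERIV_pos_inc_right[OF D(3)] D(1) by force
    next
      case False
      then show ?thesis using DERIV_neg_dec_right[OF D(3)] D(1,2) by force
    qed
    then obtain d where d: "d > 0" "\<And>e. e > 0 \<Longrightarrow> e < d \<Longrightarrow> h (s + e) \<noteq> 0" by blast
    have "\<not> (s < t \<and> t < s + d)" if "t \<in> C" for t
      using d(2)[of "t - s"] that by (auto simp: C_def)
    then show "\<exists>d>0. \<forall>t\<in>C. \<not> (s < t \<and> t < s + d)" using d(1) by blast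
  qed
  then have negC: "negligible C"
    by (simp add: negligible_iff_null_sets null_sets_completionI countable_imp_null_set_lborel)
  define D where "D s = (if h s = 0 then 0 else sgn (h s) * \<eta> s)" for s
  have "AE s in lebesgue. s \<in> {0<..<T} \<longrightarrow> (h has_vector_derivative \<eta> s) (at s) \<and> s \<notin> C"
    using lebesgue_differentiation_real[OF \<eta>i] negC[unfolded negligible_iff_null_sets, THEN AE_not_in]
    by eventually_elim (auto simp: h_def[abs_def])
  then obtain N where N: "negligible N"
    "\<And>s. s \<in> {0..T} - N \<Longrightarrow> s \<in> {0<..<T} \<and> (h has_vector_derivative \<eta> s) (at s) \<and> s \<notin> C"
    by (rule AE_interior_obtain_negligible) blast
  have \<eta>0: "\<eta> s = 0" if "s \<in> {0..T} - N" "h s = 0" for s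
    using N(2)[OF that(1)] that(2) unfolding C_def by (auto simp: has_real_derivative_iff_has_vector_derivative)
  have Dder: "((\<lambda>s. \<bar>h s\<bar>) has_vector_derivative D s) (at s)" if s: "s \<in> {0..T} - N" for s
  proof (cases "h s = 0")
    case True
    have "(h has_derivative (\<lambda>x. x *\<^sub>R 0)) (at s)"
      using N(2)[OF s] \<eta>0[OF s True] by (simp add: has_vector_derivative_def)
    then show ?thesis using True unfolding has_vector_derivative_def has_derivative_within_alt D_def by auto
  next
    case False
    have hd: "(h has_vector_derivative \<eta> s) (at s)" using N(2)[OF s] by blast
    have "(h \<longlongrightarrow> h s) (nhds s)"
      using has_vector_derivative_continuous[OF hd] by (simp add: isCont_def tendsto_at_iff_tendsto_nhds)
    then have ev: "\<forall>\<^sub>F r in nhds s. \<bar>h r\<bar> = sgn (h s) * h r"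
    proof (cases "h s > 0")
      case True
      then show ?thesis using order_tendstoD(1)[OF \<open>(h \<longlongrightarrow> h s) (nhds s)\<close>, of 0]
        by (auto elim!: eventually_mono)
    next
      case F: False
      then have "h s < 0" using False by simp
      then show ?thesis using order_tendstoD(2)[OF \<open>(h \<longlongrightarrow> h s) (nhds s)\<close>, of 0]
        by (auto elim!: eventually_mono)
    qed
    have "((\<lambda>r. sgn (h s) * h r) has_real_derivative sgn (h s) * \<eta> s) (at s)"
      using hd by (intro DERIV_cmult) (simp add: has_real_derivative_iff_has_vector_derivative)
    then have "((\<lambda>r. \<bar>h r\<bar>) has_real_derivative sgn (h s) * \<eta> s) (at s)"
      using DERIV_cong_ev[OF refl ev refl] by blast
    then show ?thesis using False by (simp add: has_real_derivative_iff_has_vector_derivative D_def)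
  qed
  have Dint: "(D has_integral \<bar>h t\<bar> - \<bar>h 0\<bar>) {0..t}"
  proof (rule has_integral_derivative_AE[where F="\<lambda>s. \<bar>h s\<bar>" and \<phi>="\<lambda>s. \<bar>\<eta> s\<bar>"])
    show "AE s in lebesgue. s \<in> {0<..<t} \<longrightarrow> ((\<lambda>s. \<bar>h s\<bar>) has_vector_derivative D s) (at s)"
      using N(1)[unfolded negligible_iff_null_sets, THEN AE_not_in]
      by eventually_elim (use Dder t in auto)
    show "norm (\<bar>h q\<bar> - \<bar>h p\<bar>) \<le> integral {p..q} (\<lambda>s. \<bar>\<eta> s\<bar>)" if "0 \<le> p" "p \<le> q" "q \<le> t" for p q
    proof -
      have "h q - h p = integral {p..q} \<eta>" using that t by (simp add: h_def integral_diff_interval[OF \<eta>i])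
      also have "\<bar>\<dots>\<bar> \<le> integral {p..q} (\<lambda>s. \<bar>\<eta> s\<bar>)"
        using that t integral_norm_bound_integral[OF integrable_subinterval_real[OF \<eta>i] integrable_subinterval_real[OF \<eta>a], of p q]
        by auto
      finally show ?thesis using abs_triangle_ineq3[of "h q" "h p"] by simp
    qed
  qed (use t \<eta>a in \<open>auto intro: integrable_subinterval_real\<close>)
  have ff: "(\<lambda>s. f1 s - f2 s) absolutely_integrable_on {0..T}" and mm: "(\<lambda>s. m1 s - m2 s) absolutely_integrable_on {0..T}"
    by (intro set_integral_diff f1 f2 m1 m2)+
  have fa: "(\<lambda>s. \<bar>f1 s - f2 s\<bar>) integrable_on {0..t}" and ma: "(\<lambda>s. \<bar>m1 s - m2 s\<bar>) integrable_on {0..t}"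
    using ff mm t by (auto simp: absolutely_integrable_on_def intro: integrable_subinterval_real)
  have h0: "h 0 = 0" by (simp add: h_def)
  have "0 \<le> \<bar>h t\<bar> - \<bar>h 0\<bar>" using h0 by simp
  also have "\<dots> = integral {0..t} D" using Dint by (simp add: integral_unique)
  also have "\<dots> \<le> integral {0..t} (\<lambda>s. \<bar>f1 s - f2 s\<bar> - \<bar>m1 s - m2 s\<bar>)"
  proof (rule integral_le_off_negligible[OF _ _ N(1)])
    show "D integrable_on {0..t}" using Dint by blast
    show "(\<lambda>s. \<bar>f1 s - f2 s\<bar> - \<bar>m1 s - m2 s\<bar>) integrable_on {0..t}" using fa ma by (rule integrable_diff)
    fix s assume "s \<in> {0..t} - N"
    then have s: "s \<in> {0..T} - N" "s \<in> {0..T}" using t by auto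
    note sk = s1[unfolded skorokhod_def, THEN conjunct2, rule_format, OF s(2)]
      s2[unfolded skorokhod_def, THEN conjunct2, rule_format, OF s(2)]
    consider "h s = 0" | "h s > 0" | "h s < 0" by linarith
    then show "D s \<le> \<bar>f1 s - f2 s\<bar> - \<bar>m1 s - m2 s\<bar>"
    proof cases
      case 1
      then have "f1 s - f2 s = m1 s - m2 s" using \<eta>0[OF s(1)] by (simp add: \<eta>_def)
      then show ?thesis using 1 by (simp add: D_def)
    next
      case 2
      then have "m2 s = 0" using h_eq[OF s(2)] sk by fastforce
      then show ?thesis using 2 sk by (auto simp: D_def \<eta>_def)
    next
      case 3
      then have "m1 s = 0" using h_eq[OF s(2)] sk by fastforce
      then show ?thesis using 3 sk by (auto simp: D_def \<eta>_def)
    qed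
  qed
  also have "\<dots> = integral {0..t} (\<lambda>s. \<bar>f1 s - f2 s\<bar>) - integral {0..t} (\<lambda>s. \<bar>m1 s - m2 s\<bar>)"
    using fa ma by (rule Henstock_Kurzweil_Integration.integral_diff)
  finally show ?thesis by simp
qed

section \<open>Prox-regularity of sublevel sets\<close>

text \<open>The sets \<open>A y\<close> of points that improve on y by more than the price of
  getting there are nested along a chain. Each successor nearly attains the infimum of F on the
  current set, so the sets shrink to a point which no other point can improve on. Completeness thus
  replaces the compactness that attaining a minimum would require.\<close>

lemma ekeland_variational_principle:
  fixes F :: "'a::complete_space \<Rightarrow> real"
  assumes "closed S" "x0 \<in> S" and F: "continuous_on S F" and lb: "\<And>x. x \<in> S \<Longrightarrow> 0 \<le> F x" and "\<eta> > 0"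
  obtains y where "y \<in> S" "F y \<le> F x0" "\<And>z. z \<in> S \<Longrightarrow> F y \<le> F z + \<eta> * dist z y"
proof -
  define A where "A y = {z \<in> S. F z + \<eta> * dist z y \<le> F y}" for y
  have A_refl: "y \<in> A y" if "y \<in> S" for y using that by (simp add: A_def)
  have A_trans: "A z \<subseteq> A y" if "z \<in> A y" for y z
  proof
    fix x assume x: "x \<in> A z"
    have "\<eta> * dist x y \<le> \<eta> * dist x z + \<eta> * dist z y"
      using \<open>\<eta> > 0\<close> dist_triangle[of x y z] by (simp flip: distrib_left)
    then show "x \<in> A y" using x that by (auto simp: A_def)
  qed
  have bdd: "bdd_below (F ` A y)" for y by (rule bdd_belowI[of _ 0]) (auto simp: A_def lb)
  have ex: "\<exists>z. z \<in> A y \<and> F z < Inf (F ` A y) + (1/2)^n" if "y \<in> S" for y and n :: nat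
  proof -
    have "F ` A y \<noteq> {}" using A_refl[OF that] by blast
    then show ?thesis using cInf_less_iff[OF _ bdd, of y "Inf (F ` A y) + (1/2)^n"] by auto
  qed
  obtain Y where Y: "Y 0 = x0" "\<And>n. Y n \<in> S"
    "\<And>n. Y (Suc n) \<in> A (Y n) \<and> F (Y (Suc n)) < Inf (F ` A (Y n)) + (1/2)^n"
  proof -
    \<comment> \<open>The clause at n = 0 carries the prescribed start \<open>x0\<close> through
      dependent choice.\<close>
    define P where "P n z \<longleftrightarrow> z \<in> S \<and> (n = 0 \<longrightarrow> z = x0)" for n :: nat and z
    have "\<exists>Y. \<forall>n. P n (Y n) \<and> (Y (Suc n) \<in> A (Y n) \<and> F (Y (Suc n)) < Inf (F ` A (Y n)) + (1/2)^n)"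
    proof (rule dependent_nat_choice)
      show "\<exists>x. P 0 x" using \<open>x0 \<in> S\<close> by (auto simp: P_def)
      fix z n assume "P n z"
      then obtain x where "x \<in> A z" "F x < Inf (F ` A z) + (1/2)^n" using ex[of z n] by (auto simp: P_def)
      then show "\<exists>y. P (Suc n) y \<and> y \<in> A z \<and> F y < Inf (F ` A z) + (1/2)^n"
        by (intro exI[of _ x]) (auto simp: P_def A_def)
    qed
    then show thesis using that by (metis P_def)
  qed
  have nested: "A (Y n) \<subseteq> A (Y k)" if "k \<le> n" for k n
    using that by (induction n rule: dec_induct) (use A_trans Y(3) in blast)+
  \<comment> \<open>z already lies in \<open>A (Y n)\<close>, so \<open>F z\<close> is at least the
    infimum that \<open>F (Y (Suc n))\<close> attains up to \<open>(1/2)^n\<close>; only that much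
    is left to pay for the distance.\<close>
  have small: "\<eta> * dist z (Y (Suc n)) < (1/2)^n" if "z \<in> A (Y (Suc n))" for z n
  proof -
    have "z \<in> A (Y n)" using nested[of n "Suc n"] that by auto
    then have "Inf (F ` A (Y n)) \<le> F z" by (intro cInf_lower bdd) auto
    then show ?thesis using that Y(3)[of n] by (auto simp: A_def)
  qed
  have mem: "Y n \<in> A (Y k)" if "k \<le> n" for n k using nested[OF that] A_refl[OF Y(2)] by blast
  have pw0: "(\<lambda>n. (1/2)^n / \<eta> :: real) \<longlonglongrightarrow> 0"
    by (intro tendsto_divide_zero LIMSEQ_power_zero) simp
  have "Cauchy (\<lambda>n. Y (Suc n))"
    unfolding Cauchy_altdef2
  proof (intro allI impI)
    fix e :: real assume "e > 0"
    then obtain n where n: "(1/2)^n / \<eta> < e"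
      using order_tendstoD(2)[OF pw0, of e] unfolding eventually_sequentially by auto
    have "dist (Y (Suc k)) (Y (Suc n)) < e" if "k \<ge> n" for k
    proof -
      have "dist (Y (Suc k)) (Y (Suc n)) < (1/2)^n / \<eta>"
        using small[OF mem[of "Suc n" "Suc k"]] that \<open>\<eta> > 0\<close> by (simp add: field_simps)
      then show ?thesis using n by simp
    qed
    then show "\<exists>N. \<forall>n\<ge>N. dist (Y (Suc n)) (Y (Suc N)) < e" by blast
  qed
  then obtain y where lim: "(\<lambda>n. Y (Suc n)) \<longlonglongrightarrow> y" by (auto simp: Cauchy_convergent_iff convergent_def)
  then have lim': "Y \<longlonglongrightarrow> y" by (simp add: filterlim_sequentially_Suc)
  have yS: "y \<in> S" using closed_sequentially[OF \<open>closed S\<close>, of Y y] Y(2) lim' by blast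
  have Flim: "(\<lambda>n. F (Y n)) \<longlonglongrightarrow> F y"
    using continuous_on_tendsto_compose[OF F lim' yS] Y(2) by auto
  have yA: "y \<in> A (Y k)" for k
  proof -
    have "(\<lambda>n. F (Y n) + \<eta> * dist (Y n) (Y k)) \<longlonglongrightarrow> F y + \<eta> * dist y (Y k)"
      by (intro tendsto_intros Flim lim')
    moreover have "\<forall>\<^sub>F n in sequentially. F (Y n) + \<eta> * dist (Y n) (Y k) \<le> F (Y k)"
      using eventually_ge_at_top[of k] by eventually_elim (use mem in \<open>auto simp: A_def\<close>)
    ultimately have "F y + \<eta> * dist y (Y k) \<le> F (Y k)" by (intro tendsto_upperbound) auto
    then show ?thesis using yS by (simp add: A_def)
  qed
  have "F y \<le> F z + \<eta> * dist z y" if z: "z \<in> S" for z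
  proof (rule ccontr)
    assume "\<not> F y \<le> F z + \<eta> * dist z y"
    then have "z \<in> A y" using z by (simp add: A_def)
    then have zA: "z \<in> A (Y k)" for k using A_trans[OF yA] by blast
    have "dist z (Y (Suc n)) \<le> (1/2)^n / \<eta>" for n
      using small[OF zA, of n] \<open>\<eta> > 0\<close> by (simp add: field_simps)
    moreover have "(\<lambda>n. dist z (Y (Suc n))) \<longlonglongrightarrow> dist z y" by (intro tendsto_intros lim)
    ultimately have "dist z y \<le> 0" by (intro LIMSEQ_le[OF _ pw0]) auto
    then show False using \<open>\<not> F y \<le> F z + \<eta> * dist z y\<close> by simp
  qed
  moreover have "F y \<le> F x0"
  proof -
    have "F y + \<eta> * dist y x0 \<le> F x0" using yA[of 0] Y(1) by (simp add: A_def)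
    moreover have "\<eta> * dist y x0 \<ge> 0" using \<open>\<eta> > 0\<close> by simp
    ultimately show ?thesis by linarith
  qed
  ultimately show thesis using that yS by blast
qed

lemma le_of_small_multiples:
  fixes A B C :: real
  assumes "\<forall>\<^sub>F t in at_right 0. t * A \<le> t * B + t\<^sup>2 * C"
  shows "A \<le> B"
proof -
  have "((\<lambda>t. B + t * C) \<longlongrightarrow> B + 0 * C) (at_right 0)" by (intro tendsto_intros)
  moreover have "\<forall>\<^sub>F t in at_right 0. A \<le> B + t * C"
    using assms eventually_at_right_less[of 0]
  proof eventually_elim
    case (elim t)
    then have "t * A \<le> t * (B + t * C)" by (simp add: algebra_simps power2_eq_square)
    then show ?case using elim(2) by simp
  qed
  ultimately have "A \<le> B + 0 * C" by (intro tendsto_lowerbound) auto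
  then show ?thesis by simp
qed

text \<open>An approximate Farkas lemma. \<open>\<kappa> *\<^sub>R n\<close> is the projection of q
  onto the ray of n, and the residual e is itself a direction in the closed half-space with inner
  product of q and e equal to the square of |e|; testing with it bounds |e| by \<eta>. The closed
  half-space is reached from the open one by tilting v along -n. The case \<eta> = 0 yields exact
  normals.\<close>

lemma approx_normal_halfspace:
  fixes n q :: "'a::real_inner"
  assumes "n \<noteq> 0" "0 \<le> \<eta>" and le: "\<And>v. inner n v < 0 \<Longrightarrow> inner q v \<le> \<eta> * norm v"
  obtains \<kappa> where "\<kappa> \<ge> 0" "norm (q - \<kappa> *\<^sub>R n) \<le> \<eta>" "\<kappa> * norm n \<le> norm q"
proof -
  have nn: "inner n n > 0" using \<open>n \<noteq> 0\<close> by simp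
  have le0: "inner q v \<le> \<eta> * norm v" if v: "inner n v \<le> 0" for v
  proof -
    have "((\<lambda>t. \<eta> * norm (v - t *\<^sub>R n) - inner q (v - t *\<^sub>R n)) \<longlongrightarrow>
        \<eta> * norm (v - 0 *\<^sub>R n) - inner q (v - 0 *\<^sub>R n)) (at_right (0::real))"
      by (intro tendsto_intros)
    moreover have "\<forall>\<^sub>F t in at_right (0::real). 0 \<le> \<eta> * norm (v - t *\<^sub>R n) - inner q (v - t *\<^sub>R n)"
      using eventually_at_right_less[of 0]
    proof eventually_elim
      case (elim t)
      have "inner n (v - t *\<^sub>R n) < 0" using v mult_pos_pos[OF elim nn] by (simp add: inner_diff_right del: inner_eq_zero_iff)
      then show ?case using le by force
    qed
    ultimately have "0 \<le> \<eta> * norm (v - 0 *\<^sub>R n) - inner q (v - 0 *\<^sub>R n)" by (intro tendsto_lowerbound) auto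
    then show ?thesis by simp
  qed
  define \<kappa> where "\<kappa> = max 0 (inner q n / inner n n)"
  define e where "e = q - \<kappa> *\<^sub>R n"
  have ne: "inner n e \<le> 0"
    using nn by (auto simp: e_def \<kappa>_def inner_diff_right max_def inner_commute field_simps split: if_splits)
  have "inner q e = \<kappa> * inner n e + (norm e)\<^sup>2"
    by (simp add: e_def power2_norm_eq_inner inner_diff_left inner_diff_right algebra_simps)
  moreover have "\<kappa> * inner n e = 0"
    using nn by (auto simp: e_def \<kappa>_def inner_diff_right max_def inner_commute)
  ultimately have "(norm e)\<^sup>2 \<le> \<eta> * norm e" using le0[OF ne] by simp
  then have e: "norm e \<le> \<eta>"
    using \<open>0 \<le> \<eta>\<close> by (cases "e = 0") (auto simp: power2_eq_square)
  have "\<kappa> * norm n \<le> norm q"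
  proof (cases "inner q n \<le> 0")
    case True
    then have "\<kappa> = 0" using divide_nonpos_pos[OF True nn] by (simp add: \<kappa>_def)
    then show ?thesis by simp
  next
    case False
    have "\<kappa> * norm n = inner q n / norm n"
      using False nn by (simp add: \<kappa>_def max_def power2_norm_eq_inner[symmetric] power2_eq_square divide_simps)
    also have "\<dots> \<le> norm q" using norm_cauchy_schwarz[of q n] \<open>n \<noteq> 0\<close> by (simp add: divide_simps)
    finally show ?thesis .
  qed
  then show thesis using that[of \<kappa>] e by (simp add: \<kappa>_def e_def)
qed

locale sublevel_hypomonotone =
  fixes F :: "'a::{real_inner,banach} \<Rightarrow> real" and D :: "'a \<Rightarrow> 'a" and c lam :: real
  assumes c_pos: "c > 0" and lam_pos: "lam > 0"
    and F_deriv: "(F has_derivative inner (D x)) (at x)"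
    and D_lower: "F x = 1 \<Longrightarrow> c \<le> norm (D x)"
    and hypomonotone: "F x = 1 \<Longrightarrow> F z \<le> 1 \<Longrightarrow> - lam * (norm (x - z))\<^sup>2 \<le> inner (D x - D z) (x - z)"
begin

lemma F_line_deriv: "((\<lambda>s. F (x + s *\<^sub>R v)) has_real_derivative inner (D (x + s *\<^sub>R v)) v) (at s)"
proof -
  have "((\<lambda>s. x + s *\<^sub>R v) has_derivative (\<lambda>h. h *\<^sub>R v)) (at s)"
    by (auto intro!: derivative_eq_intros)
  then have "((F \<circ> (\<lambda>s. x + s *\<^sub>R v)) has_derivative inner (D (x + s *\<^sub>R v)) \<circ> (\<lambda>h. h *\<^sub>R v)) (at s)"
    by (rule diff_chain_at) (rule F_deriv)
  then show ?thesis by (simp add: has_field_derivative_def o_def mult_commute_abs)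
qed

lemma F_cont: "continuous_on S F"
  by (meson F_deriv continuous_at_imp_continuous_on has_derivative_continuous)

lemma closed_sublevel: "closed {x. F x \<le> 1}"
  by (intro closed_Collect_le F_cont continuous_intros)

lemma sublevel_direction:
  assumes "F x \<le> 1" "F x = 1 \<Longrightarrow> inner (D x) v < 0"
  shows "\<forall>\<^sub>F t in at_right 0. F (x + t *\<^sub>R v) \<le> 1"
proof (cases "F x = 1")
  case True
  have "((\<lambda>s. F (x + s *\<^sub>R v)) has_real_derivative inner (D x) v) (at 0)"
    using F_line_deriv[of x v 0] by simp
  then obtain d where "d > 0" "\<And>h. 0 < h \<Longrightarrow> h < d \<Longrightarrow> F (x + (0 + h) *\<^sub>R v) < F (x + 0 *\<^sub>R v)"
    using DERIV_neg_dec_right assms(2)[OF True] by blast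
  then show ?thesis using True unfolding eventually_at_right_field
    by (intro exI[of _ d]) (auto intro: less_imp_le)
next
  case False
  have "((\<lambda>s. F (x + s *\<^sub>R v)) \<longlongrightarrow> F (x + 0 *\<^sub>R v)) (at_right 0)"
    using DERIV_isCont[OF F_line_deriv[of x v 0]] by (simp add: isCont_def filterlim_at_split)
  then have "\<forall>\<^sub>F s in at_right 0. F (x + s *\<^sub>R v) < 1"
    using False assms(1) by (intro order_tendstoD(2)) auto
  then show ?thesis by eventually_elim auto
qed

text \<open>If the directional derivative at the far end of the segment is positive, the restriction of F
  to the segment has an interior minimum, which lies in the sublevel set.\<close>
lemma gradient_lower_bound:
  assumes x: "F x = 1" and z: "F z \<le> 1"
  shows "inner (D x) (x - z) \<ge> - lam * (norm (x - z))\<^sup>2"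
proof -
  define f where "f s = F (x + s *\<^sub>R (z - x))" for s
  define f' where "f' s = inner (D (x + s *\<^sub>R (z - x))) (z - x)" for s
  have der: "(f has_real_derivative f' s) (at s)" for s unfolding f_def f'_def by (rule F_line_deriv)
  have "\<exists>s. 0 < s \<and> s \<le> 1 \<and> f s \<le> 1 \<and> f' s \<le> 0"
  proof (cases "f' 1 \<le> 0")
    case True then show ?thesis using z by (intro exI[of _ 1]) (simp add: f_def)
  next
    case False
    then obtain d where d: "d > 0" "\<And>h. 0 < h \<Longrightarrow> h < d \<Longrightarrow> f (1 - h) < f 1"
      using DERIV_pos_inc_left[OF der[of 1]] by auto
    have "continuous_on {0..1} f" using der by (meson DERIV_isCont continuous_at_imp_continuous_on)
    then obtain s where s: "s \<in> {0..1}" "\<And>r. r \<in> {0..1} \<Longrightarrow> f s \<le> f r"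
      using continuous_attains_inf[of "{0..1::real}" f] by auto
    define h where "h = min (d/2) 1"
    have "f s \<le> f (1 - h)" "f (1 - h) < f 1" using d s(2)[of "1 - h"] by (auto simp: h_def)
    then have lt: "f s < f 1" by simp
    have f1: "f 1 \<le> 1" and f0: "f 0 = 1" using x z by (auto simp: f_def)
    have "s \<noteq> 0" "s \<noteq> 1" using lt f1 f0 by auto
    then have s01: "0 < s" "s < 1" using s(1) by auto
    have "f' s = 0"
      by (rule DERIV_local_min[OF der, of "min s (1 - s)"]) (use s01 s(2) in \<open>auto simp: abs_if split: if_splits\<close>)
    then show ?thesis using s01 lt f1 by (intro exI[of _ s]) auto
  qed
  then obtain s where s: "0 < s" "s \<le> 1" "f s \<le> 1" "f' s \<le> 0" by blast
  \<comment> \<open>Hypomonotonicity between x and z also contains the gradient at z, of unknown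
    sign; at \<open>z'\<close> that term has the right sign because \<open>f' s \<le> 0\<close>. The
    error is quadratic in s and the inner product linear, so division by s leaves
    \<open>lam * s\<close>, which is at most \<open>lam\<close>.\<close>
  define z' where "z' = x + s *\<^sub>R (z - x)"
  have "- lam * (norm (x - z'))\<^sup>2 \<le> inner (D x - D z') (x - z')"
    using x s(3) by (intro hypomonotone) (auto simp: z'_def f_def)
  moreover have "x - z' = s *\<^sub>R (x - z)" by (simp add: z'_def algebra_simps)
  ultimately have "s * (- lam * s * (norm (x - z))\<^sup>2) \<le> s * inner (D x - D z') (x - z)"
    using s by (simp add: power_mult_distrib power2_eq_square mult_ac)
  then have "- lam * s * (norm (x - z))\<^sup>2 \<le> inner (D x - D z') (x - z)"
    using s(1) by (simp only: mult_le_cancel_left_pos)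
  then have "- lam * s * (norm (x - z))\<^sup>2 \<le> inner (D x) (x - z) - inner (D z') (x - z)"
    by (simp add: inner_diff_left)
  moreover have "inner (D z') (x - z) = - f' s"
    by (simp add: f'_def z'_def inner_diff_right)
  moreover have "lam * s * (norm (x - z))\<^sup>2 \<le> lam * 1 * (norm (x - z))\<^sup>2"
    using s lam_pos by (intro mult_right_mono mult_left_mono) auto
  ultimately show ?thesis using s(4) by simp
qed

text \<open>Hypomonotonicity bounds A + B below by -E, and \<open>gradient_lower_bound\<close>
  bounds A and B separately. If one of them is nonnegative only the other costs anything; if both
  are negative, raising both weights to \<mu> makes the sum smaller and A + B is used. So unequal
  weights cost the factor \<mu> and not 2 \<mu>, which keeps the radius sharp.\<close>

lemma scaled_hypomonotone:
  assumes x: "F x = 1" and y: "F y \<le> 1" and "0 \<le> \<sigma>" "\<sigma> \<le> \<mu>" "0 \<le> \<kappa>" "\<kappa> \<le> \<mu>" and ky: "\<kappa> \<noteq> 0 \<Longrightarrow> F y = 1"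
  shows "inner (\<kappa> *\<^sub>R D y - \<sigma> *\<^sub>R D x) (y - x) \<ge> - \<mu> * lam * (norm (y - x))\<^sup>2"
proof -
  define E where "E = lam * (norm (y - x))\<^sup>2"
  define A where "A = inner (D x) (x - y)"
  define B where "B = inner (D y) (y - x)"
  have E: "E \<ge> 0" using lam_pos by (simp add: E_def)
  have A: "A \<ge> - E" using gradient_lower_bound[OF x y] by (simp add: A_def E_def norm_minus_commute)
  have AB: "A + B \<ge> - E"
    using hypomonotone[OF x y] by (simp add: A_def B_def E_def norm_minus_commute inner_diff_left inner_diff_right algebra_simps)
  have *: "\<sigma> * A + \<kappa> * B \<ge> - \<mu> * E"
  proof (cases "\<kappa> = 0")
    case True
    have "\<sigma> * A \<ge> \<sigma> * (- E)" using A \<open>0 \<le> \<sigma>\<close> by (intro mult_left_mono)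
    moreover have "\<sigma> * E \<le> \<mu> * E" using E \<open>\<sigma> \<le> \<mu>\<close> by (intro mult_right_mono)
    ultimately show ?thesis using True by simp
  next
    case False
    have B: "B \<ge> - E" using gradient_lower_bound[OF ky[OF False], of x] x by (simp add: B_def E_def)
    consider "A \<ge> 0" | "B \<ge> 0" | "A \<le> 0" "B \<le> 0" by linarith
    then show ?thesis
    proof cases
      case 1
      have "\<kappa> * B \<ge> \<kappa> * (- E)" using B \<open>0 \<le> \<kappa>\<close> by (intro mult_left_mono)
      moreover have "\<kappa> * E \<le> \<mu> * E" using E \<open>\<kappa> \<le> \<mu>\<close> by (intro mult_right_mono)
      moreover have "\<sigma> * A \<ge> 0" using 1 \<open>0 \<le> \<sigma>\<close> by simp
      ultimately show ?thesis by simp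
    next
      case 2
      have "\<sigma> * A \<ge> \<sigma> * (- E)" using A \<open>0 \<le> \<sigma>\<close> by (intro mult_left_mono)
      moreover have "\<sigma> * E \<le> \<mu> * E" using E \<open>\<sigma> \<le> \<mu>\<close> by (intro mult_right_mono)
      moreover have "\<kappa> * B \<ge> 0" using 2 \<open>0 \<le> \<kappa>\<close> by simp
      ultimately show ?thesis by simp
    next
      case 3
      have "\<mu> * A \<le> \<sigma> * A" "\<mu> * B \<le> \<kappa> * B" using 3 \<open>\<sigma> \<le> \<mu>\<close> \<open>\<kappa> \<le> \<mu>\<close> by (auto intro: mult_right_mono_neg)
      moreover have "\<mu> * (A + B) \<ge> \<mu> * (- E)" using AB \<open>0 \<le> \<sigma>\<close> \<open>\<sigma> \<le> \<mu>\<close> by (intro mult_left_mono) auto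
      ultimately show ?thesis by (simp add: distrib_left)
    qed
  qed
  have "inner (\<kappa> *\<^sub>R D y - \<sigma> *\<^sub>R D x) (y - x) = \<sigma> * A + \<kappa> * B"
    by (simp add: A_def B_def inner_diff_left inner_diff_right algebra_simps)
  then show ?thesis using * by (simp add: E_def mult.assoc)
qed

text \<open>The sublevel set avoids every open ball of radius \<open>s < c / lam\<close> touching it from outside at x:
  an almost minimizer y of the distance to the centre p is almost critical (Ekeland), and comparing
  the two normals \<open>p - y\<close> and \<open>p - x\<close> by hypomonotonicity forces y to be close to x.\<close>
theorem prox_regular:
  assumes x: "F x = 1" and z: "F z \<le> 1"
  shows "inner (D x) (x - z) \<ge> - (lam / (2 * c)) * norm (D x) * (norm (x - z))\<^sup>2"
proof (rule ccontr)
  assume neg: "\<not> ?thesis"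
  define \<alpha> where "\<alpha> = norm (D x)"
  have \<alpha>: "\<alpha> \<ge> c" "\<alpha> > 0" using D_lower[OF x] c_pos by (auto simp: \<alpha>_def)
  define P where "P = inner (D x) (z - x) / \<alpha>"
  define d2 where "d2 = (norm (x - z))\<^sup>2"
  have "inner (D x) (z - x) > lam / (2 * c) * \<alpha> * d2"
    using neg by (simp add: \<alpha>_def d2_def inner_diff_right)
  then have P: "P > lam / (2 * c) * d2" using \<alpha> by (simp add: P_def field_simps)
  have "z \<noteq> x" using P by (auto simp: P_def d2_def)
  then have d2: "d2 > 0" by (simp add: d2_def)
  have Ppos: "P > 0" using P d2 c_pos lam_pos by (smt (verit) mult_pos_pos divide_pos_pos)
  have "d2 / (2 * P) < c / lam" using P Ppos c_pos lam_pos by (simp add: field_simps)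
  \<comment> \<open>The lower bound on s puts z strictly inside the ball of radius s about p; the
    upper bound makes \<theta> positive.\<close>
  then obtain s where s: "d2 / (2 * P) < s" "s < c / lam" using dense by blast
  have s0: "s > 0" using s(1) d2 Ppos by (smt (verit) divide_pos_pos)
  define p where "p = x + (s / \<alpha>) *\<^sub>R D x"
  have px: "norm (p - x) = s" using s0 \<alpha> by (simp add: p_def \<alpha>_def)
  have "(norm (z - p))\<^sup>2 = d2 - 2 * s * P + s\<^sup>2"
  proof -
    have "(norm (z - p))\<^sup>2 = (norm ((z - x) - (p - x)))\<^sup>2" by simp
    also have "\<dots> = (norm (z - x))\<^sup>2 - 2 * inner (z - x) (p - x) + (norm (p - x))\<^sup>2"
      by (simp add: power2_norm_eq_inner inner_diff_left inner_diff_right inner_commute)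
    also have "inner (z - x) (p - x) = s * P" using \<alpha> by (simp add: p_def P_def inner_commute)
    finally show ?thesis by (simp add: px d2_def norm_minus_commute)
  qed
  also have "\<dots> < s\<^sup>2" using s(1) Ppos by (simp add: field_simps)
  finally have zp: "norm (z - p) < s" using s0 by (simp add: power2_less_imp_less)
  define \<sigma> where "\<sigma> = norm (z - p)"
  define \<theta> where "\<theta> = 1 - s * lam / c"
  have \<theta>: "\<theta> > 0" using s(2) c_pos lam_pos by (simp add: \<theta>_def field_simps)
  \<comment> \<open>y will satisfy \<open>\<theta> * d \<le> \<eta>\<close> with d its distance from
    x, while d is at least \<open>s - \<sigma>\<close>; half of the product makes the two
    incompatible.\<close>
  define \<eta> where "\<eta> = (s - \<sigma>) * \<theta> / 2"
  have \<eta>: "\<eta> > 0" using \<theta> zp by (simp add: \<eta>_def \<sigma>_def)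
  have "continuous_on {x. F x \<le> 1} (\<lambda>y. (norm (y - p))\<^sup>2 / 2)" by (intro continuous_intros) auto
  then obtain y where y: "F y \<le> 1" "(norm (y - p))\<^sup>2 / 2 \<le> (norm (z - p))\<^sup>2 / 2"
    "\<And>z. F z \<le> 1 \<Longrightarrow> (norm (y - p))\<^sup>2 / 2 \<le> (norm (z - p))\<^sup>2 / 2 + \<eta> * dist z y"
    using ekeland_variational_principle[of "{x. F x \<le> 1}" z "\<lambda>y. (norm (y - p))\<^sup>2 / 2" \<eta>]
      z \<eta> closed_sublevel by auto
  have yp: "norm (y - p) \<le> \<sigma>" using y(2) by (simp add: \<sigma>_def)
  have crit: "inner (p - y) v \<le> \<eta> * norm v" if v: "F y = 1 \<Longrightarrow> inner (D y) v < 0" for v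
  proof (rule le_of_small_multiples[where C="(norm v)\<^sup>2 / 2"])
    have "\<forall>\<^sub>F t in at_right 0. F (y + t *\<^sub>R v) \<le> 1" using y(1) v by (rule sublevel_direction)
    then show "\<forall>\<^sub>F t in at_right 0. t * inner (p - y) v \<le> t * (\<eta> * norm v) + t\<^sup>2 * ((norm v)\<^sup>2 / 2)"
      using eventually_at_right_less[of 0]
    proof eventually_elim
      case (elim t)
      have "(norm (y - p))\<^sup>2 / 2 \<le> (norm (y + t *\<^sub>R v - p))\<^sup>2 / 2 + \<eta> * dist (y + t *\<^sub>R v) y"
        using elim(1) by (rule y(3))
      moreover have "\<eta> * dist (y + t *\<^sub>R v) y = t * (\<eta> * norm v)" using elim by (simp add: dist_norm)
      moreover have "(norm (y + t *\<^sub>R v - p))\<^sup>2 = (norm (y - p))\<^sup>2 - 2 * (t * inner (p - y) v) + t\<^sup>2 * (norm v)\<^sup>2"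
        unfolding power2_norm_eq_inner
        by (simp add: inner_diff_left inner_diff_right inner_add_left inner_add_right
            inner_commute algebra_simps power2_eq_square)
      ultimately show ?case by argo
    qed
  qed
  have "\<exists>\<kappa>. \<kappa> \<ge> 0 \<and> norm (p - y - \<kappa> *\<^sub>R D y) \<le> \<eta> \<and> \<kappa> \<le> s / c \<and> (\<kappa> \<noteq> 0 \<longrightarrow> F y = 1)"
  proof (cases "F y = 1")
    case True
    have "D y \<noteq> 0" using D_lower[OF True] c_pos by auto
    then obtain \<kappa> where \<kappa>: "\<kappa> \<ge> 0" "norm (p - y - \<kappa> *\<^sub>R D y) \<le> \<eta>" "\<kappa> * norm (D y) \<le> norm (p - y)"
      using approx_normal_halfspace[of "D y" \<eta> "p - y"] crit \<eta> by (metis less_imp_le)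
    have "\<kappa> * c \<le> \<kappa> * norm (D y)" using \<kappa>(1) D_lower[OF True] by (rule mult_left_mono[rotated])
    also have "\<dots> \<le> s" using \<kappa>(3) yp zp by (simp add: norm_minus_commute \<sigma>_def)
    finally show ?thesis using \<kappa> True c_pos by (intro exI[of _ \<kappa>]) (simp add: field_simps)
  next
    case False
    have "(norm (p - y))\<^sup>2 \<le> \<eta> * norm (p - y)" using crit[of "p - y"] False by (simp add: power2_norm_eq_inner)
    then have "norm (p - y) \<le> \<eta>" using \<eta> by (cases "p = y") (auto simp: power2_eq_square)
    then show ?thesis using s0 c_pos by (intro exI[of _ 0]) auto
  qed
  then obtain \<kappa> where \<kappa>: "\<kappa> \<ge> 0" "norm (p - y - \<kappa> *\<^sub>R D y) \<le> \<eta>" "\<kappa> \<le> s / c" "\<kappa> \<noteq> 0 \<Longrightarrow> F y = 1" by blast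
  define e where "e = p - y - \<kappa> *\<^sub>R D y"
  define d where "d = norm (y - x)"
  \<comment> \<open>Both multipliers are at most \<open>s / c\<close>: for x since \<alpha> is at
    least c, for y since \<open>\<kappa> * c\<close> is at most the distance from p to y. The two
    normals differ by \<open>-(y - x)\<close> up to the Ekeland error e, so a full square of d
    stands against \<open>s * lam / c\<close> times it; \<theta> is what remains.\<close>
  have "inner (\<kappa> *\<^sub>R D y - (s / \<alpha>) *\<^sub>R D x) (y - x) \<ge> - (s / c) * lam * d\<^sup>2"
    unfolding d_def using \<kappa> s0 \<alpha> c_pos x y(1)
    by (intro scaled_hypomonotone) (auto simp: frac_le)
  moreover have "\<kappa> *\<^sub>R D y - (s / \<alpha>) *\<^sub>R D x = - (y - x) - e" by (simp add: e_def p_def)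
  ultimately have "- (s / c) * lam * d\<^sup>2 \<le> - d\<^sup>2 - inner e (y - x)"
    by (simp add: d_def power2_norm_eq_inner inner_diff_left)
  moreover have "- inner e (y - x) \<le> \<eta> * d"
  proof -
    have "\<bar>inner e (y - x)\<bar> \<le> norm e * d" unfolding d_def by (rule Cauchy_Schwarz_ineq2)
    also have "\<dots> \<le> \<eta> * d" using \<kappa>(2) by (intro mult_right_mono) (auto simp: e_def d_def)
    finally show ?thesis by linarith
  qed
  ultimately have "\<theta> * d\<^sup>2 \<le> \<eta> * d" by (simp add: \<theta>_def algebra_simps)
  moreover have dge: "d \<ge> s - \<sigma>"
    using norm_triangle_ineq[of "p - y" "y - x"] px yp by (simp add: d_def norm_minus_commute)
  moreover have "d > 0" using dge zp by (simp add: \<sigma>_def)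
  ultimately have "\<theta> * d \<le> \<eta>" by (simp add: power2_eq_square)
  moreover have "\<theta> * (s - \<sigma>) \<le> \<theta> * d" using dge \<theta> by (intro mult_left_mono) auto
  ultimately have "\<theta> * (s - \<sigma>) \<le> \<theta> * (s - \<sigma>) / 2" by (simp add: \<eta>_def mult.commute)
  moreover have "\<theta> * (s - \<sigma>) > 0" using \<theta> zp by (simp add: \<sigma>_def)
  ultimately show False by linarith
qed

end

section \<open>Differentiability of the data\<close>

lemma gateaux_line_deriv:
  fixes F :: "'a::real_normed_vector \<Rightarrow> real"
  assumes lim: "\<And>x y. ((\<lambda>t. (F (x + t *\<^sub>R y) - F x) / t) \<longlongrightarrow> D x y) (at 0)"
  shows "((\<lambda>s. F (x + s *\<^sub>R y)) has_real_derivative D (x + s *\<^sub>R y) y) (at s)"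
proof -
  have "(\<lambda>h. (F (x + (s + h) *\<^sub>R y) - F (x + s *\<^sub>R y)) / h) = (\<lambda>t. (F ((x + s *\<^sub>R y) + t *\<^sub>R y) - F (x + s *\<^sub>R y)) / t)"
    by (simp add: scaleR_add_left add.assoc)
  then show ?thesis unfolding DERIV_def using lim[of "x + s *\<^sub>R y" y] by simp
qed

lemma gateaux_mean_value:
  fixes F :: "'a::real_normed_vector \<Rightarrow> real"
  assumes lim: "\<And>x y. ((\<lambda>t. (F (x + t *\<^sub>R y) - F x) / t) \<longlongrightarrow> D x y) (at 0)"
  obtains z where "0 < z" "z < 1" "F (x + y) - F x = D (x + z *\<^sub>R y) y"
proof -
  have "\<exists>z>0. z < 1 \<and> F (x + 1 *\<^sub>R y) - F (x + 0 *\<^sub>R y) = (1 - 0) * D (x + z *\<^sub>R y) y"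
    by (rule MVT2) (use gateaux_line_deriv[OF lim] in auto)
  then show thesis using that by auto
qed

text \<open>The mean value theorem along one line, combined with the Lipschitz dependence of the
  derivative on its base point, gives a remainder uniform in the direction. This upgrades the
  assumed directional gradients to Frechet derivatives, which the chain rules need.\<close>

lemma gateaux_lipschitz_remainder:
  fixes F :: "'a::real_normed_vector \<Rightarrow> real"
  assumes lim: "\<And>x y. ((\<lambda>t. (F (x + t *\<^sub>R y) - F x) / t) \<longlongrightarrow> D x y) (at 0)"
    and lip: "\<And>x x' y. \<bar>D x y - D x' y\<bar> \<le> C * norm (x - x') * norm y" and "C \<ge> 0"
  shows "\<bar>F (x + y) - F x - D x y\<bar> \<le> C * (norm y)\<^sup>2"
proof -
  obtain z where z: "0 < z" "z < 1" "F (x + y) - F x = D (x + z *\<^sub>R y) y"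
    using gateaux_mean_value[OF lim] by blast
  have "\<bar>F (x + y) - F x - D x y\<bar> \<le> C * norm (x + z *\<^sub>R y - x) * norm y"
    unfolding z(3) by (rule lip)
  also have "\<dots> = C * (z * norm y) * norm y" using z(1) by simp
  also have "\<dots> \<le> C * (1 * norm y) * norm y"
    using z \<open>C \<ge> 0\<close> by (intro mult_right_mono mult_left_mono) auto
  finally show ?thesis by (simp add: power2_eq_square mult.assoc)
qed

lemma has_derivative_quadratic_remainder:
  fixes F :: "'a::real_normed_vector \<Rightarrow> 'b::real_normed_vector"
  assumes "bounded_linear D" and rem: "\<And>y. norm (F (x + y) - F x - D y) \<le> C * (norm y)\<^sup>2"
  shows "(F has_derivative D) (at x)"
  unfolding has_derivative_within_alt
proof (intro conjI allI impI assms(1))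
  fix e :: real assume "e > 0"
  have "norm (F z - F x - D (z - x)) \<le> e * norm (z - x)" if z: "norm (z - x) < e / (\<bar>C\<bar> + 1)" for z
  proof -
    have "norm (F z - F x - D (z - x)) \<le> C * (norm (z - x))\<^sup>2" using rem[of "z - x"] by simp
    also have "\<dots> \<le> (\<bar>C\<bar> + 1) * (norm (z - x))\<^sup>2" by (intro mult_right_mono) auto
    also have "\<dots> = ((\<bar>C\<bar> + 1) * norm (z - x)) * norm (z - x)" by (simp add: power2_eq_square mult.assoc)
    also have "\<dots> \<le> e * norm (z - x)"
      using z by (intro mult_right_mono) (auto simp: field_simps)
    finally show ?thesis .
  qed
  moreover have "e / (\<bar>C\<bar> + 1) > 0" using \<open>e > 0\<close> by simp
  ultimately show "\<exists>d>0. \<forall>y\<in>UNIV. norm (y - x) < d \<longrightarrow> norm (F y - F x - D (y - x)) \<le> e * norm (y - x)" by blast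
qed

section \<open>Chain rule and level sets for G\<close>

locale sweeping_data =
  fixes G :: "'x::{real_inner,banach} \<Rightarrow> 'w::banach \<Rightarrow> real"
    and Gx :: "'x \<Rightarrow> 'w \<Rightarrow> 'x" and Gw :: "'x \<Rightarrow> 'w \<Rightarrow> ('w \<Rightarrow>\<^sub>L real)"
    and g :: "real \<Rightarrow> 'x \<Rightarrow> 'x \<Rightarrow> 'w" and gt :: "real \<Rightarrow> 'x \<Rightarrow> 'x \<Rightarrow> 'w"
    and gu gxi :: "real \<Rightarrow> 'x \<Rightarrow> 'x \<Rightarrow> ('x \<Rightarrow>\<^sub>L 'w)"
    and a b :: "real \<Rightarrow> real" and T lam c L K0 K1 C0 C1 \<gamma> \<omega> Cxi Cu :: real
  assumes T_pos: "T > 0" and hypH: "hyp_H G Gx lam c L"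
    and hypL: "hyp_L G Gx Gw K0 K1 C0 C1"
    and hypg: "hyp_g T g gt gu gxi a b \<gamma> \<omega> Cxi Cu c K1"
begin

lemma pos_consts: "lam > 0" "c > 0" "K0 > 0" "K1 > 0" "C0 > 0" "C1 > 0" "\<gamma> > 0" "\<omega> > 0" "Cxi > 0" "Cu > 0"
  using hypH hypL hypg by (auto simp: hyp_H_def hyp_L_def hyp_g_def)

lemma Gx_lower: "G x w = 1 \<Longrightarrow> c \<le> norm (Gx x w)"
  using hypH by (auto simp: hyp_H_def)

lemma Gx_bound: "norm (Gx x w) \<le> K0" and Gw_bound: "norm (Gw x w) \<le> K1"
  and Gx_lip: "norm (Gx x w - Gx x' w') \<le> C0 * (norm (x - x') + norm (w - w'))"
  and Gw_lip: "norm (Gw x w - Gw x' w') \<le> C1 * (norm (x - x') + norm (w - w'))"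
  using hypL by (auto simp: hyp_L_def)

lemma G_lim_x: "((\<lambda>t. (G (x + t *\<^sub>R y) w - G x w) / t) \<longlongrightarrow> inner (Gx x w) y) (at 0)"
  and G_lim_w: "((\<lambda>t. (G x (w + t *\<^sub>R v) - G x w) / t) \<longlongrightarrow> blinfun_apply (Gw x w) v) (at 0)"
  using hypL by (auto simp: hyp_L_def is_grad_x_def is_grad_w_def)

lemma G_remainder_x: "\<bar>G (x + y) w - G x w - inner (Gx x w) y\<bar> \<le> C0 * (norm y)\<^sup>2"
proof (rule gateaux_lipschitz_remainder[where F="\<lambda>x. G x w" and D="\<lambda>x. inner (Gx x w)", OF G_lim_x])
  fix x x' y
  have "\<bar>inner (Gx x w - Gx x' w) y\<bar> \<le> norm (Gx x w - Gx x' w) * norm y" by (rule Cauchy_Schwarz_ineq2)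
  also have "\<dots> \<le> C0 * norm (x - x') * norm y" using Gx_lip[of x w x' w] by (intro mult_right_mono) auto
  finally show "\<bar>inner (Gx x w) y - inner (Gx x' w) y\<bar> \<le> C0 * norm (x - x') * norm y" by (simp add: inner_diff_left)
qed (use pos_consts in auto)

lemma G_deriv_x: "((\<lambda>x. G x w) has_derivative inner (Gx x w)) (at x)"
  by (rule has_derivative_quadratic_remainder[where C=C0])
    (use G_remainder_x in \<open>auto intro: bounded_linear_inner_right\<close>)

lemma G_deriv_w: "((\<lambda>w. G x w) has_derivative blinfun_apply (Gw x w)) (at w)"
proof (rule has_derivative_quadratic_remainder[where C=C1])
  fix v
  show "norm (G x (w + v) - G x w - Gw x w v) \<le> C1 * (norm v)\<^sup>2"
    unfolding real_norm_def
  proof (rule gateaux_lipschitz_remainder[where F="\<lambda>w. G x w" and D="\<lambda>w. blinfun_apply (Gw x w)", OF G_lim_w])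
    fix w w' v
    have "\<bar>blinfun_apply (Gw x w - Gw x w') v\<bar> \<le> norm (Gw x w - Gw x w') * norm v"
      using norm_blinfun[of "Gw x w - Gw x w'" v] by simp
    also have "\<dots> \<le> C1 * norm (w - w') * norm v" using Gw_lip[of x w x w'] by (intro mult_right_mono) auto
    finally show "\<bar>Gw x w v - Gw x w' v\<bar> \<le> C1 * norm (w - w') * norm v" by (simp add: blinfun.diff_left)
  qed (use pos_consts in auto)
qed (rule blinfun.bounded_linear_right)

lemma G_lipschitz: "\<bar>G x w - G x' w'\<bar> \<le> K0 * norm (x - x') + K1 * norm (w - w')"
proof -
  obtain z where z: "G (x' + (x - x')) w - G x' w = inner (Gx (x' + z *\<^sub>R (x - x')) w) (x - x')"
    using gateaux_mean_value[where F="\<lambda>x. G x w" and D="\<lambda>x. inner (Gx x w)", OF G_lim_x] by metis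
  have "\<bar>G x w - G x' w\<bar> \<le> norm (Gx (x' + z *\<^sub>R (x - x')) w) * norm (x - x')"
    using z Cauchy_Schwarz_ineq2 by (metis add.commute diff_add_cancel)
  also have "\<dots> \<le> K0 * norm (x - x')" by (intro mult_right_mono Gx_bound) auto
  finally have 1: "\<bar>G x w - G x' w\<bar> \<le> K0 * norm (x - x')" .
  obtain z where z: "G x' (w' + (w - w')) - G x' w' = Gw x' (w' + z *\<^sub>R (w - w')) (w - w')"
    using gateaux_mean_value[where F="\<lambda>w. G x' w" and D="\<lambda>w. blinfun_apply (Gw x' w)", OF G_lim_w] by metis
  have "\<bar>G x' w - G x' w'\<bar> \<le> norm (Gw x' (w' + z *\<^sub>R (w - w'))) * norm (w - w')"
    using z norm_blinfun by (metis add.commute diff_add_cancel real_norm_def)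
  also have "\<dots> \<le> K1 * norm (w - w')" by (intro mult_right_mono Gw_bound) auto
  finally show ?thesis using 1 by linarith
qed

lemma G_chain:
  assumes p: "(p has_vector_derivative p') (at t)" and q: "(q has_vector_derivative q') (at t)"
  shows "((\<lambda>s. G (p s) (q s)) has_vector_derivative inner (Gx (p t) (q t)) p' + Gw (p t) (q t) q') (at t)"
proof -
  have cont: "continuous (at (x, w)) (\<lambda>(x, w). Gw x w)" for x w
  proof -
    have "((\<lambda>z. Gw (fst z) (snd z) - Gw x w) \<longlongrightarrow> 0) (at (x, w))"
    proof (rule Lim_null_comparison)
      show "\<forall>\<^sub>F z in at (x, w). norm (Gw (fst z) (snd z) - Gw x w) \<le> C1 * (norm (fst z - x) + norm (snd z - w))"
        using Gw_lip by (intro always_eventually) auto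
      have "((\<lambda>z. C1 * (norm (fst z - x) + norm (snd z - w))) \<longlongrightarrow> C1 * (norm (fst (x,w) - x) + norm (snd (x,w) - w))) (at (x, w))"
        by (intro tendsto_intros tendsto_fst tendsto_snd tendsto_ident_at)
      then show "((\<lambda>z. C1 * (norm (fst z - x) + norm (snd z - w))) \<longlongrightarrow> 0) (at (x, w))" by simp
    qed
    then have "((\<lambda>z. Gw (fst z) (snd z)) \<longlongrightarrow> Gw x w) (at (x, w))" by (rule LIM_zero_cancel)
    then show ?thesis by (simp add: continuous_within case_prod_unfold)
  qed
  have "((\<lambda>(x, w). G x w) has_derivative (\<lambda>(tx, tw). inner (Gx (p t) (q t)) tx + Gw (p t) (q t) tw))
      (at (p t, q t) within UNIV \<times> UNIV)"
    by (rule has_derivative_partialsI) (use G_deriv_x G_deriv_w cont in auto)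
  then have "((\<lambda>(x, w). G x w) has_derivative (\<lambda>(tx, tw). inner (Gx (p t) (q t)) tx + Gw (p t) (q t) tw)) (at (p t, q t))"
    by simp
  moreover have "((\<lambda>s. (p s, q s)) has_derivative (\<lambda>h. (h *\<^sub>R p', h *\<^sub>R q'))) (at t)"
    using p q unfolding has_vector_derivative_def by (rule has_derivative_Pair)
  ultimately have "((\<lambda>(x, w). G x w) \<circ> (\<lambda>s. (p s, q s)) has_derivative
     (\<lambda>(tx, tw). inner (Gx (p t) (q t)) tx + Gw (p t) (q t) tw) \<circ> (\<lambda>h. (h *\<^sub>R p', h *\<^sub>R q'))) (at t)"
    by (intro diff_chain_at)
  then show ?thesis
    by (simp add: has_vector_derivative_def o_def blinfun.scaleR_right distrib_left)
qed

text \<open>The gradient is nonzero there, so G exceeds 1 along it. Hence hypomonotonicity, assumed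
  at frontier points only, is available wherever G = 1.\<close>

lemma level_set_frontier:
  assumes "G x w = 1" shows "x \<in> frontier (Zset G w)"
proof -
  have nz: "inner (Gx x w) (Gx x w) > 0" using Gx_lower[OF assms] pos_consts by auto
  have "((\<lambda>s. G (x + s *\<^sub>R Gx x w) w) has_real_derivative inner (Gx (x + 0 *\<^sub>R Gx x w) w) (Gx x w)) (at 0)"
    by (rule gateaux_line_deriv[where F="\<lambda>x. G x w" and D="\<lambda>x. inner (Gx x w)", OF G_lim_x])
  moreover have "0 < inner (Gx (x + 0 *\<^sub>R Gx x w) w) (Gx x w)" using nz by simp
  ultimately obtain d where d: "d > 0" "\<And>h. 0 < h \<Longrightarrow> h < d \<Longrightarrow> G (x + 0 *\<^sub>R Gx x w) w < G (x + (0 + h) *\<^sub>R Gx x w) w"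
    using DERIV_pos_inc_right by blast
  have "x \<notin> interior (Zset G w)"
  proof
    assume "x \<in> interior (Zset G w)"
    then obtain e where e: "e > 0" "ball x e \<subseteq> Zset G w" by (auto simp: mem_interior)
    define h where "h = min (d/2) (e / (2 * norm (Gx x w)))"
    have n: "norm (Gx x w) > 0" using nz by auto
    have h: "0 < h" "h < d" using d e n by (auto simp: h_def)
    have "h * norm (Gx x w) \<le> (e / (2 * norm (Gx x w))) * norm (Gx x w)"
      using n by (intro mult_right_mono) (auto simp: h_def)
    also have "\<dots> < e" using n e by simp
    finally have "x + h *\<^sub>R Gx x w \<in> ball x e" using h by (simp add: dist_norm)
    then have "G (x + h *\<^sub>R Gx x w) w \<le> 1" using e(2) by (auto simp: Zset_def)
    then show False using d(2)[OF h] assms by simp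
  qed
  moreover have "x \<in> closure (Zset G w)" using assms closure_subset[of "Zset G w"] by (auto simp: Zset_def)
  ultimately show ?thesis by (simp add: frontier_def)
qed

sublocale sublevel: sublevel_hypomonotone "\<lambda>x. G x w" "\<lambda>x. Gx x w" c lam for w
proof
  show "- lam * (norm (x - z))\<^sup>2 \<le> inner (Gx x w - Gx z w) (x - z)" if "G x w = 1" "G z w \<le> 1" for x z
    using hypH level_set_frontier[OF that(1)] that(2) unfolding hyp_H_def by (auto simp: Zset_def)
qed (use pos_consts Gx_lower G_deriv_x in auto)

section \<open>Regularity of g in time and state\<close>

definition g_bounds :: "real \<Rightarrow> bool" where
  "g_bounds t \<longleftrightarrow> (\<forall>u v \<xi> \<eta>.
       norm (gxi t u \<xi>) \<le> \<gamma> \<and> norm (gu t u \<xi>) \<le> \<omega> \<and> norm (gt t u \<xi>) \<le> a t \<and>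
       norm (gxi t u \<xi> - gxi t v \<eta>) \<le> Cxi * (norm (u - v) + norm (\<xi> - \<eta>)) \<and>
       norm (gu t u \<xi> - gu t v \<eta>) \<le> Cu * (norm (u - v) + norm (\<xi> - \<eta>)) \<and>
       norm (gt t u \<xi> - gt t v \<eta>) \<le> b t * (norm (u - v) + norm (\<xi> - \<eta>)))"

text \<open>\<open>g_bounds\<close> quantifies over the states at a fixed time, so one null set of
  times serves all states. This is what permits evaluation along arbitrary curves.\<close>

lemma g_bounds_AE: "AE t in lebesgue. t \<in> {0<..<T} \<longrightarrow> g_bounds t"
  using hypg unfolding hyp_g_def g_bounds_def by blast

lemma g_boundsD:
  assumes "g_bounds t"
  shows "norm (gxi t u \<xi>) \<le> \<gamma>" "norm (gu t u \<xi>) \<le> \<omega>" "norm (gt t u \<xi>) \<le> a t"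
    "norm (gxi t u \<xi> - gxi t v \<eta>) \<le> Cxi * (norm (u - v) + norm (\<xi> - \<eta>))"
    "norm (gu t u \<xi> - gu t v \<eta>) \<le> Cu * (norm (u - v) + norm (\<xi> - \<eta>))"
    "norm (gt t u \<xi> - gt t v \<eta>) \<le> b t * (norm (u - v) + norm (\<xi> - \<eta>))"
  using assms unfolding g_bounds_def by blast+

lemma g_cont: "continuous_on ({0..T} \<times> UNIV \<times> UNIV) (\<lambda>(t, u, \<xi>). g t u \<xi>)"
  and gt_deriv: "t \<in> {0..T} \<Longrightarrow> ((\<lambda>s. g s v \<xi>) has_vector_derivative gt t v \<xi>) (at t within {0..T})"
  and gu_deriv: "t \<in> {0..T} \<Longrightarrow> ((\<lambda>v. g t v \<xi>) has_derivative blinfun_apply (gu t v \<xi>)) (at v)"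
  and gxi_deriv: "t \<in> {0..T} \<Longrightarrow> ((\<lambda>\<eta>. g t v \<eta>) has_derivative blinfun_apply (gxi t v \<xi>)) (at \<xi>)"
  and a_int: "a absolutely_integrable_on {0..T}" and b_int: "b absolutely_integrable_on {0..T}"
  and delta_less: "K1 * \<gamma> / c < 1"
  using hypg unfolding hyp_g_def by blast+

lemma g_continuous_compose:
  assumes "continuous_on S p" "continuous_on S q" "continuous_on S r" "\<And>s. s \<in> S \<Longrightarrow> r s \<in> {0..T}"
  shows "continuous_on S (\<lambda>s. g (r s) (p s) (q s))"
proof -
  have "continuous_on S (\<lambda>s. (\<lambda>(t, u, \<xi>). g t u \<xi>) (r s, p s, q s))"
    by (rule continuous_on_compose2[OF g_cont]) (use assms in \<open>auto intro!: continuous_intros\<close>)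
  then show ?thesis by simp
qed

lemma abs_a_int: "(\<lambda>t. \<bar>a t\<bar>) integrable_on {0..T}" and abs_b_int: "(\<lambda>t. \<bar>b t\<bar>) integrable_on {0..T}"
  using a_int b_int by (auto simp: absolutely_integrable_on_def)

lemma gt_has_integral:
  assumes "0 \<le> s" "s \<le> t" "t \<le> T"
  shows "((\<lambda>\<tau>. gt \<tau> v \<xi>) has_integral (g t v \<xi> - g s v \<xi>)) {s..t}"
  by (rule fundamental_theorem_of_calculus)
    (use assms in \<open>auto intro: has_vector_derivative_within_subset[OF gt_deriv]\<close>)

lemma integral_norm_bound_AE:
  fixes f :: "real \<Rightarrow> 'c::banach"
  assumes f: "(f has_integral I) {s..t}" and h: "h integrable_on {0..T}" and st: "0 \<le> s" "s \<le> t" "t \<le> T"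
    and le: "\<And>\<tau>. g_bounds \<tau> \<Longrightarrow> norm (f \<tau>) \<le> h \<tau>"
  shows "norm I \<le> integral {s..t} h"
proof -
  obtain N where N: "negligible N" "\<And>t. t \<in> {0..T} - N \<Longrightarrow> t \<in> {0<..<T} \<and> g_bounds t"
    using g_bounds_AE by (rule AE_interior_obtain_negligible) blast
  define f' where "f' \<tau> = (if \<tau> \<in> N then 0 else f \<tau>)" for \<tau>
  define h' where "h' \<tau> = (if \<tau> \<in> N then 0 else h \<tau>)" for \<tau>
  have f': "(f' has_integral I) {s..t}"
    by (rule has_integral_spike[OF N(1) _ f]) (simp add: f'_def)
  have hi: "h integrable_on {s..t}" using h st by (auto intro: integrable_subinterval_real)
  then have h': "h' integrable_on {s..t}" by (rule integrable_spike[OF _ N(1)]) (simp add: h'_def)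
  have "norm (integral {s..t} f') \<le> integral {s..t} h'"
    by (rule integral_norm_bound_integral) (use f' h' st N(2) le in \<open>auto simp: f'_def h'_def\<close>)
  also have "\<dots> = integral {s..t} h" by (rule integral_spike[OF N(1)]) (simp add: h'_def)
  finally show ?thesis using f' by (simp add: integral_unique)
qed

lemma g_time_increment:
  assumes "0 \<le> s" "s \<le> t" "t \<le> T"
  shows "norm (g t v \<xi> - g s v \<xi>) \<le> integral {s..t} (\<lambda>\<tau>. \<bar>a \<tau>\<bar>)"
  by (rule integral_norm_bound_AE[OF gt_has_integral[OF assms] abs_a_int assms])
    (use g_boundsD(3) in \<open>smt (verit)\<close>)

text \<open>A mixed second-order increment, controlled by the Lipschitz weight b of the time
  derivative. In the chain rule it takes the place of continuity of \<open>gt\<close> in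
  time.\<close>

lemma g_time_increment_diff:
  assumes "0 \<le> s" "s \<le> t" "t \<le> T"
  shows "norm ((g t v \<xi> - g s v \<xi>) - (g t v' \<xi>' - g s v' \<xi>')) \<le>
     integral {s..t} (\<lambda>\<tau>. \<bar>b \<tau>\<bar>) * (norm (v - v') + norm (\<xi> - \<xi>'))"
proof -
  have "norm ((g t v \<xi> - g s v \<xi>) - (g t v' \<xi>' - g s v' \<xi>')) \<le>
     integral {s..t} (\<lambda>\<tau>. \<bar>b \<tau>\<bar> * (norm (v - v') + norm (\<xi> - \<xi>')))"
  proof (rule integral_norm_bound_AE[OF has_integral_diff[OF gt_has_integral[OF assms] gt_has_integral[OF assms]] _ assms])
    show "(\<lambda>\<tau>. \<bar>b \<tau>\<bar> * (norm (v - v') + norm (\<xi> - \<xi>'))) integrable_on {0..T}"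
      using abs_b_int by (rule integrable_on_mult_left)
    fix \<tau> assume "g_bounds \<tau>"
    then have "norm (gt \<tau> v \<xi> - gt \<tau> v' \<xi>') \<le> b \<tau> * (norm (v - v') + norm (\<xi> - \<xi>'))" by (rule g_boundsD)
    also have "\<dots> \<le> \<bar>b \<tau>\<bar> * (norm (v - v') + norm (\<xi> - \<xi>'))" by (intro mult_right_mono) auto
    finally show "norm (gt \<tau> v \<xi> - gt \<tau> v' \<xi>') \<le> \<bar>b \<tau>\<bar> * (norm (v - v') + norm (\<xi> - \<xi>'))" .
  qed
  then show ?thesis by simp
qed

text \<open>The derivative bounds hold for almost every t, where the mean value inequality applies.
  Both sides are continuous in t, so the good times form a closed set of full measure, and therefore
  the whole interval.\<close>

lemma g_lipschitz:
  assumes "t \<in> {0..T}"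
  shows "norm (g t v \<xi> - g t v' \<xi>') \<le> \<omega> * norm (v - v') + \<gamma> * norm (\<xi> - \<xi>')"
proof -
  define C where "C = {t \<in> {0..T}. norm (g t v \<xi> - g t v' \<xi>') \<le> \<omega> * norm (v - v') + \<gamma> * norm (\<xi> - \<xi>')}"
  have good: "t \<in> C" if t: "t \<in> {0<..<T}" and gb: "g_bounds t" for t
  proof -
    have t': "t \<in> {0..T}" using t by auto
    have "norm (g t v \<xi> - g t v' \<xi>) \<le> \<omega> * norm (v - v')"
      by (rule differentiable_bound[of UNIV "\<lambda>v. g t v \<xi>" "\<lambda>v. blinfun_apply (gu t v \<xi>)"])
        (use gu_deriv[OF t'] g_boundsD(2)[OF gb] in \<open>auto simp: norm_blinfun.rep_eq[symmetric]\<close>)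
    moreover have "norm (g t v' \<xi> - g t v' \<xi>') \<le> \<gamma> * norm (\<xi> - \<xi>')"
      by (rule differentiable_bound[of UNIV "\<lambda>\<xi>. g t v' \<xi>" "\<lambda>\<xi>. blinfun_apply (gxi t v' \<xi>)"])
        (use gxi_deriv[OF t'] g_boundsD(1)[OF gb] in \<open>auto simp: norm_blinfun.rep_eq[symmetric]\<close>)
    moreover have "norm (g t v \<xi> - g t v' \<xi>') \<le> norm (g t v \<xi> - g t v' \<xi>) + norm (g t v' \<xi> - g t v' \<xi>')"
      using norm_triangle_ineq[of "g t v \<xi> - g t v' \<xi>" "g t v' \<xi> - g t v' \<xi>'"] by simp
    ultimately show ?thesis using t' by (simp add: C_def)
  qed
  have "closed C"
  proof -
    have "continuous_on {0..T} (\<lambda>t. norm (g t v \<xi> - g t v' \<xi>'))"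
      by (intro continuous_intros g_continuous_compose) auto
    then have "closed ({0..T} \<inter> (\<lambda>t. norm (g t v \<xi> - g t v' \<xi>')) -` {..\<omega> * norm (v - v') + \<gamma> * norm (\<xi> - \<xi>')})"
      by (intro continuous_closed_preimage) auto
    moreover have "\<dots> = C" by (auto simp: C_def)
    ultimately show ?thesis by simp
  qed
  have "{0<..<T} \<subseteq> C"
  proof
    fix s assume "s \<in> {0<..<T}"
    then show "s \<in> C"
      by (rule mem_closed_if_AE_lebesgue_open[OF _ \<open>closed C\<close>, rotated 2])
        (use g_bounds_AE good in \<open>auto elim: eventually_mono\<close>)
  qed
  then have "closure {0<..<T} \<subseteq> C" using \<open>closed C\<close> by (rule closure_minimal)
  then show ?thesis using assms T_pos by (auto simp: C_def)
qed

lemma g_joint_deriv: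
  assumes t: "t \<in> {0..T}" and gb: "g_bounds t"
  shows "((\<lambda>(v, \<xi>). g t v \<xi>) has_derivative (\<lambda>(dv, d\<xi>). gu t v \<xi> dv + gxi t v \<xi> d\<xi>)) (at (v, \<xi>))"
proof -
  have "((\<lambda>z. gxi t (fst z) (snd z) - gxi t v \<xi>) \<longlongrightarrow> 0) (at (v, \<xi>))"
  proof (rule Lim_null_comparison)
    show "\<forall>\<^sub>F z in at (v, \<xi>). norm (gxi t (fst z) (snd z) - gxi t v \<xi>) \<le> Cxi * (norm (fst z - v) + norm (snd z - \<xi>))"
      using g_boundsD(4)[OF gb] by (intro always_eventually) auto
    have "((\<lambda>z. Cxi * (norm (fst z - v) + norm (snd z - \<xi>))) \<longlongrightarrow> Cxi * (norm (fst (v,\<xi>) - v) + norm (snd (v,\<xi>) - \<xi>))) (at (v, \<xi>))"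
      by (intro tendsto_intros tendsto_fst tendsto_snd tendsto_ident_at)
    then show "((\<lambda>z. Cxi * (norm (fst z - v) + norm (snd z - \<xi>))) \<longlongrightarrow> 0) (at (v, \<xi>))" by simp
  qed
  then have "((\<lambda>z. gxi t (fst z) (snd z)) \<longlongrightarrow> gxi t v \<xi>) (at (v, \<xi>))" by (rule LIM_zero_cancel)
  then have cont: "continuous (at (v, \<xi>)) (\<lambda>(v, \<xi>). gxi t v \<xi>)"
    by (simp add: continuous_within case_prod_unfold)
  have "((\<lambda>(v, \<xi>). g t v \<xi>) has_derivative (\<lambda>(dv, d\<xi>). gu t v \<xi> dv + gxi t v \<xi> d\<xi>)) (at (v, \<xi>) within UNIV \<times> UNIV)"
    by (rule has_derivative_partialsI) (use gu_deriv[OF t] gxi_deriv[OF t] cont in auto)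
  then show ?thesis by simp
qed

text \<open>The increment splits into a time increment at frozen state, a state increment at frozen
  time and the mixed remainder R. Near t, R is at most a small factor times the increment of the
  primitive of |b|, so it has derivative 0 where that primitive is differentiable, which is the
  hypothesis \<open>B\<close>.\<close>

lemma g_chain:
  assumes t: "t \<in> {0<..<T}" and gb: "g_bounds t"
    and B: "((\<lambda>t. integral {0..t} (\<lambda>\<tau>. \<bar>b \<tau>\<bar>)) has_vector_derivative \<bar>b t\<bar>) (at t)"
    and p: "(p has_vector_derivative p') (at t)" and q: "(q has_vector_derivative q') (at t)"
  shows "((\<lambda>s. g s (p s) (q s)) has_vector_derivative gt t (p t) (q t) + gu t (p t) (q t) p' + gxi t (p t) (q t) q') (at t)"
proof -
  have t': "t \<in> {0..T}" using t by auto
  let ?B = "\<lambda>t. integral {0..t} (\<lambda>\<tau>. \<bar>b \<tau>\<bar>)"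
  define R where "R s = (g s (p s) (q s) - g t (p s) (q s)) - (g s (p t) (q t) - g t (p t) (q t))" for s
  have R: "(R has_vector_derivative 0) (at t)"
  proof (rule has_vector_derivative_zero_dominated[OF B])
    fix e :: real assume "e > 0"
    have "((\<lambda>s. norm (p s - p t) + norm (q s - q t)) \<longlongrightarrow> norm (p t - p t) + norm (q t - q t)) (at t)"
      using has_vector_derivative_continuous[OF p] has_vector_derivative_continuous[OF q]
      by (intro tendsto_intros) (auto simp: isCont_def)
    then have "\<forall>\<^sub>F s in at t. norm (p s - p t) + norm (q s - q t) < e"
      using \<open>e > 0\<close> by (intro order_tendstoD(2)) auto
    moreover have "\<forall>\<^sub>F s in at t. s \<in> {0<..<T}" using t by (intro eventually_at_in_open') auto
    ultimately show "\<forall>\<^sub>F s in at t. norm (R s - R t) \<le> e * \<bar>?B s - ?B t\<bar>"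
    proof eventually_elim
      case (elim s)
      have "norm (R s - R t) \<le> \<bar>?B s - ?B t\<bar> * (norm (p s - p t) + norm (q s - q t))"
      proof (cases "t \<le> s")
        case True
        have "norm (R s) \<le> integral {t..s} (\<lambda>\<tau>. \<bar>b \<tau>\<bar>) * (norm (p s - p t) + norm (q s - q t))"
          unfolding R_def using True elim t by (intro g_time_increment_diff) auto
        also have "integral {t..s} (\<lambda>\<tau>. \<bar>b \<tau>\<bar>) = ?B s - ?B t"
          using True elim t by (intro integral_diff_interval[OF abs_b_int, symmetric]) auto
        also have "(?B s - ?B t) * (norm (p s - p t) + norm (q s - q t)) \<le> \<bar>?B s - ?B t\<bar> * (norm (p s - p t) + norm (q s - q t))"
          by (intro mult_right_mono) auto
        finally show ?thesis by (simp add: R_def)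
      next
        case False
        have "R s = - ((g t (p s) (q s) - g s (p s) (q s)) - (g t (p t) (q t) - g s (p t) (q t)))"
          by (simp add: R_def)
        then have "norm (R s) = norm ((g t (p s) (q s) - g s (p s) (q s)) - (g t (p t) (q t) - g s (p t) (q t)))"
          by (metis norm_minus_cancel)
        also have "\<dots> \<le> integral {s..t} (\<lambda>\<tau>. \<bar>b \<tau>\<bar>) * (norm (p s - p t) + norm (q s - q t))"
          using False elim t by (intro g_time_increment_diff) auto
        also have "integral {s..t} (\<lambda>\<tau>. \<bar>b \<tau>\<bar>) = ?B t - ?B s"
          using False elim t by (intro integral_diff_interval[OF abs_b_int, symmetric]) auto
        also have "(?B t - ?B s) * (norm (p s - p t) + norm (q s - q t)) \<le> \<bar>?B s - ?B t\<bar> * (norm (p s - p t) + norm (q s - q t))"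
          by (intro mult_right_mono) auto
        finally show ?thesis by (simp add: R_def)
      qed
      also have "\<dots> \<le> \<bar>?B s - ?B t\<bar> * e" using elim by (intro mult_left_mono) auto
      finally show ?case by (simp add: mult.commute)
    qed
  qed
  have "at t within {0..T} = at t" using t by (intro at_within_interior) (auto simp: interior_atLeastAtMost_real)
  then have 2: "((\<lambda>s. g s (p t) (q t)) has_vector_derivative gt t (p t) (q t)) (at t)"
    using gt_deriv[OF t', of "p t" "q t"] by simp
  have "((\<lambda>s. (p s, q s)) has_derivative (\<lambda>h. (h *\<^sub>R p', h *\<^sub>R q'))) (at t)"
    using p q unfolding has_vector_derivative_def by (rule has_derivative_Pair)
  then have "((\<lambda>(v, \<xi>). g t v \<xi>) \<circ> (\<lambda>s. (p s, q s)) has_derivative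
     (\<lambda>(dv, d\<xi>). gu t (p t) (q t) dv + gxi t (p t) (q t) d\<xi>) \<circ> (\<lambda>h. (h *\<^sub>R p', h *\<^sub>R q'))) (at t)"
    by (rule diff_chain_at) (rule g_joint_deriv[OF t' gb])
  then have 3: "((\<lambda>s. g t (p s) (q s)) has_vector_derivative gu t (p t) (q t) p' + gxi t (p t) (q t) q') (at t)"
    by (simp add: has_vector_derivative_def o_def blinfun.scaleR_right scaleR_add_right)
  have "((\<lambda>s. R s + g s (p t) (q t) + g t (p s) (q s) - g t (p t) (q t)) has_vector_derivative
     0 + gt t (p t) (q t) + (gu t (p t) (q t) p' + gxi t (p t) (q t) q') - 0) (at t)"
    by (intro has_vector_derivative_add has_vector_derivative_diff R 2 3 has_vector_derivative_const)
  then show ?thesis by (simp add: R_def add.assoc)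
qed

end

section \<open>The reflection step\<close>

lemma has_vector_derivative_imp_LIMSEQ:
  assumes "(f has_vector_derivative D) (at t)"
  shows "(\<lambda>n. real (Suc n) *\<^sub>R (f (t + 1 / real (Suc n)) - f t)) \<longlonglongrightarrow> D"
proof -
  have "((\<lambda>h. norm (f (t + h) - f t - h *\<^sub>R D) / norm h) \<longlongrightarrow> 0) (at 0)"
    using assms by (simp add: has_vector_derivative_def has_derivative_at)
  moreover have "filterlim (\<lambda>n. 1 / real (Suc n)) (at 0) sequentially"
    unfolding filterlim_at using LIMSEQ_inverse_real_of_nat
    by (auto simp: inverse_eq_divide intro!: always_eventually)
  ultimately have lim: "(\<lambda>n. norm (f (t + 1 / real (Suc n)) - f t - (1 / real (Suc n)) *\<^sub>R D) / norm (1 / real (Suc n))) \<longlonglongrightarrow> 0"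
    by (rule filterlim_compose)
  have "norm (f (t + 1 / real (Suc n)) - f t - (1 / real (Suc n)) *\<^sub>R D) / norm (1 / real (Suc n)) =
      norm (real (Suc n) *\<^sub>R (f (t + 1 / real (Suc n)) - f t) - D)" for n
  proof -
    have "real (Suc n) *\<^sub>R (f (t + 1 / real (Suc n)) - f t) - D =
        real (Suc n) *\<^sub>R (f (t + 1 / real (Suc n)) - f t - (1 / real (Suc n)) *\<^sub>R D)"
      by (simp add: scaleR_diff_right del: of_nat_Suc)
    then show ?thesis by (simp add: divide_simps mult.commute del: of_nat_Suc)
  qed
  then show ?thesis using lim by (simp only: tendsto_norm_zero_iff LIM_zero_iff)
qed

text \<open>Source of the gain 1 / N from the exponential weight. The primitive of \<nu> is only
  absolutely continuous, so the formula comes from the almost everywhere derivative together with an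
  increment bound, the latter by convexity of exp.\<close>

lemma primitive_exp_has_integral:
  fixes \<nu> :: "real \<Rightarrow> real"
  assumes \<nu>: "\<nu> integrable_on {0..T}" "\<And>t. 0 \<le> \<nu> t" and "N > 0" and t: "t \<in> {0..T}"
  shows "((\<lambda>s. \<nu> s * exp (N * integral {0..s} \<nu>)) has_integral ((exp (N * integral {0..t} \<nu>) - 1) / N)) {0..t}"
proof -
  define \<Lambda> where "\<Lambda> s = integral {0..s} \<nu>" for s
  define F where "F s = exp (N * \<Lambda> s) / N" for s
  have sub: "\<nu> integrable_on {p..q}" if "0 \<le> p" "q \<le> T" for p q
    using \<nu>(1) that by (auto intro: integrable_subinterval_real)
  have incr: "\<Lambda> q - \<Lambda> p = integral {p..q} \<nu>" if "0 \<le> p" "p \<le> q" "q \<le> T" for p q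
    using that by (simp add: \<Lambda>_def integral_diff_interval[OF \<nu>(1)])
  have mono: "\<Lambda> p \<le> \<Lambda> q" if "0 \<le> p" "p \<le> q" "q \<le> T" for p q
    using incr[OF that] \<nu>(2) sub[of p q] that Henstock_Kurzweil_Integration.integral_nonneg[of \<nu> "{p..q}"] by auto
  have "((\<lambda>s. \<nu> s * exp (N * \<Lambda> s)) has_integral (F t - F 0)) {0..t}"
  proof (rule has_integral_derivative_AE[where \<phi>="\<lambda>s. \<nu> s * exp (N * \<Lambda> t)"])
    show "(\<lambda>s. \<nu> s * exp (N * \<Lambda> t)) integrable_on {0..t}"
      using sub[of 0 t] t by (intro integrable_on_mult_left) auto
    show "norm (F q - F p) \<le> integral {p..q} (\<lambda>s. \<nu> s * exp (N * \<Lambda> t))" if pq: "0 \<le> p" "p \<le> q" "q \<le> t" for p q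
    proof -
      have le: "\<Lambda> p \<le> \<Lambda> q" "\<Lambda> q \<le> \<Lambda> t" using mono[of p q] mono[of q t] pq t by auto
      have "exp (N * \<Lambda> q) - exp (N * \<Lambda> p) \<le> exp (N * \<Lambda> q) * (N * \<Lambda> q - N * \<Lambda> p)"
      proof -
        have "1 + (N * \<Lambda> p - N * \<Lambda> q) \<le> exp (N * \<Lambda> p - N * \<Lambda> q)" by (rule exp_ge_add_one_self)
        then have "exp (N * \<Lambda> q) * (1 + (N * \<Lambda> p - N * \<Lambda> q)) \<le> exp (N * \<Lambda> q) * exp (N * \<Lambda> p - N * \<Lambda> q)"
          by (intro mult_left_mono) auto
        also have "\<dots> = exp (N * \<Lambda> p)" by (simp flip: exp_add)
        finally show ?thesis by (simp add: algebra_simps)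
      qed
      also have "\<dots> \<le> exp (N * \<Lambda> t) * (N * \<Lambda> q - N * \<Lambda> p)"
        using le \<open>N > 0\<close> by (intro mult_right_mono) auto
      also have "\<dots> = N * (integral {p..q} \<nu> * exp (N * \<Lambda> t))" using incr[of p q] pq t by (simp add: algebra_simps)
      finally have "F q - F p \<le> integral {p..q} \<nu> * exp (N * \<Lambda> t)"
        using \<open>N > 0\<close> by (simp add: F_def field_simps)
      moreover have "F p \<le> F q" using le \<open>N > 0\<close> by (simp add: F_def divide_right_mono)
      ultimately show ?thesis by simp
    qed
    show "AE s in lebesgue. s \<in> {0<..<t} \<longrightarrow> (F has_vector_derivative \<nu> s * exp (N * \<Lambda> s)) (at s)"
      using lebesgue_differentiation_real[OF \<nu>(1)]
    proof eventually_elim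
      case (elim s)
      show ?case
      proof
        assume "s \<in> {0<..<t}"
        then have "(\<Lambda> has_real_derivative \<nu> s) (at s)"
          using elim t by (auto simp: \<Lambda>_def[abs_def] has_real_derivative_iff_has_vector_derivative)
        then have "(F has_real_derivative (exp (N * \<Lambda> s) * (N * \<nu> s)) / N) (at s)"
          unfolding F_def by (auto intro!: derivative_eq_intros)
        then show "(F has_vector_derivative \<nu> s * exp (N * \<Lambda> s)) (at s)"
          using \<open>N > 0\<close> by (simp add: has_real_derivative_iff_has_vector_derivative mult.commute)
      qed
    qed
  qed (use t in auto)
  moreover have "F t - F 0 = (exp (N * \<Lambda> t) - 1) / N" by (simp add: F_def \<Lambda>_def diff_divide_distrib)
  ultimately show ?thesis by (simp add: \<Lambda>_def)
qed

locale sweeping_process = sweeping_data G Gx Gw g gt gu gxi a b T lam c L K0 K1 C0 C1 \<gamma> \<omega> Cxi Cu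
  for G :: "'x::{real_inner,banach} \<Rightarrow> 'w::banach \<Rightarrow> real"
    and Gx :: "'x \<Rightarrow> 'w \<Rightarrow> 'x" and Gw :: "'x \<Rightarrow> 'w \<Rightarrow> ('w \<Rightarrow>\<^sub>L real)"
    and g :: "real \<Rightarrow> 'x \<Rightarrow> 'x \<Rightarrow> 'w" and gt :: "real \<Rightarrow> 'x \<Rightarrow> 'x \<Rightarrow> 'w"
    and gu gxi :: "real \<Rightarrow> 'x \<Rightarrow> 'x \<Rightarrow> ('x \<Rightarrow>\<^sub>L 'w)"
    and a b :: "real \<Rightarrow> real" and T lam c L K0 K1 C0 C1 \<gamma> \<omega> Cxi Cu :: real +
  fixes u u' :: "real \<Rightarrow> 'x" and x0 :: 'x
  assumes u'_int: "u' integrable_on {0..T}" and norm_u'_int: "(\<lambda>t. norm (u' t)) integrable_on {0..T}"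
    and u_eq: "\<And>t. t \<in> {0..T} \<Longrightarrow> u t = u 0 + integral {0..t} u'"
    and u_deriv: "AE t in lebesgue. t \<in> {0<..<T} \<longrightarrow> (u has_vector_derivative u' t) (at t)"
    and x0_in: "G x0 (g 0 (u 0) (u 0 - x0)) \<le> 1"
begin

text \<open>The bound M solves \<open>M = K0 |u'| + K1 (|a| + \<omega> |u'|) + \<delta> M\<close>, so that it is preserved by the reflection step.
  The field V is \<open>\<nabla>\<^sub>x G / |\<nabla>\<^sub>x G|\<^sup>2\<close> on the level set; the truncation makes it bounded and Lipschitz everywhere.\<close>
definition "\<delta> = K1 * \<gamma> / c"
definition "M t = (K0 * norm (u' t) + K1 * (\<bar>a t\<bar> + \<omega> * norm (u' t))) / (1 - \<delta>)"
definition "V x w = (1 / (max (norm (Gx x w)) c)\<^sup>2) *\<^sub>R Gx x w"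
definition "W \<xi> t = g t (u t) (\<xi> t)"
definition "vel \<xi> t = V (u t - \<xi> t) (W \<xi> t)"
definition "CV = 3 * C0 * (1 + \<gamma>) / c\<^sup>2"
text \<open>The times at which all chain rules hold. The condition does not involve \<xi>, so the
  exceptional null set is common to all iterates.\<close>

definition "good t \<longleftrightarrow> t \<in> {0<..<T} \<and> g_bounds t \<and> (u has_vector_derivative u' t) (at t) \<and>
  ((\<lambda>t. integral {0..t} (\<lambda>\<tau>. \<bar>b \<tau>\<bar>)) has_vector_derivative \<bar>b t\<bar>) (at t)"
definition "rate \<xi> m t = gt t (u t) (\<xi> t) + gu t (u t) (\<xi> t) (u' t) + m t *\<^sub>R gxi t (u t) (\<xi> t) (vel \<xi> t)"
text \<open>The derivative of the level if \<xi>' were \<open>m t *\<^sub>R vel \<xi> t\<close>,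
  without the part of it that comes from -\<xi>' in x: that part becomes the reflection term. The
  value 0 at bad times makes pointwise bounds hold at every t.\<close>

definition "drift \<xi> m t = (if good t then inner (Gx (u t - \<xi> t) (W \<xi> t)) (u' t) +
   Gw (u t - \<xi> t) (W \<xi> t) (rate \<xi> m t) else 0)"
definition "adm (\<xi> :: real \<Rightarrow> 'x) m \<longleftrightarrow> continuous_on {0..T} \<xi> \<and> m absolutely_integrable_on {0..T} \<and> (\<forall>t. 0 \<le> m t \<and> m t \<le> M t)"
text \<open>Lipschitz weight of the drift in \<xi>: the three summands come from the variation of
  \<open>Gx\<close>, of \<open>Gw\<close> and of \<open>rate\<close>, in this order.\<close>

definition "\<rho> t = C0 * (1 + \<gamma>) * norm (u' t) + C1 * (1 + \<gamma>) * (\<bar>a t\<bar> + \<omega> * norm (u' t) + \<gamma> * M t / c)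
   + K1 * (\<bar>b t\<bar> + Cu * norm (u' t) + Cxi * M t / c + \<gamma> * M t * CV)"
text \<open>The added term is the Lipschitz weight of the velocity \<open>m vel\<close>, so that a
  single weight serves the estimates of both components.\<close>

definition "\<nu> t = \<rho> t + M t * CV"
definition "\<theta> = (1 + \<delta>) / 2"
text \<open>The first summand gives \<open>2 / (c * N) \<le> (1 - \<delta>) / 2\<close>, which
  closes the gap from \<delta> to its midpoint \<theta> with 1; the second gives
  \<open>1 / N \<le> \<theta> / 2\<close>, for the \<xi> component.\<close>

definition "N = 4 / (c * (1 - \<delta>)) + 2 / \<theta>"
definition "wt t = exp (N * integral {0..t} \<nu>)"
definition "step \<xi> m \<xi>' m' \<longleftrightarrow> skorokhod T (G x0 (g 0 (u 0) (u 0 - x0))) (drift \<xi> m) m' \<and> (\<forall>t. 0 \<le> m' t \<and> m' t \<le> M t) \<and>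
   (\<forall>t\<in>{0..T}. \<xi>' t = u 0 - x0 + integral {0..t} (\<lambda>s. m' s *\<^sub>R vel \<xi> s))"
text \<open>Distance at most A in the weighted norm. The density error \<theta> A contributes
  \<open>\<theta> * A / c\<close> to \<xi>; the factor 2 leaves the same amount for the Volterra
  term.\<close>

definition "close A (\<xi>1 :: real \<Rightarrow> 'x) m1 \<xi>2 m2 \<longleftrightarrow> (\<forall>t\<in>{0..T}. integral {0..t} (\<lambda>s. \<bar>m1 s - m2 s\<bar>) \<le> A * wt t \<and>
   norm (\<xi>1 t - \<xi>2 t) \<le> 2 * A / c * wt t)"

lemma delta: "0 < \<delta>" "\<delta> < 1" "0 < \<theta>" "\<theta> < 1" "N > 0"
proof -
  show d: "0 < \<delta>" "\<delta> < 1" using pos_consts delta_less by (auto simp: \<delta>_def)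
  then show "0 < \<theta>" "\<theta> < 1" by (auto simp: \<theta>_def)
  then show "N > 0" using d pos_consts by (auto simp: N_def intro!: add_pos_pos)
qed

lemma good_AE: "AE t in lebesgue. t \<in> {0<..<T} \<longrightarrow> good t"
  using g_bounds_AE u_deriv lebesgue_differentiation_real[OF abs_b_int]
  by eventually_elim (auto simp: good_def)

lemma not_good_negligible: "negligible {t \<in> {0..T}. \<not> good t}"
proof -
  obtain N where N: "negligible N" "\<And>t. t \<in> {0..T} - N \<Longrightarrow> t \<in> {0<..<T} \<and> good t"
    using good_AE by (rule AE_interior_obtain_negligible) blast
  show ?thesis by (rule negligible_subset[OF N(1)]) (use N(2) in auto)
qed

lemma u_cont: "continuous_on {0..T} u"
proof -
  have "continuous_on {0..T} (\<lambda>t. u 0 + integral {0..t} u')"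
    by (intro continuous_intros indefinite_integral_continuous_1 u'_int)
  then show ?thesis by (rule continuous_on_eq) (rule u_eq[symmetric])
qed

lemma M_nonneg: "0 \<le> M t" and rho_nonneg: "0 \<le> \<rho> t" and nu_nonneg: "0 \<le> \<nu> t" and CV_pos: "CV > 0"
proof -
  show M: "0 \<le> M t" using delta pos_consts by (auto simp: M_def intro!: divide_nonneg_pos add_nonneg_nonneg mult_nonneg_nonneg)
  show CV: "CV > 0" using pos_consts by (auto simp: CV_def intro!: divide_pos_pos mult_pos_pos)
  show l: "0 \<le> \<rho> t" unfolding \<rho>_def using M CV pos_consts
    by (intro add_nonneg_nonneg mult_nonneg_nonneg divide_nonneg_pos) auto
  show "0 \<le> \<nu> t" using M CV l by (simp add: \<nu>_def)
qed

lemma M_int: "M integrable_on {0..T}"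
  unfolding M_def using norm_u'_int abs_a_int
  by (intro integrable_on_divide integrable_add integrable_on_mult_right) auto

lemma nu_int: "\<nu> integrable_on {0..T}"
proof -
  have "\<rho> integrable_on {0..T}"
    unfolding \<rho>_def using norm_u'_int abs_a_int abs_b_int M_int
    by (intro integrable_on_divide integrable_add integrable_on_mult_right integrable_on_mult_left) auto
  then show ?thesis unfolding \<nu>_def using M_int by (intro integrable_add integrable_on_mult_left)
qed

section \<open>Estimates for the velocity field and the drift\<close>

lemma V_bound: "norm (V x w) \<le> 1 / c"
proof -
  let ?n = "norm (Gx x w)" and ?m = "max (norm (Gx x w)) c"
  have "norm (V x w) = ?n / ?m\<^sup>2" by (simp add: V_def)
  also have "\<dots> \<le> ?m / ?m\<^sup>2" by (intro divide_right_mono) auto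
  also have "\<dots> = 1 / ?m" by (simp add: power2_eq_square)
  also have "\<dots> \<le> 1 / c" using pos_consts by (intro frac_le) auto
  finally show ?thesis .
qed

text \<open>The truncated norm is 1-Lipschitz in the gradient. Changing the vector costs 1 / c^2;
  changing the scalar costs 2 / c^2, because the remaining factor \<open>norm z'\<close> is at most
  \<open>n'\<close> and cancels one power of the denominator. Together they give the 3.\<close>

lemma V_lip: "norm (V x w - V x' w') \<le> 3 * C0 / c\<^sup>2 * (norm (x - x') + norm (w - w'))"
proof -
  define z z' where "z = Gx x w" and "z' = Gx x' w'"
  define n n' where "n = max (norm z) c" and "n' = max (norm z') c"
  have n: "n \<ge> c" "n' \<ge> c" "n > 0" "n' > 0" "norm z' \<le> n'" using pos_consts by (auto simp: n_def n'_def max_def)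
  define D where "D = norm (z - z')"
  have "\<bar>norm z - norm z'\<bar> \<le> D" unfolding D_def by (rule norm_triangle_ineq3)
  then have nn: "\<bar>n' - n\<bar> \<le> D" by (auto simp: n_def n'_def max_def abs_if split: if_splits)
  have D0: "D \<ge> 0" by (simp add: D_def)
  have "V x w - V x' w' = (1 / n\<^sup>2) *\<^sub>R (z - z') + (1 / n\<^sup>2 - 1 / n'\<^sup>2) *\<^sub>R z'"
    by (simp add: V_def z_def z'_def n_def n'_def algebra_simps)
  then have "norm (V x w - V x' w') \<le> norm ((1 / n\<^sup>2) *\<^sub>R (z - z')) + norm ((1 / n\<^sup>2 - 1 / n'\<^sup>2) *\<^sub>R z')"
    by (simp only: norm_triangle_ineq)
  also have "norm ((1 / n\<^sup>2) *\<^sub>R (z - z')) \<le> D / c\<^sup>2"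
    using n pos_consts by (simp add: D_def divide_simps mult_left_mono)
  also have "norm ((1 / n\<^sup>2 - 1 / n'\<^sup>2) *\<^sub>R z') \<le> 2 * D / c\<^sup>2"
  proof -
    have "1 / n\<^sup>2 - 1 / n'\<^sup>2 = (n' - n) * ((n' + n) / (n\<^sup>2 * n'\<^sup>2))"
      using n by (simp add: field_simps power2_eq_square)
    then have "norm ((1 / n\<^sup>2 - 1 / n'\<^sup>2) *\<^sub>R z') = \<bar>n' - n\<bar> * (((n' + n) / (n\<^sup>2 * n'\<^sup>2)) * norm z')"
      using n by (simp add: abs_mult)
    also have "\<dots> \<le> D * (((n' + n) / (n\<^sup>2 * n'\<^sup>2)) * n')"
      using n nn D0 by (intro mult_mono mult_left_mono) auto
    also have "((n' + n) / (n\<^sup>2 * n'\<^sup>2)) * n' = 1 / (n * n) + 1 / (n * n')"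
      using n by (simp add: field_simps power2_eq_square)
    also have "D * (1 / (n * n) + 1 / (n * n')) \<le> D * (1 / (c * c) + 1 / (c * c))"
      using n pos_consts D0 by (intro mult_left_mono add_mono divide_left_mono mult_mono) auto
    finally show ?thesis by (simp add: power2_eq_square mult.commute)
  qed
  finally have "norm (V x w - V x' w') \<le> 3 / c\<^sup>2 * D" by simp
  also have "\<dots> \<le> 3 / c\<^sup>2 * (C0 * (norm (x - x') + norm (w - w')))"
    unfolding D_def z_def z'_def by (intro mult_left_mono Gx_lip) auto
  finally show ?thesis by simp
qed

lemma W_diff: "t \<in> {0..T} \<Longrightarrow> norm (W \<xi>1 t - W \<xi>2 t) \<le> \<gamma> * norm (\<xi>1 t - \<xi>2 t)"
  using g_lipschitz[of t "u t" "\<xi>1 t" "u t" "\<xi>2 t"] by (simp add: W_def)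

lemma xw_diff: "t \<in> {0..T} \<Longrightarrow>
  norm ((u t - \<xi>1 t) - (u t - \<xi>2 t)) + norm (W \<xi>1 t - W \<xi>2 t) \<le> (1 + \<gamma>) * norm (\<xi>1 t - \<xi>2 t)"
  using W_diff[of t \<xi>1 \<xi>2] by (simp add: norm_minus_commute algebra_simps)

lemma vel_diff: assumes "t \<in> {0..T}" shows "norm (vel \<xi>1 t - vel \<xi>2 t) \<le> CV * norm (\<xi>1 t - \<xi>2 t)"
proof -
  have "norm (vel \<xi>1 t - vel \<xi>2 t) \<le> 3 * C0 / c\<^sup>2 * (norm ((u t - \<xi>1 t) - (u t - \<xi>2 t)) + norm (W \<xi>1 t - W \<xi>2 t))"
    unfolding vel_def by (rule V_lip)
  also have "\<dots> \<le> 3 * C0 / c\<^sup>2 * ((1 + \<gamma>) * norm (\<xi>1 t - \<xi>2 t))"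
    using pos_consts by (intro mult_left_mono xw_diff assms) auto
  finally show ?thesis by (simp add: CV_def)
qed

lemma vel_bound: "norm (vel \<xi> t) \<le> 1 / c" unfolding vel_def by (rule V_bound)

lemma lipschitz_compose_continuous:
  fixes h :: "'x \<Rightarrow> 'w \<Rightarrow> 'e::real_normed_vector"
  assumes lip: "\<And>x w x' w'. norm (h x w - h x' w') \<le> C * (norm (x - x') + norm (w - w'))"
    and p: "continuous_on S p" and q: "continuous_on S q"
  shows "continuous_on S (\<lambda>t. h (p t) (q t))"
  unfolding continuous_on_def
proof
  fix t assume t: "t \<in> S"
  have "((\<lambda>s. h (p s) (q s) - h (p t) (q t)) \<longlongrightarrow> 0) (at t within S)"
  proof (rule Lim_null_comparison)
    show "\<forall>\<^sub>F s in at t within S. norm (h (p s) (q s) - h (p t) (q t)) \<le> C * (norm (p s - p t) + norm (q s - q t))"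
      using lip by (intro always_eventually) auto
    have "((\<lambda>s. C * (norm (p s - p t) + norm (q s - q t))) \<longlongrightarrow> C * (norm (p t - p t) + norm (q t - q t))) (at t within S)"
      using p q t by (intro tendsto_intros) (auto simp: continuous_on_def)
    then show "((\<lambda>s. C * (norm (p s - p t) + norm (q s - q t))) \<longlongrightarrow> 0) (at t within S)" by simp
  qed
  then show "((\<lambda>s. h (p s) (q s)) \<longlongrightarrow> h (p t) (q t)) (at t within S)" by (rule LIM_zero_cancel)
qed

lemma W_cont: "continuous_on {0..T} \<xi> \<Longrightarrow> continuous_on {0..T} (W \<xi>)"
  unfolding W_def by (intro g_continuous_compose u_cont continuous_intros) auto

lemma compose_cont:
  assumes "continuous_on {0..T} \<xi>"
  shows "continuous_on {0..T} (vel \<xi>)"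
    "continuous_on {0..T} (\<lambda>t. Gx (u t - \<xi> t) (W \<xi> t))" "continuous_on {0..T} (\<lambda>t. Gw (u t - \<xi> t) (W \<xi> t))"
  unfolding vel_def
  by (rule lipschitz_compose_continuous[OF V_lip] lipschitz_compose_continuous[OF Gx_lip]
      lipschitz_compose_continuous[OF Gw_lip]; intro W_cont continuous_on_diff u_cont assms)+

lemma rate_bound:
  assumes gb: "g_bounds t" and "0 \<le> m t" "m t \<le> M t"
  shows "norm (rate \<xi> m t) \<le> \<bar>a t\<bar> + \<omega> * norm (u' t) + \<gamma> * M t / c"
proof -
  have "norm (gu t (u t) (\<xi> t) (u' t)) \<le> \<omega> * norm (u' t)"
    by (meson norm_blinfun order_trans mult_right_mono g_boundsD(2)[OF gb] norm_ge_zero)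
  moreover have "norm (gxi t (u t) (\<xi> t) (vel \<xi> t)) \<le> \<gamma> * (1 / c)"
    using norm_blinfun[of "gxi t (u t) (\<xi> t)" "vel \<xi> t"] g_boundsD(1)[OF gb, of "u t" "\<xi> t"] vel_bound[of \<xi> t] pos_consts
    by (meson mult_mono norm_ge_zero order_trans less_imp_le)
  then have "m t * norm (gxi t (u t) (\<xi> t) (vel \<xi> t)) \<le> M t * (\<gamma> * (1 / c))"
    using assms by (intro mult_mono) auto
  moreover have "norm (gt t (u t) (\<xi> t)) \<le> \<bar>a t\<bar>" using g_boundsD(3)[OF gb, of "u t" "\<xi> t"] by linarith
  moreover have "norm (rate \<xi> m t) \<le> norm (gt t (u t) (\<xi> t)) + norm (gu t (u t) (\<xi> t) (u' t)) + m t * norm (gxi t (u t) (\<xi> t) (vel \<xi> t))"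
    using assms(2) norm_triangle_ineq[of "gt t (u t) (\<xi> t) + gu t (u t) (\<xi> t) (u' t)" "m t *\<^sub>R gxi t (u t) (\<xi> t) (vel \<xi> t)"]
      norm_triangle_ineq[of "gt t (u t) (\<xi> t)" "gu t (u t) (\<xi> t) (u' t)"] by (simp add: rate_def)
  ultimately show ?thesis by (simp add: mult.commute)
qed

lemma drift_bound:
  assumes "0 \<le> m t" "m t \<le> M t"
  shows "\<bar>drift \<xi> m t\<bar> \<le> M t"
proof (cases "good t")
  case True
  then have gb: "g_bounds t" by (simp add: good_def)
  let ?x = "u t - \<xi> t" and ?w = "W \<xi> t" and ?z = "rate \<xi> m t"
  have "\<bar>Gw ?x ?w ?z\<bar> \<le> norm (Gw ?x ?w) * norm ?z" using norm_blinfun[of "Gw ?x ?w" ?z] by simp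
  also have "\<dots> \<le> K1 * (\<bar>a t\<bar> + \<omega> * norm (u' t) + \<gamma> * M t / c)"
    using rate_bound[where m=m, OF gb assms] pos_consts by (intro mult_mono Gw_bound) auto
  finally have 1: "\<bar>Gw ?x ?w ?z\<bar> \<le> K1 * (\<bar>a t\<bar> + \<omega> * norm (u' t)) + \<delta> * M t"
    by (simp add: \<delta>_def algebra_simps)
  have "\<bar>inner (Gx ?x ?w) (u' t)\<bar> \<le> norm (Gx ?x ?w) * norm (u' t)" by (rule Cauchy_Schwarz_ineq2)
  also have "\<dots> \<le> K0 * norm (u' t)" by (intro mult_right_mono Gx_bound) auto
  finally have "\<bar>drift \<xi> m t\<bar> \<le> K0 * norm (u' t) + K1 * (\<bar>a t\<bar> + \<omega> * norm (u' t)) + \<delta> * M t"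
    using 1 True by (simp add: drift_def)
  also have "K0 * norm (u' t) + K1 * (\<bar>a t\<bar> + \<omega> * norm (u' t)) = (1 - \<delta>) * M t"
    using delta by (simp add: M_def)
  finally show ?thesis by (simp add: algebra_simps)
qed (use M_nonneg[of t] in \<open>simp add: drift_def\<close>)

text \<open>At good times the drift is the limit of difference quotients of g and u, composed with
  continuous gradients, plus the scalar m times such quotients. These are absolutely integrable and
  converge pointwise, and M dominates the limit, so dominated convergence applies.\<close>

lemma drift_int:
  assumes "adm \<xi> m"
  shows "drift \<xi> m absolutely_integrable_on {0..T}"
proof -
  have \<xi>: "continuous_on {0..T} \<xi>" and m: "m absolutely_integrable_on {0..T}" and mM: "\<And>t. 0 \<le> m t \<and> m t \<le> M t"
    using assms by (auto simp: adm_def)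
  \<comment> \<open>The cut at T keeps the shifted time where g and u are controlled; at a good
    time, which is interior, it is eventually inactive.\<close>
  define k where "k n t = min (t + 1 / real (Suc n)) T" for n t
  \<comment> \<open>Time and u move while \<xi> stays at \<open>\<xi> t\<close>, because the
    velocity direction is tested separately in \<open>C\<close>: the actual derivative of \<xi> need
    not be \<open>m vel\<close> here.\<close>
  define A where "A n t = real (Suc n) * (inner (Gx (u t - \<xi> t) (W \<xi> t)) (u (k n t) - u t)
    + Gw (u t - \<xi> t) (W \<xi> t) (g (k n t) (u (k n t)) (\<xi> t) - g t (u t) (\<xi> t)))" for n t
  define C where "C n t = real (Suc n) * Gw (u t - \<xi> t) (W \<xi> t) (g t (u t) (\<xi> t + (1 / real (Suc n)) *\<^sub>R vel \<xi> t) - g t (u t) (\<xi> t))" for n t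
  define F where "F n t = (if good t then A n t + m t * C n t else 0)" for n t
  have kin: "k n t \<in> {0..T}" if "t \<in> {0..T}" for n t using that T_pos by (auto simp: k_def)
  have kc: "continuous_on {0..T} (k n)" for n unfolding k_def by (intro continuous_intros)
  have ukc: "continuous_on {0..T} (\<lambda>t. u (k n t))" for n
    by (rule continuous_on_compose2[OF u_cont kc]) (use kin in auto)
  note cc = compose_cont[OF \<xi>]
  have Ac: "continuous_on {0..T} (A n)" for n
    unfolding A_def by (intro continuous_intros cc blinfun.continuous_on g_continuous_compose u_cont \<xi> ukc kc kin) auto
  have Cc: "continuous_on {0..T} (C n)" for n
    unfolding C_def by (intro continuous_intros cc blinfun.continuous_on g_continuous_compose u_cont \<xi>) auto
  have Fint: "F n absolutely_integrable_on {0..T}" for n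
  proof (rule absolutely_integrable_spike[OF _ not_good_negligible])
    have "(\<lambda>t. C n t * m t) absolutely_integrable_on {0..T}"
      using m by (intro absolutely_integrable_bounded_measurable_product_real continuous_imp_measurable_on_sets_lebesgue
          compact_imp_bounded compact_continuous_image Cc) auto
    then show "(\<lambda>t. A n t + m t * C n t) absolutely_integrable_on {0..T}"
      using absolutely_integrable_continuous_real[OF Ac] by (intro set_integral_add) (simp_all add: mult.commute)
    show "F n t = A n t + m t * C n t" if "t \<in> {0..T} - {t \<in> {0..T}. \<not> good t}" for t
      using that by (simp add: F_def)
  qed
  show ?thesis
  proof (rule dominated_convergence_absolutely_integrable[OF Fint M_int])
    show "norm (drift \<xi> m t) \<le> M t" for t using drift_bound mM by simp
    fix t assume t: "t \<in> {0..T}"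
    show "(\<lambda>n. F n t) \<longlonglongrightarrow> drift \<xi> m t"
    proof (cases "good t")
      case True
      then have t': "t \<in> {0<..<T}" and gb: "g_bounds t" and ud: "(u has_vector_derivative u' t) (at t)"
        and bd: "((\<lambda>t. integral {0..t} (\<lambda>\<tau>. \<bar>b \<tau>\<bar>)) has_vector_derivative \<bar>b t\<bar>) (at t)"
        by (auto simp: good_def)
      let ?Gx = "Gx (u t - \<xi> t) (W \<xi> t)" and ?Gw = "Gw (u t - \<xi> t) (W \<xi> t)"
      have "((\<lambda>s. g s (u s) (\<xi> t)) has_vector_derivative gt t (u t) (\<xi> t) + gu t (u t) (\<xi> t) (u' t) + gxi t (u t) (\<xi> t) 0) (at t)"
        by (rule g_chain[OF t' gb bd ud has_vector_derivative_const])
      then have "((\<lambda>s. inner ?Gx (u s) + ?Gw (g s (u s) (\<xi> t))) has_vector_derivative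
          inner ?Gx (u' t) + ?Gw (gt t (u t) (\<xi> t) + gu t (u t) (\<xi> t) (u' t))) (at t)"
        using bounded_linear.has_vector_derivative[OF bounded_linear_inner_right ud]
          bounded_linear.has_vector_derivative[OF blinfun.bounded_linear_right]
        by (intro has_vector_derivative_add) (auto simp: blinfun.zero_right)
      from has_vector_derivative_imp_LIMSEQ[OF this]
      have "(\<lambda>n. real (Suc n) *\<^sub>R ((inner ?Gx (u (t + 1 / real (Suc n))) + ?Gw (g (t + 1 / real (Suc n)) (u (t + 1 / real (Suc n))) (\<xi> t)))
         - (inner ?Gx (u t) + ?Gw (g t (u t) (\<xi> t))))) \<longlonglongrightarrow> inner ?Gx (u' t) + ?Gw (gt t (u t) (\<xi> t) + gu t (u t) (\<xi> t) (u' t))" .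
      moreover have "\<forall>\<^sub>F n in sequentially. real (Suc n) *\<^sub>R ((inner ?Gx (u (t + 1 / real (Suc n))) + ?Gw (g (t + 1 / real (Suc n)) (u (t + 1 / real (Suc n))) (\<xi> t)))
         - (inner ?Gx (u t) + ?Gw (g t (u t) (\<xi> t)))) = A n t"
      proof -
        have "\<forall>\<^sub>F n in sequentially. 1 / real (Suc n) < T - t"
          using order_tendstoD(2)[OF LIMSEQ_inverse_real_of_nat, of "T - t"] t' by (simp add: inverse_eq_divide)
        then show ?thesis
        proof eventually_elim
          case (elim n)
          then have "k n t = t + 1 / real (Suc n)" by (simp add: k_def)
          then show ?case by (simp add: A_def inner_diff_right blinfun.diff_right algebra_simps del: of_nat_Suc)
        qed
      qed
      ultimately have Alim: "(\<lambda>n. A n t) \<longlonglongrightarrow> inner ?Gx (u' t) + ?Gw (gt t (u t) (\<xi> t) + gu t (u t) (\<xi> t) (u' t))"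
        by (rule Lim_transform_eventually)
      have "((\<lambda>s. \<xi> t + s *\<^sub>R vel \<xi> t) has_derivative (\<lambda>h. h *\<^sub>R vel \<xi> t)) (at 0)"
        by (auto intro!: derivative_eq_intros)
      then have "((\<lambda>\<eta>. g t (u t) \<eta>) \<circ> (\<lambda>s. \<xi> t + s *\<^sub>R vel \<xi> t) has_derivative
          blinfun_apply (gxi t (u t) (\<xi> t)) \<circ> (\<lambda>h. h *\<^sub>R vel \<xi> t)) (at 0)"
        by (rule diff_chain_at) (use gxi_deriv[OF t, of "u t" "\<xi> t"] in simp)
      then have "((\<lambda>s. g t (u t) (\<xi> t + s *\<^sub>R vel \<xi> t)) has_vector_derivative gxi t (u t) (\<xi> t) (vel \<xi> t)) (at 0)"
        by (simp add: has_vector_derivative_def o_def blinfun.scaleR_right)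
      from has_vector_derivative_imp_LIMSEQ[OF bounded_linear.has_vector_derivative[OF blinfun.bounded_linear_right this, of ?Gw]]
      have "(\<lambda>n. C n t) \<longlonglongrightarrow> ?Gw (gxi t (u t) (\<xi> t) (vel \<xi> t))"
        by (simp add: C_def blinfun.diff_right del: of_nat_Suc)
      with Alim have "(\<lambda>n. A n t + m t * C n t) \<longlonglongrightarrow> inner ?Gx (u' t) + ?Gw (gt t (u t) (\<xi> t) + gu t (u t) (\<xi> t) (u' t))
         + m t * ?Gw (gxi t (u t) (\<xi> t) (vel \<xi> t))" by (intro tendsto_intros)
      then show ?thesis using True by (simp add: F_def drift_def rate_def blinfun.add_right blinfun.scaleR_right add.assoc)
    qed (simp add: F_def drift_def)
  qed
qed

text \<open>The difference is telescoped so that m changes in the last term only. Its coefficient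
  \<gamma> / c, multiplied by the bound K1 for \<open>Gw\<close>, is the contraction constant
  \<delta>; all other terms carry an integrable weight times the distance of \<xi>1 and
  \<xi>2.\<close>

lemma rate_diff:
  assumes good: "good t" and m1: "0 \<le> m1 t" "m1 t \<le> M t" and m2: "0 \<le> m2 t" "m2 t \<le> M t"
  shows "norm (rate \<xi>1 m1 t - rate \<xi>2 m2 t) \<le>
    (\<bar>b t\<bar> + Cu * norm (u' t) + Cxi * M t / c + \<gamma> * M t * CV) * norm (\<xi>1 t - \<xi>2 t) + \<gamma> / c * \<bar>m1 t - m2 t\<bar>"
proof -
  have gb: "g_bounds t" and t: "t \<in> {0..T}" using good by (auto simp: good_def)
  define e where "e = norm (\<xi>1 t - \<xi>2 t)"
  have e: "e \<ge> 0" by (simp add: e_def)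
  let ?A = "gt t (u t) (\<xi>1 t) - gt t (u t) (\<xi>2 t)"
  let ?B = "(gu t (u t) (\<xi>1 t) - gu t (u t) (\<xi>2 t)) (u' t)"
  let ?C = "m1 t *\<^sub>R (gxi t (u t) (\<xi>1 t) - gxi t (u t) (\<xi>2 t)) (vel \<xi>1 t)"
  let ?D = "m1 t *\<^sub>R gxi t (u t) (\<xi>2 t) (vel \<xi>1 t - vel \<xi>2 t)"
  let ?E = "(m1 t - m2 t) *\<^sub>R gxi t (u t) (\<xi>2 t) (vel \<xi>2 t)"
  have eq: "rate \<xi>1 m1 t - rate \<xi>2 m2 t = ?A + ?B + ?C + ?D + ?E"
    by (simp add: rate_def blinfun.diff_left blinfun.diff_right scaleR_diff_left scaleR_diff_right)
  have A: "norm ?A \<le> \<bar>b t\<bar> * e"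
  proof -
    have "norm ?A \<le> b t * e" using g_boundsD(6)[OF gb, of "u t" "\<xi>1 t" "u t" "\<xi>2 t"] by (simp add: e_def)
    also have "\<dots> \<le> \<bar>b t\<bar> * e" using e by (intro mult_right_mono) auto
    finally show ?thesis .
  qed
  have B: "norm ?B \<le> (Cu * e) * norm (u' t)"
    using g_boundsD(5)[OF gb, of "u t" "\<xi>1 t" "u t" "\<xi>2 t"]
    by (intro order_trans[OF norm_blinfun] mult_right_mono) (auto simp: e_def)
  have C: "norm ?C \<le> M t * ((Cxi * e) * (1 / c))"
  proof -
    have "norm ((gxi t (u t) (\<xi>1 t) - gxi t (u t) (\<xi>2 t)) (vel \<xi>1 t)) \<le> (Cxi * e) * (1 / c)"
      using g_boundsD(4)[OF gb, of "u t" "\<xi>1 t" "u t" "\<xi>2 t"] vel_bound pos_consts e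
      by (intro order_trans[OF norm_blinfun] mult_mono) (auto simp: e_def)
    then show ?thesis unfolding norm_scaleR using m1 M_nonneg[of t] by (intro mult_mono) auto
  qed
  have D: "norm ?D \<le> M t * (\<gamma> * (CV * e))"
  proof -
    have "norm (gxi t (u t) (\<xi>2 t) (vel \<xi>1 t - vel \<xi>2 t)) \<le> \<gamma> * (CV * e)"
      using g_boundsD(1)[OF gb, of "u t" "\<xi>2 t"] vel_diff[OF t] pos_consts
      by (intro order_trans[OF norm_blinfun] mult_mono) (auto simp: e_def)
    then show ?thesis unfolding norm_scaleR using m1 M_nonneg[of t] by (intro mult_mono) auto
  qed
  have E: "norm ?E \<le> \<bar>m1 t - m2 t\<bar> * (\<gamma> * (1 / c))"
  proof -
    have "norm (gxi t (u t) (\<xi>2 t) (vel \<xi>2 t)) \<le> \<gamma> * (1 / c)"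
      using g_boundsD(1)[OF gb, of "u t" "\<xi>2 t"] vel_bound pos_consts
      by (intro order_trans[OF norm_blinfun] mult_mono) auto
    then show ?thesis unfolding norm_scaleR by (intro mult_left_mono) auto
  qed
  have "norm (?A + ?B + ?C + ?D + ?E) \<le> norm ?A + norm ?B + norm ?C + norm ?D + norm ?E"
    by (intro norm_triangle_le add_mono order_refl)
  then show ?thesis unfolding eq e_def[symmetric] using A B C D E by (simp add: algebra_simps)
qed

lemma drift_diff:
  assumes t: "t \<in> {0..T}" and m1: "0 \<le> m1 t" "m1 t \<le> M t" and m2: "0 \<le> m2 t" "m2 t \<le> M t"
  shows "\<bar>drift \<xi>1 m1 t - drift \<xi>2 m2 t\<bar> \<le> \<delta> * \<bar>m1 t - m2 t\<bar> + \<rho> t * norm (\<xi>1 t - \<xi>2 t)"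
proof (cases "good t")
  case False
  then show ?thesis using rho_nonneg[of t] delta by (simp add: drift_def)
next
  case True
  then have gb: "g_bounds t" by (simp add: good_def)
  define e where "e = norm (\<xi>1 t - \<xi>2 t)"
  let ?x1 = "u t - \<xi>1 t" and ?x2 = "u t - \<xi>2 t" and ?w1 = "W \<xi>1 t" and ?w2 = "W \<xi>2 t"
  let ?z1 = "rate \<xi>1 m1 t" and ?z2 = "rate \<xi>2 m2 t"
  have xw: "norm (?x1 - ?x2) + norm (?w1 - ?w2) \<le> (1 + \<gamma>) * e" unfolding e_def by (rule xw_diff[OF t])
  have "\<bar>inner (Gx ?x1 ?w1 - Gx ?x2 ?w2) (u' t)\<bar> \<le> norm (Gx ?x1 ?w1 - Gx ?x2 ?w2) * norm (u' t)"
    by (rule Cauchy_Schwarz_ineq2)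
  also have "\<dots> \<le> (C0 * ((1 + \<gamma>) * e)) * norm (u' t)"
    using xw pos_consts by (intro mult_right_mono order_trans[OF Gx_lip] mult_left_mono) auto
  finally have 1: "\<bar>inner (Gx ?x1 ?w1 - Gx ?x2 ?w2) (u' t)\<bar> \<le> (C0 * ((1 + \<gamma>) * e)) * norm (u' t)" .
  have "\<bar>(Gw ?x1 ?w1 - Gw ?x2 ?w2) ?z1\<bar> \<le> norm (Gw ?x1 ?w1 - Gw ?x2 ?w2) * norm ?z1"
    using norm_blinfun[of "Gw ?x1 ?w1 - Gw ?x2 ?w2" ?z1] by simp
  also have "\<dots> \<le> (C1 * ((1 + \<gamma>) * e)) * (\<bar>a t\<bar> + \<omega> * norm (u' t) + \<gamma> * M t / c)"
    using xw pos_consts rate_bound[where m=m1, OF gb m1]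
    by (intro mult_mono order_trans[OF Gw_lip] mult_left_mono) (auto simp: e_def)
  finally have 2: "\<bar>(Gw ?x1 ?w1 - Gw ?x2 ?w2) ?z1\<bar> \<le> (C1 * ((1 + \<gamma>) * e)) * (\<bar>a t\<bar> + \<omega> * norm (u' t) + \<gamma> * M t / c)" .
  have "\<bar>Gw ?x2 ?w2 (?z1 - ?z2)\<bar> \<le> norm (Gw ?x2 ?w2) * norm (?z1 - ?z2)"
    using norm_blinfun[of "Gw ?x2 ?w2" "?z1 - ?z2"] by simp
  also have "\<dots> \<le> K1 * ((\<bar>b t\<bar> + Cu * norm (u' t) + Cxi * M t / c + \<gamma> * M t * CV) * e + \<gamma> / c * \<bar>m1 t - m2 t\<bar>)"
    unfolding e_def using pos_consts by (intro mult_mono Gw_bound rate_diff True m1 m2) auto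
  finally have 3: "\<bar>Gw ?x2 ?w2 (?z1 - ?z2)\<bar> \<le> K1 * ((\<bar>b t\<bar> + Cu * norm (u' t) + Cxi * M t / c + \<gamma> * M t * CV) * e) + \<delta> * \<bar>m1 t - m2 t\<bar>"
    by (simp add: \<delta>_def distrib_left)
  have "drift \<xi>1 m1 t - drift \<xi>2 m2 t = inner (Gx ?x1 ?w1 - Gx ?x2 ?w2) (u' t) + (Gw ?x1 ?w1 - Gw ?x2 ?w2) ?z1 + Gw ?x2 ?w2 (?z1 - ?z2)"
    using True by (simp add: drift_def inner_diff_left blinfun.diff_left blinfun.diff_right)
  moreover have tri: "\<bar>p + q + r\<bar> \<le> P + Q + R" if "\<bar>p\<bar> \<le> P" "\<bar>q\<bar> \<le> Q" "\<bar>r\<bar> \<le> R" for p q r P Q R :: real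
    using that by linarith
  ultimately have "\<bar>drift \<xi>1 m1 t - drift \<xi>2 m2 t\<bar> \<le> (C0 * ((1 + \<gamma>) * e)) * norm (u' t) +
     (C1 * ((1 + \<gamma>) * e)) * (\<bar>a t\<bar> + \<omega> * norm (u' t) + \<gamma> * M t / c) +
     (K1 * ((\<bar>b t\<bar> + Cu * norm (u' t) + Cxi * M t / c + \<gamma> * M t * CV) * e) + \<delta> * \<bar>m1 t - m2 t\<bar>)"
    using tri[OF 1 2 3] by (simp only:)
  also have "\<dots> = \<delta> * \<bar>m1 t - m2 t\<bar> + \<rho> t * e"
  proof -
    define X where "X = \<bar>a t\<bar> + \<omega> * norm (u' t) + \<gamma> * M t / c"
    define Y where "Y = \<bar>b t\<bar> + Cu * norm (u' t) + Cxi * M t / c + \<gamma> * M t * CV"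
    have "\<rho> t = C0 * (1 + \<gamma>) * norm (u' t) + C1 * (1 + \<gamma>) * X + K1 * Y" by (simp add: \<rho>_def X_def Y_def)
    then show ?thesis unfolding X_def[symmetric] Y_def[symmetric] by (simp add: algebra_simps)
  qed
  finally show ?thesis by (simp add: e_def)
qed

section \<open>Contraction of the reflection step in the weighted norm\<close>

lemma abs_int_sub:
  fixes f :: "real \<Rightarrow> real"
  assumes "f absolutely_integrable_on {0..T}" "t \<in> {0..T}"
  shows "f integrable_on {0..t}" "(\<lambda>s. \<bar>f s\<bar>) integrable_on {0..t}"
  using assms by (auto simp: absolutely_integrable_on_def intro: integrable_subinterval_real)

lemma weighted_int:
  fixes h :: "real \<Rightarrow> real" and \<xi> :: "real \<Rightarrow> 'x"
  assumes "h integrable_on {0..T}" "\<And>t. 0 \<le> h t" "continuous_on {0..T} \<xi>" "t \<in> {0..T}"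
  shows "(\<lambda>s. h s * norm (\<xi> s)) integrable_on {0..t}"
proof -
  have "h absolutely_integrable_on {0..T}" using assms by (intro nonnegative_absolutely_integrable_1)
  then have "(\<lambda>s. h s *\<^sub>R norm (\<xi> s)) integrable_on {0..T}"
    by (rule integrable_on_scaleR_continuous) (intro continuous_intros assms)
  then show ?thesis using assms(4) by (auto intro: integrable_subinterval_real)
qed

lemma step_exists:
  assumes "adm \<xi> m"
  obtains \<xi>' m' where "step \<xi> m \<xi>' m'"
proof -
  obtain m' where m': "skorokhod T (G x0 (g 0 (u 0) (u 0 - x0))) (drift \<xi> m) m'" "\<And>t. 0 \<le> m' t" "\<And>t. m' t \<le> \<bar>drift \<xi> m t\<bar>"
    using skorokhod_exists[OF T_pos drift_int[OF assms] x0_in] by blast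
  have "m' t \<le> M t" for t using m'(3)[of t] drift_bound[of m t \<xi>] assms by (force simp: adm_def)
  then have "step \<xi> m (\<lambda>t. u 0 - x0 + integral {0..t} (\<lambda>s. m' s *\<^sub>R vel \<xi> s)) m'"
    using m' by (simp add: step_def)
  then show thesis by (rule that)
qed

lemma step_adm:
  assumes "adm \<xi> m" "step \<xi> m \<xi>' m'"
  shows "adm \<xi>' m'"
proof -
  have m': "m' absolutely_integrable_on {0..T}" using assms(2) by (simp add: step_def skorokhod_def)
  have "continuous_on {0..T} (\<lambda>t. u 0 - x0 + integral {0..t} (\<lambda>s. m' s *\<^sub>R vel \<xi> s))"
    using assms(1) by (intro continuous_intros indefinite_integral_continuous_1 integrable_on_scaleR_continuous m' compose_cont)
      (simp add: adm_def)
  then have "continuous_on {0..T} \<xi>'" by (rule continuous_on_eq) (use assms(2) in \<open>simp add: step_def\<close>)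
  then show ?thesis using m' assms(2) by (simp add: adm_def step_def)
qed

text \<open>The density estimate combines nonexpansiveness of reflection with
  \<open>drift_diff\<close>. The estimate for \<xi> is expressed in the new densities, so the first
  one can be fed into it and the old densities enter with factor \<delta> alone.\<close>

lemma step_diff:
  assumes adm: "adm \<xi>1 m1" "adm \<xi>2 m2" and step: "step \<xi>1 m1 \<xi>1' m1'" "step \<xi>2 m2 \<xi>2' m2'" and t: "t \<in> {0..T}"
  shows "integral {0..t} (\<lambda>s. \<bar>m1' s - m2' s\<bar>) \<le>
      \<delta> * integral {0..t} (\<lambda>s. \<bar>m1 s - m2 s\<bar>) + integral {0..t} (\<lambda>s. \<nu> s * norm (\<xi>1 s - \<xi>2 s))"
    and "norm (\<xi>1' t - \<xi>2' t) \<le>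
      (1 / c) * integral {0..t} (\<lambda>s. \<bar>m1' s - m2' s\<bar>) + integral {0..t} (\<lambda>s. \<nu> s * norm (\<xi>1 s - \<xi>2 s))"
proof -
  have m: "m1 absolutely_integrable_on {0..T}" "m2 absolutely_integrable_on {0..T}"
    and mb: "\<And>t. 0 \<le> m1 t \<and> m1 t \<le> M t" "\<And>t. 0 \<le> m2 t \<and> m2 t \<le> M t"
    and \<xi>: "continuous_on {0..T} \<xi>1" "continuous_on {0..T} \<xi>2"
    using adm by (auto simp: adm_def)
  have m': "m1' absolutely_integrable_on {0..T}" "m2' absolutely_integrable_on {0..T}"
    and mb': "\<And>t. 0 \<le> m1' t \<and> m1' t \<le> M t" "\<And>t. 0 \<le> m2' t \<and> m2' t \<le> M t"
    using step by (auto simp: step_def skorokhod_def)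
  have dd: "(\<lambda>s. drift \<xi>1 m1 s - drift \<xi>2 m2 s) absolutely_integrable_on {0..T}"
    by (intro set_integral_diff drift_int adm)
  have mm: "(\<lambda>s. m1 s - m2 s) absolutely_integrable_on {0..T}" by (intro set_integral_diff m)
  have mm': "(\<lambda>s. m1' s - m2' s) absolutely_integrable_on {0..T}" by (intro set_integral_diff m')
  have ni: "(\<lambda>s. \<nu> s * norm (\<xi>1 s - \<xi>2 s)) integrable_on {0..t}"
    by (intro weighted_int nu_int nu_nonneg continuous_on_diff \<xi> t)
  have "integral {0..t} (\<lambda>s. \<bar>m1' s - m2' s\<bar>) \<le> integral {0..t} (\<lambda>s. \<bar>drift \<xi>1 m1 s - drift \<xi>2 m2 s\<bar>)"
    using step by (intro skorokhod_contraction[OF drift_int[OF adm(1)] drift_int[OF adm(2)] _ _ t]) (auto simp: step_def)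
  also have "\<dots> \<le> integral {0..t} (\<lambda>s. \<delta> * \<bar>m1 s - m2 s\<bar> + \<nu> s * norm (\<xi>1 s - \<xi>2 s))"
  proof (rule integral_le)
    show "(\<lambda>s. \<bar>drift \<xi>1 m1 s - drift \<xi>2 m2 s\<bar>) integrable_on {0..t}" by (rule abs_int_sub(2)[OF dd t])
    show "(\<lambda>s. \<delta> * \<bar>m1 s - m2 s\<bar> + \<nu> s * norm (\<xi>1 s - \<xi>2 s)) integrable_on {0..t}"
      by (intro integrable_add integrable_on_mult_right abs_int_sub(2)[OF mm t] ni)
    fix s assume "s \<in> {0..t}"
    then have s: "s \<in> {0..T}" using t by auto
    have "\<bar>drift \<xi>1 m1 s - drift \<xi>2 m2 s\<bar> \<le> \<delta> * \<bar>m1 s - m2 s\<bar> + \<rho> s * norm (\<xi>1 s - \<xi>2 s)"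
      using mb by (intro drift_diff s) auto
    also have "\<rho> s * norm (\<xi>1 s - \<xi>2 s) \<le> \<nu> s * norm (\<xi>1 s - \<xi>2 s)"
      using M_nonneg[of s] CV_pos by (intro mult_right_mono) (auto simp: \<nu>_def)
    finally show "\<bar>drift \<xi>1 m1 s - drift \<xi>2 m2 s\<bar> \<le> \<delta> * \<bar>m1 s - m2 s\<bar> + \<nu> s * norm (\<xi>1 s - \<xi>2 s)" by simp
  qed
  also have "\<dots> = \<delta> * integral {0..t} (\<lambda>s. \<bar>m1 s - m2 s\<bar>) + integral {0..t} (\<lambda>s. \<nu> s * norm (\<xi>1 s - \<xi>2 s))"
    using Henstock_Kurzweil_Integration.integral_add[OF integrable_on_mult_right[OF abs_int_sub(2)[OF mm t]] ni] by simp
  finally show "integral {0..t} (\<lambda>s. \<bar>m1' s - m2' s\<bar>) \<le>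
      \<delta> * integral {0..t} (\<lambda>s. \<bar>m1 s - m2 s\<bar>) + integral {0..t} (\<lambda>s. \<nu> s * norm (\<xi>1 s - \<xi>2 s))" .
  have vi: "(\<lambda>s. m1' s *\<^sub>R vel \<xi>1 s) integrable_on {0..t}" "(\<lambda>s. m2' s *\<^sub>R vel \<xi>2 s) integrable_on {0..t}"
    using integrable_on_scaleR_continuous[OF m'(1) compose_cont(1)[OF \<xi>(1)]]
      integrable_on_scaleR_continuous[OF m'(2) compose_cont(1)[OF \<xi>(2)]] t
    by (auto intro: integrable_subinterval_real)
  have eq: "\<xi>1' t - \<xi>2' t = integral {0..t} (\<lambda>s. m1' s *\<^sub>R vel \<xi>1 s - m2' s *\<^sub>R vel \<xi>2 s)"
    using step t vi by (simp add: step_def Henstock_Kurzweil_Integration.integral_diff)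
  have "norm (\<xi>1' t - \<xi>2' t) \<le> integral {0..t} (\<lambda>s. (1 / c) * \<bar>m1' s - m2' s\<bar> + \<nu> s * norm (\<xi>1 s - \<xi>2 s))"
    unfolding eq
  proof (rule integral_norm_bound_integral)
    show "(\<lambda>s. (1 / c) * \<bar>m1' s - m2' s\<bar> + \<nu> s * norm (\<xi>1 s - \<xi>2 s)) integrable_on {0..t}"
      by (intro integrable_add integrable_on_mult_right abs_int_sub(2)[OF mm' t] ni)
    show "(\<lambda>s. m1' s *\<^sub>R vel \<xi>1 s - m2' s *\<^sub>R vel \<xi>2 s) integrable_on {0..t}"
      by (intro integrable_diff vi)
    fix s assume "s \<in> {0..t}"
    then have s: "s \<in> {0..T}" using t by auto
    have "m1' s *\<^sub>R vel \<xi>1 s - m2' s *\<^sub>R vel \<xi>2 s = (m1' s - m2' s) *\<^sub>R vel \<xi>1 s + m2' s *\<^sub>R (vel \<xi>1 s - vel \<xi>2 s)"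
      by (simp add: scaleR_diff_left scaleR_diff_right)
    then have "norm (m1' s *\<^sub>R vel \<xi>1 s - m2' s *\<^sub>R vel \<xi>2 s) \<le> \<bar>m1' s - m2' s\<bar> * norm (vel \<xi>1 s) + m2' s * norm (vel \<xi>1 s - vel \<xi>2 s)"
      using norm_triangle_ineq[of "(m1' s - m2' s) *\<^sub>R vel \<xi>1 s" "m2' s *\<^sub>R (vel \<xi>1 s - vel \<xi>2 s)"] mb'(2)[of s] by simp
    also have "\<dots> \<le> \<bar>m1' s - m2' s\<bar> * (1 / c) + M s * (CV * norm (\<xi>1 s - \<xi>2 s))"
      using mb'(2)[of s] M_nonneg[of s] vel_bound[of \<xi>1 s] vel_diff[OF s, of \<xi>1 \<xi>2]
      by (intro add_mono mult_mono mult_left_mono) auto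
    also have "M s * (CV * norm (\<xi>1 s - \<xi>2 s)) \<le> \<nu> s * norm (\<xi>1 s - \<xi>2 s)"
      unfolding mult.assoc[symmetric] using rho_nonneg[of s] by (intro mult_right_mono) (auto simp: \<nu>_def)
    finally show "norm (m1' s *\<^sub>R vel \<xi>1 s - m2' s *\<^sub>R vel \<xi>2 s) \<le> (1 / c) * \<bar>m1' s - m2' s\<bar> + \<nu> s * norm (\<xi>1 s - \<xi>2 s)"
      by (simp add: mult.commute)
  qed
  also have "\<dots> = (1 / c) * integral {0..t} (\<lambda>s. \<bar>m1' s - m2' s\<bar>) + integral {0..t} (\<lambda>s. \<nu> s * norm (\<xi>1 s - \<xi>2 s))"
    using Henstock_Kurzweil_Integration.integral_add[OF integrable_on_mult_right[OF abs_int_sub(2)[OF mm' t], of "1 / c"] ni]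
    by (simp only: integral_mult_right)
  finally show "norm (\<xi>1' t - \<xi>2' t) \<le>
      (1 / c) * integral {0..t} (\<lambda>s. \<bar>m1' s - m2' s\<bar>) + integral {0..t} (\<lambda>s. \<nu> s * norm (\<xi>1 s - \<xi>2 s))" .
qed

lemma wt_ge_1: assumes "t \<in> {0..T}" shows "1 \<le> wt t"
proof -
  have "0 \<le> integral {0..t} \<nu>"
    using nu_int assms nu_nonneg
    by (intro Henstock_Kurzweil_Integration.integral_nonneg) (auto intro: integrable_subinterval_real)
  then show ?thesis using delta(5) by (simp add: wt_def)
qed

text \<open>The exponential weight makes the Volterra terms of the step estimate small, so that only the
  factor \<open>\<delta> < 1\<close> of the state dependence remains.\<close>
lemma close_step:
  assumes adm: "adm \<xi>1 m1" "adm \<xi>2 m2" and step: "step \<xi>1 m1 \<xi>1' m1'" "step \<xi>2 m2 \<xi>2' m2'"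
    and "A \<ge> 0" and cl: "close A \<xi>1 m1 \<xi>2 m2"
  shows "close (\<theta> * A) \<xi>1' m1' \<xi>2' m2'"
  unfolding close_def
proof
  fix t assume t: "t \<in> {0..T}"
  have \<xi>: "continuous_on {0..T} \<xi>1" "continuous_on {0..T} \<xi>2" using adm by (auto simp: adm_def)
  have w1: "1 \<le> wt t" by (rule wt_ge_1[OF t])
  have int: "((\<lambda>s. \<nu> s * wt s) has_integral (wt t - 1) / N) {0..t}"
    unfolding wt_def by (rule primitive_exp_has_integral[OF nu_int nu_nonneg delta(5) t])
  have "integral {0..t} (\<lambda>s. \<nu> s * norm (\<xi>1 s - \<xi>2 s)) \<le> integral {0..t} (\<lambda>s. 2 * A / c * (\<nu> s * wt s))"
  proof (rule integral_le)
    show "(\<lambda>s. \<nu> s * norm (\<xi>1 s - \<xi>2 s)) integrable_on {0..t}"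
      by (intro weighted_int nu_int nu_nonneg continuous_on_diff \<xi> t)
    show "(\<lambda>s. 2 * A / c * (\<nu> s * wt s)) integrable_on {0..t}" using int by (intro integrable_on_mult_right) blast
    fix s assume "s \<in> {0..t}"
    then have "norm (\<xi>1 s - \<xi>2 s) \<le> 2 * A / c * wt s" using cl t by (auto simp: close_def)
    then have "\<nu> s * norm (\<xi>1 s - \<xi>2 s) \<le> \<nu> s * (2 * A / c * wt s)" by (intro mult_left_mono nu_nonneg)
    then show "\<nu> s * norm (\<xi>1 s - \<xi>2 s) \<le> 2 * A / c * (\<nu> s * wt s)" by (simp add: mult_ac)
  qed
  also have "\<dots> = 2 * A / c * ((wt t - 1) / N)" using int by (simp add: integral_unique)
  also have "\<dots> \<le> 2 * A / c * (wt t / N)"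
    using \<open>A \<ge> 0\<close> pos_consts delta(5) by (intro mult_left_mono divide_right_mono) auto
  finally have V: "integral {0..t} (\<lambda>s. \<nu> s * norm (\<xi>1 s - \<xi>2 s)) \<le> 2 * A / c * (wt t / N)" .
  have d1: "1 - \<delta> > 0" using delta by simp
  have invN1: "2 / (c * N) \<le> (1 - \<delta>) / 2"
  proof -
    have "4 / (c * (1 - \<delta>)) \<le> N" using delta by (simp add: N_def)
    then have "4 \<le> N * (c * (1 - \<delta>))" using pos_consts d1 by (simp add: pos_divide_le_eq)
    then show ?thesis using pos_consts delta(5) by (simp add: field_simps)
  qed
  have invN2: "1 / N \<le> \<theta> / 2"
  proof -
    have "2 / \<theta> \<le> N" using delta pos_consts d1 by (simp add: N_def)
    then have "2 \<le> N * \<theta>" using delta by (simp add: pos_divide_le_eq)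
    then show ?thesis using delta by (simp add: field_simps)
  qed
  have Aw: "0 \<le> A * wt t" using \<open>A \<ge> 0\<close> w1 by simp
  have V1: "2 * A / c * (wt t / N) \<le> (1 - \<delta>) / 2 * (A * wt t)"
    using mult_right_mono[OF invN1 Aw] by (simp add: mult_ac)
  have V2: "2 * A / c * (wt t / N) \<le> \<theta> / 2 * (2 * A / c * wt t)"
  proof -
    have "1 / N * (2 * A / c * wt t) \<le> \<theta> / 2 * (2 * A / c * wt t)"
      using invN2 \<open>A \<ge> 0\<close> w1 pos_consts by (intro mult_right_mono) auto
    then show ?thesis by (simp add: mult.commute)
  qed
  have E: "integral {0..t} (\<lambda>s. \<bar>m1' s - m2' s\<bar>) \<le> \<theta> * A * wt t"
  proof -
    have "integral {0..t} (\<lambda>s. \<bar>m1' s - m2' s\<bar>) \<le> \<delta> * integral {0..t} (\<lambda>s. \<bar>m1 s - m2 s\<bar>) + 2 * A / c * (wt t / N)"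
      using step_diff(1)[OF adm step t] V by linarith
    also have "\<delta> * integral {0..t} (\<lambda>s. \<bar>m1 s - m2 s\<bar>) \<le> \<delta> * (A * wt t)"
      using cl t delta by (intro mult_left_mono) (auto simp: close_def)
    also have "\<delta> * (A * wt t) + 2 * A / c * (wt t / N) \<le> \<delta> * (A * wt t) + (1 - \<delta>) / 2 * (A * wt t)" using V1 by simp
    also have "\<dots> = \<theta> * A * wt t" by (simp add: \<theta>_def field_simps)
    finally show ?thesis by simp
  qed
  have "norm (\<xi>1' t - \<xi>2' t) \<le> (1 / c) * (\<theta> * A * wt t) + \<theta> / 2 * (2 * A / c * wt t)"
  proof -
    have "norm (\<xi>1' t - \<xi>2' t) \<le> (1 / c) * integral {0..t} (\<lambda>s. \<bar>m1' s - m2' s\<bar>) + 2 * A / c * (wt t / N)"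
      using step_diff(2)[OF adm step t] V by linarith
    moreover have "(1 / c) * integral {0..t} (\<lambda>s. \<bar>m1' s - m2' s\<bar>) \<le> (1 / c) * (\<theta> * A * wt t)"
      using E pos_consts by (intro mult_left_mono) auto
    ultimately show ?thesis using V2 by linarith
  qed
  also have "\<dots> = 2 * (\<theta> * A) / c * wt t" using pos_consts by (simp add: field_simps)
  finally show "integral {0..t} (\<lambda>s. \<bar>m1' s - m2' s\<bar>) \<le> \<theta> * A * wt t \<and> norm (\<xi>1' t - \<xi>2' t) \<le> 2 * (\<theta> * A) / c * wt t"
    using E by simp
qed

lemma close_triangle:
  assumes adm: "adm \<xi>1 m1" "adm \<xi>2 m2" "adm \<xi>3 m3" and cl: "close A \<xi>1 m1 \<xi>2 m2" "close B \<xi>2 m2 \<xi>3 m3"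
  shows "close (A + B) \<xi>1 m1 \<xi>3 m3"
  unfolding close_def
proof
  fix t assume t: "t \<in> {0..T}"
  have i: "(\<lambda>s. \<bar>m1 s - m2 s\<bar>) integrable_on {0..t}" "(\<lambda>s. \<bar>m2 s - m3 s\<bar>) integrable_on {0..t}" "(\<lambda>s. \<bar>m1 s - m3 s\<bar>) integrable_on {0..t}"
    using adm by (auto simp: adm_def intro!: abs_int_sub(2)[OF _ t] set_integral_diff)
  have "integral {0..t} (\<lambda>s. \<bar>m1 s - m3 s\<bar>) \<le> integral {0..t} (\<lambda>s. \<bar>m1 s - m2 s\<bar> + \<bar>m2 s - m3 s\<bar>)"
    using i by (intro integral_le integrable_add) auto
  also have "\<dots> = integral {0..t} (\<lambda>s. \<bar>m1 s - m2 s\<bar>) + integral {0..t} (\<lambda>s. \<bar>m2 s - m3 s\<bar>)"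
    using i by (intro Henstock_Kurzweil_Integration.integral_add)
  also have "\<dots> \<le> A * wt t + B * wt t" using cl t by (intro add_mono) (auto simp: close_def)
  finally have 1: "integral {0..t} (\<lambda>s. \<bar>m1 s - m3 s\<bar>) \<le> A * wt t + B * wt t" .
  have "norm (\<xi>1 t - \<xi>3 t) \<le> norm (\<xi>1 t - \<xi>2 t) + norm (\<xi>2 t - \<xi>3 t)"
    using norm_triangle_ineq[of "\<xi>1 t - \<xi>2 t" "\<xi>2 t - \<xi>3 t"] by simp
  also have "\<dots> \<le> 2 * A / c * wt t + 2 * B / c * wt t" using cl t by (intro add_mono) (auto simp: close_def)
  also have "\<dots> = 2 * (A + B) / c * wt t" by (simp add: algebra_simps add_divide_distrib)
  finally show "integral {0..t} (\<lambda>s. \<bar>m1 s - m3 s\<bar>) \<le> (A + B) * wt t \<and> norm (\<xi>1 t - \<xi>3 t) \<le> 2 * (A + B) / c * wt t"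
    using 1 by (simp add: distrib_right)
qed

lemma close_mono:
  assumes "close A \<xi>1 m1 \<xi>2 m2" "A \<le> B" shows "close B \<xi>1 m1 \<xi>2 m2"
  unfolding close_def
proof
  fix t assume t: "t \<in> {0..T}"
  have w: "0 \<le> wt t" using wt_ge_1[OF t] by simp
  have "A * wt t \<le> B * wt t" "2 * A / c * wt t \<le> 2 * B / c * wt t"
    using assms(2) w pos_consts by (auto intro!: mult_right_mono divide_right_mono)
  then show "integral {0..t} (\<lambda>s. \<bar>m1 s - m2 s\<bar>) \<le> B * wt t \<and> norm (\<xi>1 t - \<xi>2 t) \<le> 2 * B / c * wt t"
    using assms(1) t unfolding close_def by force
qed

lemma close_sym: "close A \<xi>1 m1 \<xi>2 m2 \<Longrightarrow> close A \<xi>2 m2 \<xi>1 m1"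
  by (simp add: close_def norm_minus_commute abs_minus_commute)

lemma close_exists:
  assumes adm: "adm \<xi>1 m1" "adm \<xi>2 m2"
  obtains A where "A \<ge> 0" "close A \<xi>1 m1 \<xi>2 m2"
proof -
  have "continuous_on {0..T} (\<lambda>t. \<xi>1 t - \<xi>2 t)" using adm by (auto simp: adm_def intro: continuous_on_diff)
  then have "bounded ((\<lambda>t. \<xi>1 t - \<xi>2 t) ` {0..T})" by (intro compact_imp_bounded compact_continuous_image) auto
  then obtain B where B: "B > 0" "\<And>t. t \<in> {0..T} \<Longrightarrow> norm (\<xi>1 t - \<xi>2 t) \<le> B"
    unfolding bounded_pos by auto
  define I where "I = integral {0..T} (\<lambda>s. \<bar>m1 s - m2 s\<bar>)"
  define A where "A = max I (B * c / 2)"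
  have A0: "A \<ge> 0" using B pos_consts by (auto simp: A_def intro!: max.coboundedI2)
  have mm: "(\<lambda>s. m1 s - m2 s) absolutely_integrable_on {0..T}" using adm by (auto simp: adm_def intro!: set_integral_diff)
  have "close A \<xi>1 m1 \<xi>2 m2"
    unfolding close_def
  proof
    fix t assume t: "t \<in> {0..T}"
    have "integral {0..t} (\<lambda>s. \<bar>m1 s - m2 s\<bar>) \<le> I"
      unfolding I_def using t T_pos abs_int_sub(2)[OF mm t] abs_int_sub(2)[OF mm, of T]
      by (intro integral_subset_le) auto
    then have 1: "integral {0..t} (\<lambda>s. \<bar>m1 s - m2 s\<bar>) \<le> A" by (simp add: A_def)
    have "B \<le> 2 * A / c" using pos_consts by (simp add: A_def field_simps max.coboundedI2)
    then have 2: "norm (\<xi>1 t - \<xi>2 t) \<le> 2 * A / c" using B(2)[OF t] by linarith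
    have "A * 1 \<le> A * wt t" "2 * A / c * 1 \<le> 2 * A / c * wt t"
      using A0 pos_consts wt_ge_1[OF t] by (intro mult_left_mono; simp)+
    then show "integral {0..t} (\<lambda>s. \<bar>m1 s - m2 s\<bar>) \<le> A * wt t \<and> norm (\<xi>1 t - \<xi>2 t) \<le> 2 * A / c * wt t"
      using 1 2 by linarith
  qed
  then show thesis using that A0 by blast
qed

text \<open>\<open>close_step\<close> applied repeatedly to the same two pairs forces their distance
  below every \<open>\<theta> ^ n * A\<close>. Only the \<xi> components can be equated pointwise,
  since the densities are seen through integrals.\<close>

lemma fixed_point_unique:
  assumes adm: "adm \<xi>1 m1" "adm \<xi>2 m2" and step: "step \<xi>1 m1 \<xi>1 m1" "step \<xi>2 m2 \<xi>2 m2" and t: "t \<in> {0..T}"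
  shows "\<xi>1 t = \<xi>2 t"
proof -
  obtain A where A: "A \<ge> 0" "close A \<xi>1 m1 \<xi>2 m2" using close_exists[OF adm] .
  have cl: "close (\<theta> ^ n * A) \<xi>1 m1 \<xi>2 m2" for n
  proof (induction n)
    case (Suc n)
    show ?case using close_step[OF adm step _ Suc] A(1) delta by (simp add: mult.assoc)
  qed (use A in simp)
  have "norm (\<xi>1 t - \<xi>2 t) \<le> \<theta> ^ n * (2 * A / c * wt t)" for n
    using cl[of n] t by (simp add: close_def mult_ac)
  moreover have "(\<lambda>n. \<theta> ^ n * (2 * A / c * wt t)) \<longlonglongrightarrow> 0"
    using delta by (intro tendsto_mult_left_zero LIMSEQ_power_zero) simp
  ultimately have "norm (\<xi>1 t - \<xi>2 t) \<le> 0" by (intro LIMSEQ_le_const) auto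
  then show ?thesis by simp
qed

end

section \<open>Fixed points of the reflection step\<close>

context sweeping_process begin

lemma wt_mono: assumes "t \<in> {0..T}" shows "wt t \<le> wt T"
proof -
  have "integral {0..t} \<nu> \<le> integral {0..T} \<nu>"
    using nu_int assms nu_nonneg by (intro integral_subset_le) (auto intro: integrable_subinterval_real)
  then show ?thesis using delta(5) by (simp add: wt_def)
qed

lemma adm_zero: "adm (\<lambda>_. u 0 - x0) (\<lambda>_. 0)"
  using M_nonneg by (simp add: adm_def)

lemma close_refl: "close 0 \<xi> m \<xi> m"
  by (simp add: close_def)

text \<open>Picard iteration. The curves converge uniformly and the densities in L1; a subsequence
  converging almost everywhere keeps the bound by M. One more step from the limit lands at distance
  0 from it, which identifies curves pointwise but densities only almost everywhere, so the second
  component has to be exchanged at the end.\<close>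

lemma fixed_point_exists:
  obtains \<xi> m where "adm \<xi> m" "step \<xi> m \<xi> m"
proof -
  have "\<exists>P. \<forall>n. adm (fst (P n)) (snd (P n)) \<and> step (fst (P n)) (snd (P n)) (fst (P (Suc n))) (snd (P (Suc n)))"
  proof (rule dependent_nat_choice)
    show "\<exists>p. adm (fst p) (snd p)" using adm_zero by (intro exI[of _ "(\<lambda>_. u 0 - x0, \<lambda>_. 0)"]) simp
    fix p n assume ap: "adm (fst p) (snd p)"
    obtain \<xi>' m' where "step (fst p) (snd p) \<xi>' m'" using step_exists[OF ap] .
    then show "\<exists>q. adm (fst q) (snd q) \<and> step (fst p) (snd p) (fst q) (snd q)"
      using step_adm[OF ap] by (intro exI[of _ "(\<xi>', m')"]) simp
  qed
  then obtain P where P: "\<And>n. adm (fst (P n)) (snd (P n))"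
    "\<And>n. step (fst (P n)) (snd (P n)) (fst (P (Suc n))) (snd (P (Suc n)))" by blast
  define X where "X n = fst (P n)" for n
  define m where "m n = snd (P n)" for n
  have adm: "adm (X n) (m n)" and step: "step (X n) (m n) (X (Suc n)) (m (Suc n))" for n
    using P by (auto simp: X_def m_def)
  obtain A where A: "A \<ge> 0" "close A (X 0) (m 0) (X 1) (m 1)" using close_exists[OF adm adm] .
  have cl: "close (\<theta> ^ n * A) (X n) (m n) (X (Suc n)) (m (Suc n))" for n
  proof (induction n)
    case (Suc n)
    show ?case using close_step[OF adm adm step step _ Suc] A(1) delta by (simp add: mult.assoc)
  qed (use A in simp)
  \<comment> \<open>Tail of the geometric series of the successive distances; the exact partial sum
    from n to k is \<open>D n - D k\<close>, which makes the induction telescope.\<close>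
  define D where "D n = \<theta> ^ n * A / (1 - \<theta>)" for n
  have D0: "D n \<ge> 0" for n using A delta by (simp add: D_def)
  have Dlim: "D \<longlonglongrightarrow> 0"
    unfolding D_def using delta by (intro tendsto_divide_zero tendsto_mult_left_zero LIMSEQ_power_zero) simp
  have cl': "close (D n - D k) (X n) (m n) (X k) (m k)" if "n \<le> k" for n k
    using that
  proof (induction k rule: dec_induct)
    case base
    show ?case using close_refl by simp
  next
    case (step k)
    have "close ((D n - D k) + \<theta> ^ k * A) (X n) (m n) (X (Suc k)) (m (Suc k))"
      by (rule close_triangle[OF adm adm adm step.IH cl])
    moreover have "\<theta> ^ k * A = (1 - \<theta>) * D k" "D (Suc k) = \<theta> * D k" using delta by (auto simp: D_def)
    then have "(D n - D k) + \<theta> ^ k * A = D n - D (Suc k)" by (simp add: algebra_simps)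
    ultimately show ?case by simp
  qed
  have clD: "close (D n) (X n) (m n) (X k) (m k)" if "n \<le> k" for n k
    by (rule close_mono[OF cl'[OF that]]) (use D0[of k] in simp)
  define B where "B n = 2 * D n / c * wt T" for n
  have Blim: "B \<longlonglongrightarrow> 0"
  proof -
    have "(\<lambda>n. 2 * D n / c * wt T) \<longlonglongrightarrow> 2 * 0 / c * wt T" using pos_consts by (intro tendsto_intros Dlim) auto
    then show ?thesis by (simp add: B_def[abs_def])
  qed
  have XB: "norm (X n t - X k t) \<le> B n" if "n \<le> k" "t \<in> {0..T}" for n k t
  proof -
    have "norm (X n t - X k t) \<le> 2 * D n / c * wt t" using clD[OF that(1)] that(2) by (simp add: close_def)
    also have "\<dots> \<le> B n" unfolding B_def using D0[of n] pos_consts by (intro mult_left_mono wt_mono that) auto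
    finally show ?thesis .
  qed
  have "uniformly_Cauchy_on {0..T} X"
    unfolding uniformly_Cauchy_on_def
  proof (intro allI impI)
    fix e :: real assume "e > 0"
    then obtain n where n: "B n < e / 2" using order_tendstoD(2)[OF Blim, of "e/2"] by (auto simp: eventually_sequentially)
    have "dist (X k t) (X l t) < e" if "t \<in> {0..T}" "k \<ge> n" "l \<ge> n" for t k l
    proof -
      have "dist (X k t) (X l t) \<le> dist (X n t) (X k t) + dist (X n t) (X l t)" by (rule dist_triangle3)
      also have "\<dots> \<le> B n + B n" using XB[of n k t] XB[of n l t] that by (simp add: dist_norm)
      finally show ?thesis using n by simp
    qed
    then show "\<exists>M. \<forall>x\<in>{0..T}. \<forall>k\<ge>M. \<forall>n\<ge>M. dist (X k x) (X n x) < e" by blast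
  qed
  then obtain \<xi> where ulim: "uniform_limit {0..T} X \<xi> sequentially"
    using Cauchy_uniformly_convergent by (auto simp: uniformly_convergent_on_def)
  have Xlim: "(\<lambda>n. X n t) \<longlonglongrightarrow> \<xi> t" if "t \<in> {0..T}" for t using tendsto_uniform_limitI[OF ulim that] .
  have \<xi>c: "continuous_on {0..T} \<xi>"
    by (rule uniform_limit_theorem[OF _ ulim]) (use adm in \<open>auto simp: adm_def\<close>)
  have X\<xi>: "norm (X n t - \<xi> t) \<le> 2 * D n / c * wt t" if t: "t \<in> {0..T}" for n t
  proof (rule LIMSEQ_le_const2)
    show "(\<lambda>k. norm (X n t - X k t)) \<longlonglongrightarrow> norm (X n t - \<xi> t)" by (intro tendsto_intros Xlim t)
    show "\<exists>N. \<forall>k\<ge>N. norm (X n t - X k t) \<le> 2 * D n / c * wt t" using clD t unfolding close_def by blast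
  qed
  have m_int: "m n absolutely_integrable_on {0..T}" and m_b: "0 \<le> m n t" "m n t \<le> M t" for n t
    using adm by (auto simp: adm_def)
  have mdiff: "(\<lambda>t. m n t - m k t) absolutely_integrable_on {0..T}" for n k by (intro set_integral_diff m_int)
  have L1: "integrable (lebesgue_on {0..T}) (m n)" for n
    using m_int[of n] by (simp add: integrable_restrict_space set_integrable_def)
  have int_eq: "(LINT x|lebesgue_on {0..T}. norm (m i x - m j x)) = integral {0..T} (\<lambda>t. \<bar>m i t - m j t\<bar>)" for i j
  proof -
    have "integrable (lebesgue_on {0..T}) (\<lambda>t. norm (m i t - m j t))"
      by (intro integrable_norm Bochner_Integration.integrable_diff L1)
    then show ?thesis by (subst lebesgue_integral_eq_integral) auto
  qed
  have L1C: "\<exists>n. \<forall>i\<ge>n. \<forall>j\<ge>n. (LINT x|lebesgue_on {0..T}. norm (m i x - m j x)) < e" if e: "e > 0" for e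
  proof -
    have "(\<lambda>n. 2 * D n * wt T) \<longlonglongrightarrow> 2 * 0 * wt T" by (intro tendsto_intros Dlim)
    then have "\<forall>\<^sub>F n in sequentially. 2 * D n * wt T < e" by (rule order_tendstoD(2)) (use e in simp)
    then obtain n where n: "2 * D n * wt T < e" by (auto simp: eventually_sequentially)
    have "integral {0..T} (\<lambda>t. \<bar>m i t - m j t\<bar>) < e" if "i \<ge> n" "j \<ge> n" for i j
    proof -
      have "close (D n + D n) (X i) (m i) (X j) (m j)"
        by (rule close_triangle[OF adm adm adm close_sym[OF clD[OF that(1)]] clD[OF that(2)]])
      then have "integral {0..T} (\<lambda>t. \<bar>m i t - m j t\<bar>) \<le> (D n + D n) * wt T" using T_pos by (simp add: close_def)
      then show ?thesis using n by simp
    qed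
    then show ?thesis unfolding int_eq by blast
  qed
  obtain r where r: "strict_mono r" "AE x in lebesgue_on {0..T}. Cauchy (\<lambda>i. m (r i) x)"
    by (rule cauchy_L1_AE_cauchy_subseq[OF L1 L1C])
  define NC where "NC = {t \<in> {0..T}. \<not> Cauchy (\<lambda>i. m (r i) t)}"
  have "AE t in lebesgue. t \<in> {0..T} \<longrightarrow> Cauchy (\<lambda>i. m (r i) t)"
    using r(2) by (subst (asm) AE_restrict_space_iff) auto
  then have NC: "negligible NC" unfolding AE_lebesgue_iff_negligible by (rule negligible_subset) (auto simp: NC_def)
  \<comment> \<open>The value 0 where the subsequence diverges keeps \<mu> between 0 and M at every
    time, as \<open>adm\<close> demands.\<close>
  define \<mu> where "\<mu> t = (if Cauchy (\<lambda>i. m (r i) t) then lim (\<lambda>i. m (r i) t) else 0)" for t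
  have mlim: "(\<lambda>i. m (r i) t) \<longlonglongrightarrow> \<mu> t" if "t \<in> {0..T} - NC" for t
    using that by (auto simp: NC_def \<mu>_def convergent_LIMSEQ_iff[symmetric] Cauchy_convergent_iff)
  have mu_b: "0 \<le> \<mu> t \<and> \<mu> t \<le> M t" for t
  proof (cases "Cauchy (\<lambda>i. m (r i) t)")
    case True
    then have l: "(\<lambda>i. m (r i) t) \<longlonglongrightarrow> \<mu> t" by (simp add: \<mu>_def convergent_LIMSEQ_iff[symmetric] Cauchy_convergent_iff)
    show ?thesis using LIMSEQ_le_const[OF l, of 0] LIMSEQ_le_const2[OF l, of "M t"] m_b by auto
  qed (use M_nonneg in \<open>simp add: \<mu>_def\<close>)
  have mu_int: "\<mu> absolutely_integrable_on {0..T}"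
  proof -
    have "(\<lambda>t. if t \<in> NC then 0 else \<mu> t) absolutely_integrable_on {0..T}"
    proof (rule dominated_convergence_absolutely_integrable[OF _ M_int])
      show "(\<lambda>t. if t \<in> NC then 0 else m (r k) t) absolutely_integrable_on {0..T}" for k
        by (rule absolutely_integrable_spike[OF m_int NC]) auto
      show "norm (if t \<in> NC then 0 else \<mu> t) \<le> M t" for t using mu_b[of t] by auto
      show "(\<lambda>k. if t \<in> NC then 0 else m (r k) t) \<longlonglongrightarrow> (if t \<in> NC then 0 else \<mu> t)" if "t \<in> {0..T}" for t
        using mlim[of t] that by auto
    qed
    then show ?thesis by (rule absolutely_integrable_spike[OF _ NC]) auto
  qed
  have adm_lim: "adm \<xi> \<mu>" using \<xi>c mu_int mu_b by (simp add: adm_def)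
  have cl_lim: "close (D n) (X n) (m n) \<xi> \<mu>" for n
    unfolding close_def
  proof
    fix t assume t: "t \<in> {0..T}"
    have Mt: "M integrable_on {0..t}" using M_int t by (auto intro: integrable_subinterval_real)
    have sub: "(\<lambda>s. \<bar>m n s - h s\<bar>) integrable_on {0..t}" if "h absolutely_integrable_on {0..T}" for h
      by (intro abs_int_sub(2)[OF _ t] set_integral_diff m_int that)
    have "(\<lambda>k. integral {0..t} (\<lambda>s. if s \<in> NC then 0 else \<bar>m n s - m (r k) s\<bar>)) \<longlonglongrightarrow>
        integral {0..t} (\<lambda>s. if s \<in> NC then 0 else \<bar>m n s - \<mu> s\<bar>)"
    proof (rule dominated_convergence(2)[OF _ Mt])
      show "(\<lambda>s. if s \<in> NC then 0 else \<bar>m n s - m (r k) s\<bar>) integrable_on {0..t}" for k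
        by (rule integrable_spike[OF sub[OF m_int] NC]) auto
      show "norm (if s \<in> NC then 0 else \<bar>m n s - m (r k) s\<bar>) \<le> M s" for k s
        using m_b[of n s] m_b[of "r k" s] by auto
      show "(\<lambda>k. if s \<in> NC then 0 else \<bar>m n s - m (r k) s\<bar>) \<longlonglongrightarrow> (if s \<in> NC then 0 else \<bar>m n s - \<mu> s\<bar>)" if "s \<in> {0..t}" for s
      proof (cases "s \<in> NC")
        case False
        then have "(\<lambda>k. m (r k) s) \<longlonglongrightarrow> \<mu> s" using that t by (intro mlim) auto
        then have "(\<lambda>k. \<bar>m n s - m (r k) s\<bar>) \<longlonglongrightarrow> \<bar>m n s - \<mu> s\<bar>" by (intro tendsto_intros)
        then show ?thesis using False by simp
      qed simp
    qed
    moreover have "integral {0..t} (\<lambda>s. if s \<in> NC then 0 else \<bar>m n s - h s\<bar>) = integral {0..t} (\<lambda>s. \<bar>m n s - h s\<bar>)" for h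
      by (rule integral_spike[OF NC]) auto
    ultimately have lim: "(\<lambda>k. integral {0..t} (\<lambda>s. \<bar>m n s - m (r k) s\<bar>)) \<longlonglongrightarrow> integral {0..t} (\<lambda>s. \<bar>m n s - \<mu> s\<bar>)" by simp
    have "\<exists>N. \<forall>k\<ge>N. integral {0..t} (\<lambda>s. \<bar>m n s - m (r k) s\<bar>) \<le> D n * wt t"
    proof (intro exI[of _ n] allI impI)
      fix k assume "n \<le> k"
      then have "n \<le> r k" using seq_suble[OF r(1), of k] by simp
      then show "integral {0..t} (\<lambda>s. \<bar>m n s - m (r k) s\<bar>) \<le> D n * wt t" using clD t by (auto simp: close_def)
    qed
    then have "integral {0..t} (\<lambda>s. \<bar>m n s - \<mu> s\<bar>) \<le> D n * wt t" by (rule LIMSEQ_le_const2[OF lim])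
    then show "integral {0..t} (\<lambda>s. \<bar>m n s - \<mu> s\<bar>) \<le> D n * wt t \<and> norm (X n t - \<xi> t) \<le> 2 * D n / c * wt t"
      using X\<xi>[OF t] by simp
  qed
  obtain \<xi>' \<mu>' where st: "step \<xi> \<mu> \<xi>' \<mu>'" using step_exists[OF adm_lim] .
  have adm': "adm \<xi>' \<mu>'" by (rule step_adm[OF adm_lim st])
  have clp: "close (D (Suc n) + \<theta> * D n) \<xi> \<mu> \<xi>' \<mu>'" for n
    by (rule close_triangle[OF adm_lim adm adm' close_sym[OF cl_lim] close_step[OF adm adm_lim step st D0 cl_lim]])
  have zero: "integral {0..t} (\<lambda>s. \<bar>\<mu> s - \<mu>' s\<bar>) \<le> 0" "norm (\<xi> t - \<xi>' t) \<le> 0" if t: "t \<in> {0..T}" for t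
  proof -
    have "(\<lambda>n. D (Suc n) + \<theta> * D n) \<longlonglongrightarrow> 0 + \<theta> * 0" by (intro tendsto_intros Dlim LIMSEQ_Suc)
    then have l: "(\<lambda>n. D (Suc n) + \<theta> * D n) \<longlonglongrightarrow> 0" by simp
    have l1: "(\<lambda>n. (D (Suc n) + \<theta> * D n) * wt t) \<longlonglongrightarrow> 0" by (rule tendsto_mult_left_zero[OF l])
    show "integral {0..t} (\<lambda>s. \<bar>\<mu> s - \<mu>' s\<bar>) \<le> 0"
      by (rule LIMSEQ_le_const[OF l1]) (use clp t in \<open>auto simp: close_def\<close>)
    have l2: "(\<lambda>n. (D (Suc n) + \<theta> * D n) * (2 / c * wt t)) \<longlonglongrightarrow> 0" by (rule tendsto_mult_left_zero[OF l])
    have "norm (\<xi> t - \<xi>' t) \<le> (D (Suc n) + \<theta> * D n) * (2 / c * wt t)" for n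
    proof -
      have "norm (\<xi> t - \<xi>' t) \<le> 2 * (D (Suc n) + \<theta> * D n) / c * wt t" using clp[of n] t unfolding close_def by blast
      also have "\<dots> = (D (Suc n) + \<theta> * D n) * (2 / c * wt t)" by simp
      finally show ?thesis .
    qed
    then show "norm (\<xi> t - \<xi>' t) \<le> 0" by (intro LIMSEQ_le_const[OF l2]) auto
  qed
  have adm'': "adm \<xi> \<mu>'" using adm_lim adm' by (simp add: adm_def)
  \<comment> \<open>The pointwise complementarity holds for \<open>\<mu>'\<close>, but relative to
    the drift of \<mu>. As \<open>skorokhod\<close> sees the drift through its primitive only,
    equality of the primitives turns \<xi> with \<open>\<mu>'\<close> into a genuine fixed
    point.\<close>
  have drift_eq: "integral {0..t} (drift \<xi> \<mu>') = integral {0..t} (drift \<xi> \<mu>)" if t: "t \<in> {0..T}" for t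
  proof -
    have i: "drift \<xi> \<mu> integrable_on {0..t}" "drift \<xi> \<mu>' integrable_on {0..t}"
      using abs_int_sub(1)[OF drift_int[OF adm_lim] t] abs_int_sub(1)[OF drift_int[OF adm''] t] by auto
    have mi: "(\<lambda>s. \<bar>\<mu> s - \<mu>' s\<bar>) integrable_on {0..t}"
      using adm'' mu_int by (intro abs_int_sub(2)[OF _ t] set_integral_diff) (auto simp: adm_def)
    have "norm (integral {0..t} (\<lambda>s. drift \<xi> \<mu> s - drift \<xi> \<mu>' s)) \<le> integral {0..t} (\<lambda>s. \<delta> * \<bar>\<mu> s - \<mu>' s\<bar>)"
    proof (rule integral_norm_bound_integral)
      fix s assume "s \<in> {0..t}"
      then have "\<bar>drift \<xi> \<mu> s - drift \<xi> \<mu>' s\<bar> \<le> \<delta> * \<bar>\<mu> s - \<mu>' s\<bar> + \<rho> s * norm (\<xi> s - \<xi> s)"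
        using t mu_b adm'' by (intro drift_diff) (auto simp: adm_def)
      then show "norm (drift \<xi> \<mu> s - drift \<xi> \<mu>' s) \<le> \<delta> * \<bar>\<mu> s - \<mu>' s\<bar>" by simp
    qed (use i mi in \<open>auto intro: integrable_diff integrable_on_mult_right\<close>)
    also have "\<dots> \<le> 0" using zero(1)[OF t] delta by (simp add: mult_nonneg_nonpos)
    finally show ?thesis using i by (simp add: Henstock_Kurzweil_Integration.integral_diff)
  qed
  have "step \<xi> \<mu>' \<xi> \<mu>'"
    unfolding step_def
  proof (intro conjI)
    show "skorokhod T (G x0 (g 0 (u 0) (u 0 - x0))) (drift \<xi> \<mu>') \<mu>'"
      using st drift_eq by (simp add: step_def skorokhod_def)
    show "\<forall>t. 0 \<le> \<mu>' t \<and> \<mu>' t \<le> M t" using adm' by (simp add: adm_def)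
    show "\<forall>t\<in>{0..T}. \<xi> t = u 0 - x0 + integral {0..t} (\<lambda>s. \<mu>' s *\<^sub>R vel \<xi> s)"
      using st zero(2) by (simp add: step_def)
  qed
  then show thesis using that adm'' by blast
qed

end

section \<open>The level along a fixed point\<close>

context sweeping_process begin

definition "level \<xi> t = G (u t - \<xi> t) (W \<xi> t)"

text \<open>The rate at which the velocity field lowers the level through x. It is 1 where the
  gradient has length at least c, in particular on the level set, and smaller only where the
  truncation is active.\<close>

definition "align \<xi> t = inner (Gx (u t - \<xi> t) (W \<xi> t)) (vel \<xi> t)"

lemma align_eq: "align \<xi> t = (norm (Gx (u t - \<xi> t) (W \<xi> t)) / max (norm (Gx (u t - \<xi> t) (W \<xi> t))) c)\<^sup>2"
  by (simp add: align_def vel_def V_def power2_norm_eq_inner[symmetric] power_divide)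

lemma align_bounds: "0 \<le> align \<xi> t" "align \<xi> t \<le> 1"
proof -
  let ?n = "norm (Gx (u t - \<xi> t) (W \<xi> t))"
  have "0 < max ?n c" using pos_consts by (simp add: max.strict_coboundedI2)
  then have "0 \<le> ?n / max ?n c" "?n / max ?n c \<le> 1" by auto
  then show "0 \<le> align \<xi> t" "align \<xi> t \<le> 1" unfolding align_eq by (auto simp: power_le_one)
qed

lemma on_level:
  assumes "level \<xi> t = 1"
  shows "c \<le> norm (Gx (u t - \<xi> t) (W \<xi> t))" "align \<xi> t = 1"
    "vel \<xi> t = (1 / (norm (Gx (u t - \<xi> t) (W \<xi> t)))\<^sup>2) *\<^sub>R Gx (u t - \<xi> t) (W \<xi> t)"
proof -
  show n: "c \<le> norm (Gx (u t - \<xi> t) (W \<xi> t))" using assms Gx_lower by (simp add: level_def)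
  then have m: "max (norm (Gx (u t - \<xi> t) (W \<xi> t))) c = norm (Gx (u t - \<xi> t) (W \<xi> t))" by simp
  show "align \<xi> t = 1" unfolding align_eq m using n pos_consts by auto
  show "vel \<xi> t = (1 / (norm (Gx (u t - \<xi> t) (W \<xi> t)))\<^sup>2) *\<^sub>R Gx (u t - \<xi> t) (W \<xi> t)"
    unfolding vel_def V_def m ..
qed

lemma level_deriv:
  assumes good: "good t" and \<xi>: "(\<xi> has_vector_derivative \<xi>') (at t)"
  shows "(level \<xi> has_vector_derivative inner (Gx (u t - \<xi> t) (W \<xi> t)) (u' t - \<xi>') +
    Gw (u t - \<xi> t) (W \<xi> t) (gt t (u t) (\<xi> t) + gu t (u t) (\<xi> t) (u' t) + gxi t (u t) (\<xi> t) \<xi>')) (at t)"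
proof -
  have t: "t \<in> {0<..<T}" and gb: "g_bounds t" and ud: "(u has_vector_derivative u' t) (at t)"
    and bd: "((\<lambda>t. integral {0..t} (\<lambda>\<tau>. \<bar>b \<tau>\<bar>)) has_vector_derivative \<bar>b t\<bar>) (at t)"
    using good by (auto simp: good_def)
  have "(W \<xi> has_vector_derivative gt t (u t) (\<xi> t) + gu t (u t) (\<xi> t) (u' t) + gxi t (u t) (\<xi> t) \<xi>') (at t)"
    unfolding W_def by (rule g_chain[OF t gb bd ud \<xi>])
  then show ?thesis unfolding level_def by (rule G_chain[OF has_vector_derivative_diff[OF ud \<xi>]])
qed

lemma level_deriv_drift:
  assumes "good t" and "(\<xi> has_vector_derivative m t *\<^sub>R vel \<xi> t) (at t)"
  shows "(level \<xi> has_vector_derivative drift \<xi> m t - m t * align \<xi> t) (at t)"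
  using level_deriv[OF assms] assms(1)
  by (simp add: drift_def rate_def align_def inner_diff_right blinfun.scaleR_right algebra_simps)

lemma u_increment:
  assumes "0 \<le> s" "s \<le> t" "t \<le> T"
  shows "norm (u t - u s) \<le> integral {s..t} (\<lambda>\<tau>. norm (u' \<tau>))"
proof -
  have "u t - u s = integral {0..t} u' - integral {0..s} u'"
    using u_eq[of t] u_eq[of s] assms by (metis add_diff_cancel_left atLeastAtMost_iff order_trans)
  also have "\<dots> = integral {s..t} u'" by (rule integral_diff_interval[OF u'_int assms])
  finally have eq: "u t - u s = integral {s..t} u'" .
  show ?thesis unfolding eq
    by (rule integral_norm_bound_integral) (use u'_int norm_u'_int assms in \<open>auto intro: integrable_subinterval_real\<close>)
qed

text \<open>Increments of the level are dominated by those of u, of g in time and of \<xi>, through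
  the global Lipschitz constants, so its almost everywhere derivative integrates back to it. The
  bound \<kappa> is left free: it is M / c for fixed points and the norm of the derivative for a
  given solution.\<close>

lemma level_has_integral:
  assumes \<kappa>: "\<kappa> integrable_on {0..T}"
    and incr: "\<And>s t. 0 \<le> s \<Longrightarrow> s \<le> t \<Longrightarrow> t \<le> T \<Longrightarrow> norm (\<xi> t - \<xi> s) \<le> integral {s..t} \<kappa>"
    and der: "AE t in lebesgue. t \<in> {0<..<T} \<longrightarrow> (\<xi> has_vector_derivative m t *\<^sub>R vel \<xi> t) (at t)"
    and t: "t \<in> {0..T}"
  shows "((\<lambda>s. drift \<xi> m s - m s * align \<xi> s) has_integral (level \<xi> t - level \<xi> 0)) {0..t}"
proof -
  define \<phi> where "\<phi> s = (K0 + K1 * \<omega>) * norm (u' s) + K1 * \<bar>a s\<bar> + (K0 + K1 * \<gamma>) * \<kappa> s" for s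
  have \<phi>: "\<phi> integrable_on {0..T}"
    unfolding \<phi>_def by (intro integrable_add integrable_on_mult_right norm_u'_int abs_a_int \<kappa>)
  show ?thesis
  proof (rule has_integral_derivative_AE[where \<phi>=\<phi>])
    show "\<phi> integrable_on {0..t}" using \<phi> t by (auto intro: integrable_subinterval_real)
    show "AE s in lebesgue. s \<in> {0<..<t} \<longrightarrow> (level \<xi> has_vector_derivative drift \<xi> m s - m s * align \<xi> s) (at s)"
      using good_AE der by eventually_elim (use t level_deriv_drift in auto)
    fix p q assume pq: "0 \<le> p" "p \<le> q" "q \<le> t"
    then have pq': "0 \<le> p" "p \<le> q" "q \<le> T" using t by auto
    define U where "U = integral {p..q} (\<lambda>\<tau>. norm (u' \<tau>))"
    define Aa where "Aa = integral {p..q} (\<lambda>\<tau>. \<bar>a \<tau>\<bar>)"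
    define X where "X = integral {p..q} \<kappa>"
    have du: "norm (u q - u p) \<le> U" unfolding U_def by (rule u_increment[OF pq'])
    have dx: "norm (\<xi> q - \<xi> p) \<le> X" unfolding X_def by (rule incr[OF pq'])
    have "norm (W \<xi> q - W \<xi> p) \<le> norm (g q (u q) (\<xi> q) - g p (u q) (\<xi> q)) + norm (g p (u q) (\<xi> q) - g p (u p) (\<xi> p))"
      unfolding W_def using norm_triangle_ineq[of "g q (u q) (\<xi> q) - g p (u q) (\<xi> q)" "g p (u q) (\<xi> q) - g p (u p) (\<xi> p)"] by simp
    also have "\<dots> \<le> Aa + (\<omega> * norm (u q - u p) + \<gamma> * norm (\<xi> q - \<xi> p))"
      unfolding Aa_def using pq' by (intro add_mono g_time_increment g_lipschitz) auto
    also have "\<dots> \<le> Aa + (\<omega> * U + \<gamma> * X)" using du dx pos_consts by (intro add_mono mult_left_mono) auto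
    finally have dw: "norm (W \<xi> q - W \<xi> p) \<le> Aa + (\<omega> * U + \<gamma> * X)" .
    have "norm ((u q - \<xi> q) - (u p - \<xi> p)) \<le> norm (u q - u p) + norm (\<xi> q - \<xi> p)"
      using norm_triangle_ineq4[of "u q - u p" "\<xi> q - \<xi> p"] by (simp add: algebra_simps)
    then have dxx: "norm ((u q - \<xi> q) - (u p - \<xi> p)) \<le> U + X" using du dx by linarith
    have "norm (level \<xi> q - level \<xi> p) \<le> K0 * norm ((u q - \<xi> q) - (u p - \<xi> p)) + K1 * norm (W \<xi> q - W \<xi> p)"
      unfolding level_def real_norm_def by (rule G_lipschitz)
    also have "\<dots> \<le> K0 * (U + X) + K1 * (Aa + (\<omega> * U + \<gamma> * X))"
      using dxx dw pos_consts by (intro add_mono mult_left_mono) auto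
    also have "\<dots> = (K0 + K1 * \<omega>) * U + K1 * Aa + (K0 + K1 * \<gamma>) * X" by (simp add: algebra_simps)
    also have "\<dots> = integral {p..q} \<phi>"
    proof -
      have i: "(\<lambda>\<tau>. norm (u' \<tau>)) integrable_on {p..q}" "(\<lambda>\<tau>. \<bar>a \<tau>\<bar>) integrable_on {p..q}" "\<kappa> integrable_on {p..q}"
        using norm_u'_int abs_a_int \<kappa> pq' by (auto intro: integrable_subinterval_real)
      have "(\<phi> has_integral (K0 + K1 * \<omega>) * U + K1 * Aa + (K0 + K1 * \<gamma>) * X) {p..q}"
        unfolding \<phi>_def U_def Aa_def X_def
        by (intro has_integral_add has_integral_mult_right integrable_integral i)
      then show ?thesis by (simp add: integral_unique)
    qed
    finally show "norm (level \<xi> q - level \<xi> p) \<le> integral {p..q} \<phi>" .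
  qed (use t in auto)
qed

text \<open>Moving from a point slightly outside along the negative gradient reaches the level set
  \<open>G = 1\<close> after a distance of order E, where the gradient has length at least c.\<close>
lemma align_near_level:
  assumes lev: "level \<xi> t = 1 + E" and E: "0 \<le> E" "E \<le> c\<^sup>2 / (16 * C0)"
    and n: "norm (Gx (u t - \<xi> t) (W \<xi> t)) \<ge> c / 2"
  shows "1 - align \<xi> t \<le> 8 * C0 / c\<^sup>2 * E"
proof -
  define x w where "x = u t - \<xi> t" and "w = W \<xi> t"
  define \<alpha> where "\<alpha> = norm (Gx x w)"
  have \<alpha>: "\<alpha> \<ge> c / 2" "\<alpha> > 0" using n pos_consts by (auto simp: \<alpha>_def x_def w_def)
  define v where "v = - (1 / \<alpha>) *\<^sub>R Gx x w"
  have nv: "norm v = 1" using \<alpha> by (simp add: v_def \<alpha>_def)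
  have iv: "inner (Gx x w) v = - \<alpha>" using \<alpha> by (simp add: v_def \<alpha>_def power2_norm_eq_inner[symmetric] power2_eq_square)
  \<comment> \<open>The slope is at least c / 2, so a step of this length lowers the level by 2 E to
    first order; the bound on E keeps the quadratic error \<open>C0 * s\<^sup>2\<close> below E, and
    the level drops to 1 or less. Along the way the gradient changes by at most
    \<open>C0 * s\<close>, and the factor c + \<alpha>, at most 2 c, yields the final constant
    8.\<close>
  define s where "s = 4 * E / c"
  have s: "s \<ge> 0" using E pos_consts by (simp add: s_def)
  have "\<bar>G (x + s *\<^sub>R v) w - G x w - inner (Gx x w) (s *\<^sub>R v)\<bar> \<le> C0 * (norm (s *\<^sub>R v))\<^sup>2" by (rule G_remainder_x)
  then have "G (x + s *\<^sub>R v) w \<le> 1 + E - s * \<alpha> + C0 * s\<^sup>2"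
    using lev iv nv s by (simp add: level_def x_def w_def)
  also have "\<dots> \<le> 1"
  proof -
    have "s * (c / 2) \<le> s * \<alpha>" using \<alpha> s by (intro mult_left_mono)
    then have 1: "2 * E \<le> s * \<alpha>" using pos_consts by (simp add: s_def)
    have "C0 * s\<^sup>2 = (16 * C0 / c\<^sup>2 * E) * E" by (simp add: s_def power_divide power_mult_distrib power2_eq_square)
    also have "\<dots> \<le> 1 * E"
      using E pos_consts by (intro mult_right_mono) (auto simp: field_simps)
    finally show ?thesis using 1 by simp
  qed
  finally have "G (x + s *\<^sub>R v) w \<le> 1" .
  moreover have "1 \<le> G (x + 0 *\<^sub>R v) w" using lev E by (simp add: level_def x_def w_def)
  moreover have "continuous_on {0..s} (\<lambda>\<sigma>. G (x + \<sigma> *\<^sub>R v) w)"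
    by (rule continuous_on_compose2[OF sublevel.F_cont[of UNIV w]]) (auto intro!: continuous_intros)
  ultimately obtain \<sigma> where \<sigma>: "0 \<le> \<sigma>" "\<sigma> \<le> s" "G (x + \<sigma> *\<^sub>R v) w = 1"
    using IVT2'[of "\<lambda>\<sigma>. G (x + \<sigma> *\<^sub>R v) w" s 1 0] s by blast
  have "c \<le> norm (Gx (x + \<sigma> *\<^sub>R v) w)" by (rule Gx_lower[OF \<sigma>(3)])
  also have "\<dots> \<le> \<alpha> + norm (Gx (x + \<sigma> *\<^sub>R v) w - Gx x w)"
    unfolding \<alpha>_def using norm_triangle_ineq[of "Gx x w" "Gx (x + \<sigma> *\<^sub>R v) w - Gx x w"] by simp
  also have "\<dots> \<le> \<alpha> + C0 * \<sigma>" using Gx_lip[of "x + \<sigma> *\<^sub>R v" w x w] nv \<sigma>(1) by simp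
  also have "\<dots> \<le> \<alpha> + C0 * s" using \<sigma> pos_consts by simp
  finally have lower: "c - \<alpha> \<le> 4 * C0 * E / c" by (simp add: s_def mult_ac)
  show ?thesis
  proof (cases "\<alpha> \<ge> c")
    case True
    then have "align \<xi> t = 1" unfolding align_eq using \<alpha> by (simp add: \<alpha>_def x_def w_def max_def)
    then show ?thesis using E pos_consts by simp
  next
    case False
    then have "align \<xi> t = (\<alpha> / c)\<^sup>2" unfolding align_eq by (simp add: \<alpha>_def x_def w_def max_def)
    then have "1 - align \<xi> t = (c - \<alpha>) * ((c + \<alpha>) / c\<^sup>2)" using pos_consts by (simp add: power_divide field_simps power2_eq_square)
    also have "\<dots> \<le> (4 * C0 * E / c) * ((2 * c) / c\<^sup>2)"
      using lower False \<alpha> pos_consts E by (intro mult_mono divide_right_mono) auto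
    also have "\<dots> = 8 * C0 / c\<^sup>2 * E" using pos_consts by (simp add: power2_eq_square)
    finally show ?thesis .
  qed
qed

lemma fixed_point_deriv:
  assumes adm: "adm \<xi> m" and step: "step \<xi> m \<xi> m"
  shows "AE t in lebesgue. t \<in> {0<..<T} \<longrightarrow> (\<xi> has_vector_derivative m t *\<^sub>R vel \<xi> t) (at t)"
proof -
  have m: "m absolutely_integrable_on {0..T}" and \<xi>: "continuous_on {0..T} \<xi>" using adm by (auto simp: adm_def)
  show ?thesis
    using primitive_scaleR_has_vector_derivative_AE[OF m compose_cont(1)[OF \<xi>]]
  proof eventually_elim
    case (elim t)
    show ?case
    proof
      assume t: "t \<in> {0<..<T}"
      have "((\<lambda>t. u 0 - x0 + integral {0..t} (\<lambda>s. m s *\<^sub>R vel \<xi> s)) has_vector_derivative 0 + m t *\<^sub>R vel \<xi> t) (at t)"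
        using elim t by (intro has_vector_derivative_add has_vector_derivative_const) auto
      then have "((\<lambda>t. u 0 - x0 + integral {0..t} (\<lambda>s. m s *\<^sub>R vel \<xi> s)) has_vector_derivative m t *\<^sub>R vel \<xi> t) (at t)" by simp
      then show "(\<xi> has_vector_derivative m t *\<^sub>R vel \<xi> t) (at t)"
      proof (rule has_vector_derivative_transform_within_open[where S="{0<..<T}"])
        show "u 0 - x0 + integral {0..s} (\<lambda>s. m s *\<^sub>R vel \<xi> s) = \<xi> s" if "s \<in> {0<..<T}" for s
          using step that unfolding step_def by auto
      qed (use t in auto)
    qed
  qed
qed

lemma fixed_point_increment:
  assumes adm: "adm \<xi> m" and step: "step \<xi> m \<xi> m" and st: "0 \<le> s" "s \<le> t" "t \<le> T"
  shows "norm (\<xi> t - \<xi> s) \<le> integral {s..t} (\<lambda>\<tau>. 1 / c * M \<tau>)"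
proof -
  have m: "m absolutely_integrable_on {0..T}" and \<xi>: "continuous_on {0..T} \<xi>" using adm by (auto simp: adm_def)
  have i: "(\<lambda>s. m s *\<^sub>R vel \<xi> s) integrable_on {0..T}" by (rule integrable_on_scaleR_continuous[OF m compose_cont(1)[OF \<xi>]])
  have eqs: "\<xi> r = u 0 - x0 + integral {0..r} (\<lambda>s. m s *\<^sub>R vel \<xi> s)" if "r \<in> {0..T}" for r
    using step that unfolding step_def by blast
  have "\<xi> t - \<xi> s = integral {0..t} (\<lambda>s. m s *\<^sub>R vel \<xi> s) - integral {0..s} (\<lambda>s. m s *\<^sub>R vel \<xi> s)"
  proof -
    have tT: "t \<in> {0..T}" and sT: "s \<in> {0..T}" using st by auto
    show ?thesis unfolding eqs[OF tT] eqs[OF sT] by simp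
  qed
  also have "\<dots> = integral {s..t} (\<lambda>s. m s *\<^sub>R vel \<xi> s)" by (rule integral_diff_interval[OF i st])
  finally have eq: "\<xi> t - \<xi> s = integral {s..t} (\<lambda>s. m s *\<^sub>R vel \<xi> s)" .
  show ?thesis unfolding eq
  proof (rule integral_norm_bound_integral)
    show "(\<lambda>s. m s *\<^sub>R vel \<xi> s) integrable_on {s..t}" using i st by (auto intro: integrable_subinterval_real)
    show "(\<lambda>\<tau>. 1 / c * M \<tau>) integrable_on {s..t}"
      using M_int st by (intro integrable_on_mult_right) (auto intro: integrable_subinterval_real)
    fix \<tau>
    have "norm (m \<tau> *\<^sub>R vel \<xi> \<tau>) = m \<tau> * norm (vel \<xi> \<tau>)" using adm by (simp add: adm_def)
    also have "\<dots> \<le> M \<tau> * (1 / c)" using adm vel_bound[of \<xi> \<tau>] M_nonneg[of \<tau>] by (intro mult_mono) (auto simp: adm_def)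
    finally show "norm (m \<tau> *\<^sub>R vel \<xi> \<tau>) \<le> 1 / c * M \<tau>" by simp
  qed
qed

text \<open>At a fixed point the level can differ from the reflected path only through the truncation in
  the velocity field. The gap is nondecreasing; right after the last time at which it vanishes it is at
  most half of itself, since the truncation error is proportional to the gap near the level set.\<close>
lemma fixed_point_level:
  assumes adm: "adm \<xi> m" and step: "step \<xi> m \<xi> m" and t: "t \<in> {0..T}"
  shows "level \<xi> t = level \<xi> 0 + integral {0..t} (drift \<xi> m) - integral {0..t} m"
proof -
  have m: "m absolutely_integrable_on {0..T}" and \<xi>: "continuous_on {0..T} \<xi>" and m0: "\<And>t. 0 \<le> m t"
    using adm by (auto simp: adm_def)
  have \<xi>0: "\<xi> 0 = u 0 - x0" using step T_pos by (simp add: step_def)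
  have lev0: "level \<xi> 0 = G x0 (g 0 (u 0) (u 0 - x0))" by (simp add: level_def W_def \<xi>0)
  define Y where "Y t = level \<xi> 0 + integral {0..t} (drift \<xi> m) - integral {0..t} m" for t
  define h where "h s = m s * (1 - align \<xi> s)" for s
  \<comment> \<open>The gap between the true level and the reflected path. Its density h is the push
    lost to truncation, which is nonnegative.\<close>
  define E where "E t = level \<xi> t - Y t" for t
  note dint = drift_int[OF adm]
  have h0: "0 \<le> h s" for s using m0 align_bounds by (simp add: h_def)
  have hint: "(h has_integral E t) {0..t}" if t: "t \<in> {0..T}" for t
  proof -
    have "((\<lambda>s. drift \<xi> m s - m s * align \<xi> s) has_integral (level \<xi> t - level \<xi> 0)) {0..t}"
      by (rule level_has_integral[OF _ fixed_point_increment[OF adm step] fixed_point_deriv[OF adm step] t])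
        (intro integrable_on_mult_right M_int)
    moreover have "((\<lambda>s. drift \<xi> m s - m s) has_integral (integral {0..t} (drift \<xi> m) - integral {0..t} m)) {0..t}"
      by (intro has_integral_diff integrable_integral abs_int_sub(1)[OF dint t] abs_int_sub(1)[OF m t])
    ultimately have "((\<lambda>s. (drift \<xi> m s - m s * align \<xi> s) - (drift \<xi> m s - m s)) has_integral
       (level \<xi> t - level \<xi> 0) - (integral {0..t} (drift \<xi> m) - integral {0..t} m)) {0..t}"
      by (rule has_integral_diff)
    then show ?thesis by (simp add: h_def[abs_def] E_def Y_def algebra_simps)
  qed
  have hi: "h integrable_on {0..T}" using hint[of T] T_pos by auto
  have Ediff: "E q - E p = integral {p..q} h" if "0 \<le> p" "p \<le> q" "q \<le> T" for p q
    using integral_diff_interval[OF hi that] hint[of p] hint[of q] that by (simp add: integral_unique)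
  have Emono: "E p \<le> E q" if "0 \<le> p" "p \<le> q" "q \<le> T" for p q
  proof -
    have "h integrable_on {p..q}" using hi that by (auto intro: integrable_subinterval_real)
    then have "0 \<le> integral {p..q} h" by (rule Henstock_Kurzweil_Integration.integral_nonneg) (rule h0)
    then show ?thesis using Ediff[OF that] by simp
  qed
  have E0: "E 0 = 0" by (simp add: E_def Y_def)
  have Ec: "continuous_on {0..T} E"
  proof -
    have "continuous_on {0..T} (\<lambda>t. integral {0..t} h)" by (rule indefinite_integral_continuous_1[OF hi])
    then show ?thesis by (rule continuous_on_eq) (use hint in \<open>auto simp: integral_unique\<close>)
  qed
  have Yc: "continuous_on {0..T} Y"
    unfolding Y_def using dint m
    by (intro continuous_intros indefinite_integral_continuous_1) (auto simp: absolutely_integrable_on_def)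
  have sk: "Y s \<le> 1" "m s \<noteq> 0 \<Longrightarrow> Y s = 1" if "s \<in> {0..T}" for s
    using step that unfolding step_def skorokhod_def Y_def lev0 by blast+
  have "E t \<le> 0"
  proof (rule ccontr)
    assume "\<not> E t \<le> 0"
    define S where "S = {s \<in> {0..t}. E s = 0}"
    have "closed S"
    proof -
      have "closed ({0..t} \<inter> E -` {0})"
        by (intro continuous_closed_preimage continuous_on_subset[OF Ec]) (use t in auto)
      moreover have "{0..t} \<inter> E -` {0} = S" by (auto simp: S_def)
      ultimately show ?thesis by simp
    qed
    moreover have "0 \<in> S" "bdd_above S" using E0 t by (auto simp: S_def intro: bdd_aboveI[of _ t])
    ultimately have "Sup S \<in> S" by (intro closed_contains_Sup) auto
    define p where "p = Sup S"
    have p: "p \<in> {0..t}" "E p = 0" using \<open>Sup S \<in> S\<close> by (auto simp: S_def p_def)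
    have pt: "p < t" using p \<open>\<not> E t \<le> 0\<close> by (cases "p = t") auto
    have after: "E s > 0" if "p < s" "s \<le> t" for s
    proof -
      have "s \<notin> S" using that cSup_upper[OF _ \<open>bdd_above S\<close>, of s] by (auto simp: p_def)
      moreover have "E p \<le> E s" using that p t by (intro Emono) auto
      ultimately show ?thesis using that p t by (auto simp: S_def)
    qed
    have pT: "p \<in> {0..T}" "p < T" using p t pt by auto
    have right: "\<exists>d>0. \<forall>s. p \<le> s \<and> s < p + d \<and> s \<le> t \<longrightarrow> P (f s)" if f: "continuous_on {0..T} f" and ev: "open {z. P z}" "P (f p)"
      for f :: "real \<Rightarrow> real" and P
    proof -
      obtain d where "d > 0" "\<And>s. s \<in> {0..T} \<Longrightarrow> dist s p < d \<Longrightarrow> f s \<in> {z. P z}"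
        using f pT(1) ev unfolding continuous_on_topological eventually_nhds_metric
        by (metis (no_types, lifting) continuous_on_iff f mem_Collect_eq open_dist)
      then show ?thesis using p t by (intro exI[of _ d]) (auto simp: dist_real_def)
    qed
    \<comment> \<open>Contradicts positivity of the gap after p, in either of two ways: no push acts
      right after p, or the push acts with almost no truncation.\<close>
    have "\<exists>q. p < q \<and> q \<le> t \<and> E q \<le> 0"
    proof (cases "Y p = 1")
      case False
      then have "Y p < 1" using sk(1)[OF pT(1)] by simp
      then obtain d where d: "d > 0" "\<And>s. p \<le> s \<and> s < p + d \<and> s \<le> t \<Longrightarrow> Y s < 1"
        using right[OF Yc, of "\<lambda>z. z < 1"] open_lessThan[of "1::real"] by (auto simp: lessThan_def)
      define q where "q = min t (p + d / 2)"
      have q: "p < q" "q \<le> t" "q < p + d" using d pt by (auto simp: q_def)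
      have "integral {p..q} h = integral {p..q} (\<lambda>_. 0)"
      proof (rule integral_cong)
        fix s assume "s \<in> {p..q}"
        then have "Y s < 1" "s \<in> {0..T}" using d(2)[of s] q p t by auto
        then show "h s = 0" using sk(2)[of s] by (auto simp: h_def)
      qed
      then have "E q = 0" using Ediff[of p q] p q t by simp
      then show ?thesis using q by auto
    next
      case True
      have levp: "level \<xi> p = 1" using p(2) True by (simp add: E_def)
      define K where "K = 8 * C0 / c\<^sup>2"
      have K: "K > 0" using pos_consts by (simp add: K_def)
      have nc: "continuous_on {0..T} (\<lambda>s. norm (Gx (u s - \<xi> s) (W \<xi> s)))" by (intro continuous_intros compose_cont \<xi>)
      have "norm (Gx (u p - \<xi> p) (W \<xi> p)) > c / 2" using on_level(1)[OF levp] pos_consts by linarith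
      then obtain d1 where d1: "d1 > 0" "\<And>s. p \<le> s \<and> s < p + d1 \<and> s \<le> t \<Longrightarrow> norm (Gx (u s - \<xi> s) (W \<xi> s)) > c / 2"
        using right[OF nc, of "\<lambda>z. z > c / 2"] open_greaterThan[of "c/2"] by (auto simp: greaterThan_def)
      have "E p < c\<^sup>2 / (16 * C0)" using p(2) pos_consts by simp
      then obtain d2 where d2: "d2 > 0" "\<And>s. p \<le> s \<and> s < p + d2 \<and> s \<le> t \<Longrightarrow> E s < c\<^sup>2 / (16 * C0)"
        using right[OF Ec, of "\<lambda>z. z < c\<^sup>2 / (16 * C0)"] open_lessThan[of "c\<^sup>2 / (16 * C0)"] by (auto simp: lessThan_def)
      have mi: "m integrable_on {0..T}" using m by (auto simp: absolutely_integrable_on_def)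
      have kc: "continuous_on {0..T} (\<lambda>s. integral {0..s} m - integral {0..p} m)"
        by (intro continuous_intros indefinite_integral_continuous_1[OF mi])
      have "integral {0..p} m - integral {0..p} m < 1 / (2 * K)" using K by simp
      then obtain d3 where d3: "d3 > 0" "\<And>s. p \<le> s \<and> s < p + d3 \<and> s \<le> t \<Longrightarrow> integral {0..s} m - integral {0..p} m < 1 / (2 * K)"
        using right[OF kc, of "\<lambda>z. z < 1 / (2 * K)"] open_lessThan[of "1 / (2 * K)"] by (auto simp: lessThan_def)
      \<comment> \<open>Up to q the gradient stays longer than c / 2 and the gap below
        \<open>c\<^sup>2 / (16 * C0)\<close>, so that \<open>align_near_level\<close> applies; the
        integral of m stays below 1 / (2 K), so that E q is at most half of itself.\<close>
      define q where "q = Min {t, p + d1 / 2, p + d2 / 2, p + d3 / 2}"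
      have q: "p < q" "q \<le> t" "q < p + d1" "q < p + d2" "q < p + d3" using d1 d2 d3 pt by (auto simp: q_def)
      have q': "0 \<le> p" "p \<le> q" "q \<le> T" using q p t by auto
      have Eq: "E q \<ge> 0" using after[of q] q by simp
      have mpq: "m integrable_on {p..q}" using mi q' by (auto intro: integrable_subinterval_real)
      have "E q = integral {p..q} h" using Ediff[OF q'] p(2) by simp
      also have "\<dots> \<le> integral {p..q} (\<lambda>s. K * E q * m s)"
      proof (rule integral_le)
        show "h integrable_on {p..q}" using hi q' by (auto intro: integrable_subinterval_real)
        show "(\<lambda>s. K * E q * m s) integrable_on {p..q}" by (intro integrable_on_mult_right mpq)
        fix s assume s: "s \<in> {p..q}"
        then have sT: "s \<in> {0..T}" using q' by auto
        show "h s \<le> K * E q * m s"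
        proof (cases "m s = 0")
          case True then show ?thesis by (simp add: h_def)
        next
          case False
          then have "level \<xi> s = 1 + E s" using sk(2)[OF sT] by (simp add: E_def)
          moreover have Es: "0 \<le> E s" using Emono[of p s] p(2) s q' by auto
          ultimately have "1 - align \<xi> s \<le> K * E s"
            unfolding K_def using d1(2)[of s] d2(2)[of s] s q by (intro align_near_level) auto
          also have "\<dots> \<le> K * E q" using K Emono[of s q] s q' by (intro mult_left_mono) auto
          finally have "m s * (1 - align \<xi> s) \<le> m s * (K * E q)" using m0 by (rule mult_left_mono)
          then show ?thesis by (simp add: h_def mult_ac)
        qed
      qed
      also have "\<dots> = (K * E q) * integral {p..q} m" by simp
      also have "\<dots> \<le> (K * E q) * (1 / (2 * K))"
        using d3(2)[of q] q K Eq integral_diff_interval[OF mi q'] by (intro mult_left_mono) auto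
      also have "\<dots> = E q / 2" using K by simp
      finally show ?thesis using q by (intro exI[of _ q]) auto
    qed
    then show False using after by force
  qed
  moreover have "E t \<ge> 0" using Emono[of 0 t] E0 t by auto
  ultimately show ?thesis by (simp add: E_def Y_def)
qed

end

section \<open>Solutions as fixed points\<close>

context sweeping_process begin

text \<open>When \<kappa> is nonzero the level attains its maximum 1 at t, so its derivative
  vanishes and expresses |\<nabla>G| |\<xi>'| by u' and the motion of w. Dividing by |\<nabla>G|
  keeps the coefficient 1 at |u'| and gives the bound of \<open>Omega\<close>; bounding |\<nabla>G|
  by K0 in that term gives M.\<close>

lemma velocity_bound:
  assumes good: "good t" and der: "(\<xi> has_vector_derivative d) (at t)"
    and \<kappa>: "0 \<le> \<kappa>" "d = \<kappa> *\<^sub>R Gx (u t - \<xi> t) (W \<xi> t)" "\<kappa> \<noteq> 0 \<Longrightarrow> level \<xi> t = 1"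
    and le: "\<And>s. s \<in> {0..T} \<Longrightarrow> level \<xi> s \<le> 1"
  shows "norm d \<le> 1 / (1 - \<delta>) * ((1 + \<omega> * K1 / c) * norm (u' t) + K1 / c * a t)"
    and "norm (Gx (u t - \<xi> t) (W \<xi> t)) * norm d \<le> M t"
proof -
  have gb: "g_bounds t" and t: "t \<in> {0<..<T}" using good by (auto simp: good_def)
  have a0: "0 \<le> a t" using g_boundsD(3)[OF gb, of 0 0] norm_ge_zero order_trans by blast
  have d1: "1 - \<delta> > 0" using delta by simp
  define n where "n = norm (Gx (u t - \<xi> t) (W \<xi> t))"
  define q where "q = norm d"
  have q0: "0 \<le> q" by (simp add: q_def)
  have "q \<le> 1 / (1 - \<delta>) * ((1 + \<omega> * K1 / c) * norm (u' t) + K1 / c * a t) \<and> n * q \<le> M t"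
  proof (cases "\<kappa> = 0")
    case True
    then have "q = 0" using \<kappa>(2) by (simp add: q_def)
    then show ?thesis using a0 d1 pos_consts M_nonneg by (auto intro!: mult_nonneg_nonneg add_nonneg_nonneg)
  next
    case False
    then have lev: "level \<xi> t = 1" by (rule \<kappa>(3))
    have n: "n \<ge> c" unfolding n_def by (rule on_level(1)[OF lev])
    let ?G = "Gx (u t - \<xi> t) (W \<xi> t)"
    let ?z = "gt t (u t) (\<xi> t) + gu t (u t) (\<xi> t) (u' t) + gxi t (u t) (\<xi> t) d"
    have "(level \<xi> has_real_derivative inner ?G (u' t - d) + Gw (u t - \<xi> t) (W \<xi> t) ?z) (at t)"
      using level_deriv[OF good der] by (simp add: has_real_derivative_iff_has_vector_derivative)
    then have "inner ?G (u' t - d) + Gw (u t - \<xi> t) (W \<xi> t) ?z = 0"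
    proof (rule DERIV_local_max)
      show "0 < min t (T - t)" using t by simp
      show "\<forall>s. \<bar>t - s\<bar> < min t (T - t) \<longrightarrow> level \<xi> s \<le> level \<xi> t" using le lev t by (auto simp: abs_if split: if_splits)
    qed
    moreover have "inner ?G d = n * q"
      using \<kappa> by (simp add: n_def q_def power2_norm_eq_inner[symmetric] power2_eq_square)
    ultimately have eq: "n * q = inner ?G (u' t) + Gw (u t - \<xi> t) (W \<xi> t) ?z" by (simp add: inner_diff_right)
    have "norm (gu t (u t) (\<xi> t) (u' t)) \<le> \<omega> * norm (u' t)"
      using g_boundsD(2)[OF gb] by (intro order_trans[OF norm_blinfun] mult_right_mono) auto
    moreover have "norm (gxi t (u t) (\<xi> t) d) \<le> \<gamma> * q"
      unfolding q_def using g_boundsD(1)[OF gb] by (intro order_trans[OF norm_blinfun] mult_right_mono) auto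
    moreover have "norm (gt t (u t) (\<xi> t)) \<le> a t" by (rule g_boundsD(3)[OF gb])
    ultimately have z: "norm ?z \<le> a t + \<omega> * norm (u' t) + \<gamma> * q"
      by (intro norm_triangle_le add_mono) auto
    define Q where "Q = K1 * (a t + \<omega> * norm (u' t) + \<gamma> * q)"
    have "norm (Gw (u t - \<xi> t) (W \<xi> t) ?z) \<le> Q"
      unfolding Q_def using z pos_consts by (intro order_trans[OF norm_blinfun] mult_mono Gw_bound) auto
    moreover have "inner ?G (u' t) \<le> n * norm (u' t)" unfolding n_def by (rule norm_cauchy_schwarz)
    ultimately have main: "n * q \<le> n * norm (u' t) + Q" using eq by simp
    have Q0: "Q \<ge> 0" using a0 q0 pos_consts by (simp add: Q_def)
    have n0: "n > 0" using n pos_consts by simp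
    have "n * (q - norm (u' t)) \<le> Q" using main by (simp add: algebra_simps)
    then have "q - norm (u' t) \<le> Q / n" using n0 by (simp add: field_simps)
    also have "\<dots> \<le> Q / c" using Q0 n pos_consts by (intro divide_left_mono) auto
    finally have "q - norm (u' t) \<le> Q / c" .
    moreover have "Q / c = K1 / c * a t + \<omega> * K1 / c * norm (u' t) + \<delta> * q"
      by (simp add: Q_def \<delta>_def algebra_simps add_divide_distrib)
    ultimately have "(1 - \<delta>) * q \<le> (1 + \<omega> * K1 / c) * norm (u' t) + K1 / c * a t"
      by (simp add: algebra_simps)
    then have 1: "q \<le> 1 / (1 - \<delta>) * ((1 + \<omega> * K1 / c) * norm (u' t) + K1 / c * a t)"
      using d1 by (simp add: field_simps)
    have "K1 * (\<gamma> * q) \<le> \<delta> * (n * q)"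
    proof -
      have "c * q \<le> n * q" using n q0 by (rule mult_right_mono)
      then have "(K1 * \<gamma> / c) * (c * q) \<le> (K1 * \<gamma> / c) * (n * q)" using pos_consts by (intro mult_left_mono) auto
      then show ?thesis using pos_consts by (simp add: \<delta>_def mult.assoc)
    qed
    moreover have "n * norm (u' t) \<le> K0 * norm (u' t)" unfolding n_def by (intro mult_right_mono Gx_bound) auto
    moreover have "K1 * (a t + \<omega> * norm (u' t)) \<le> K1 * (\<bar>a t\<bar> + \<omega> * norm (u' t))"
      using pos_consts by (intro mult_left_mono) auto
    moreover have "Q = K1 * (a t + \<omega> * norm (u' t)) + K1 * (\<gamma> * q)" by (simp add: Q_def distrib_left)
    ultimately have "(1 - \<delta>) * (n * q) \<le> K0 * norm (u' t) + K1 * (\<bar>a t\<bar> + \<omega> * norm (u' t))"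
      using main by (simp add: left_diff_distrib)
    then have "n * q \<le> M t" unfolding M_def using d1 by (simp add: pos_le_divide_eq mult.commute)
    with 1 show ?thesis by simp
  qed
  then show "norm d \<le> 1 / (1 - \<delta>) * ((1 + \<omega> * K1 / c) * norm (u' t) + K1 / c * a t)"
    "norm (Gx (u t - \<xi> t) (W \<xi> t)) * norm d \<le> M t" by (simp_all add: q_def n_def)
qed

lemma fixed_point_solution:
  assumes adm: "adm \<xi> m" and step: "step \<xi> m \<xi> m"
  shows "sweeping_solution T G g (c / lam) u x0 \<xi>"
    and "\<xi> \<in> Omega T (K1 * \<gamma> / c) \<omega> K1 c a u x0"
proof -
  have m: "m absolutely_integrable_on {0..T}" and \<xi>: "continuous_on {0..T} \<xi>" and m0: "\<And>t. 0 \<le> m t"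
    using adm by (auto simp: adm_def)
  have \<xi>0: "\<xi> 0 = u 0 - x0" using step T_pos by (simp add: step_def)
  have lev0: "level \<xi> 0 = G x0 (g 0 (u 0) (u 0 - x0))" by (simp add: level_def W_def \<xi>0)
  have le: "level \<xi> t \<le> 1" and eq1: "m t \<noteq> 0 \<Longrightarrow> level \<xi> t = 1" if "t \<in> {0..T}" for t
    using step that fixed_point_level[OF adm step that] unfolding step_def skorokhod_def lev0 by auto
  have w11: "W11 T \<xi>"
    unfolding W11_def
  proof (intro exI[of _ "\<lambda>t. m t *\<^sub>R vel \<xi> t"] conjI fixed_point_deriv[OF adm step])
    show "(\<lambda>t. m t *\<^sub>R vel \<xi> t) integrable_on {0..T}" by (rule integrable_on_scaleR_continuous[OF m compose_cont(1)[OF \<xi>]])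
    have "(\<lambda>t. m t *\<^sub>R norm (vel \<xi> t)) integrable_on {0..T}"
      by (intro integrable_on_scaleR_continuous[OF m] continuous_on_norm compose_cont(1)[OF \<xi>])
    then show "(\<lambda>t. norm (m t *\<^sub>R vel \<xi> t)) integrable_on {0..T}" using m0 by simp
    show "\<forall>t\<in>{0..T}. \<xi> t = \<xi> 0 + integral {0..t} (\<lambda>t. m t *\<^sub>R vel \<xi> t)" using step unfolding step_def \<xi>0 by blast
  qed
  have ae: "AE t in lebesgue. t \<in> {0<..<T} \<longrightarrow> good t \<and> (\<xi> has_vector_derivative m t *\<^sub>R vel \<xi> t) (at t)"
    using good_AE fixed_point_deriv[OF adm step] by eventually_elim auto
  \<comment> \<open>A nonzero push places t on the level set, where the truncation is inactive and
    \<open>vel\<close> is a positive multiple of the gradient.\<close>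
  have normal: "\<exists>\<kappa>\<ge>0. m t *\<^sub>R vel \<xi> t = \<kappa> *\<^sub>R Gx (u t - \<xi> t) (W \<xi> t) \<and> (\<kappa> \<noteq> 0 \<longrightarrow> level \<xi> t = 1)"
    if "t \<in> {0..T}" for t
  proof (cases "m t = 0")
    case False
    let ?k = "m t * (1 / (norm (Gx (u t - \<xi> t) (W \<xi> t)))\<^sup>2)"
    have "?k \<ge> 0" using m0 by simp
    moreover have "m t *\<^sub>R vel \<xi> t = ?k *\<^sub>R Gx (u t - \<xi> t) (W \<xi> t)"
      using on_level(3)[OF eq1[OF that False]] by simp
    ultimately show ?thesis using eq1[OF that False] by blast
  qed (auto intro: exI[of _ 0])
  show "sweeping_solution T G g (c / lam) u x0 \<xi>"
    unfolding sweeping_solution_def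
  proof (intro conjI w11)
    show "\<forall>t\<in>{0..T}. u t - \<xi> t \<in> Zset G (g t (u t) (\<xi> t))" using le by (simp add: Zset_def level_def W_def)
    show "u 0 - \<xi> 0 = x0" by (simp add: \<xi>0)
    show "AE t in lebesgue. t \<in> {0<..<T} \<longrightarrow> (\<forall>z\<in>Zset G (g t (u t) (\<xi> t)).
        0 \<le> inner (u t - \<xi> t - z) (dot \<xi> t) + norm (dot \<xi> t) / (2 * (c / lam)) * (norm (u t - \<xi> t - z))\<^sup>2)"
      using ae
    proof eventually_elim
      case (elim t)
      show ?case
      proof (intro impI ballI)
        fix z assume t: "t \<in> {0<..<T}" and z: "z \<in> Zset G (g t (u t) (\<xi> t))"
        have tT: "t \<in> {0..T}" using t by auto
        let ?x = "u t - \<xi> t" and ?w = "W \<xi> t"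
        have dot: "dot \<xi> t = m t *\<^sub>R vel \<xi> t" using elim t by (auto simp: dot_def intro: vector_derivative_at)
        obtain \<kappa> where \<kappa>: "\<kappa> \<ge> 0" "m t *\<^sub>R vel \<xi> t = \<kappa> *\<^sub>R Gx ?x ?w" "\<kappa> \<noteq> 0 \<Longrightarrow> level \<xi> t = 1" using normal[OF tT] by blast
        show "0 \<le> inner (?x - z) (dot \<xi> t) + norm (dot \<xi> t) / (2 * (c / lam)) * (norm (?x - z))\<^sup>2"
        proof (cases "\<kappa> = 0")
          case False
          have "G ?x ?w = 1" "G z ?w \<le> 1" using \<kappa>(3)[OF False] z by (auto simp: level_def Zset_def W_def)
          then have "inner (Gx ?x ?w) (?x - z) \<ge> - (lam / (2 * c)) * norm (Gx ?x ?w) * (norm (?x - z))\<^sup>2"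
            by (rule sublevel.prox_regular)
          \<comment> \<open>Scaling by \<kappa> turns \<kappa> times the gradient into the velocity,
            and \<open>lam / (2 * c)\<close> is 1 / (2 r).\<close>
          then have "0 \<le> \<kappa> * (inner (Gx ?x ?w) (?x - z) + (lam / (2 * c)) * norm (Gx ?x ?w) * (norm (?x - z))\<^sup>2)"
            using \<kappa>(1) by (intro mult_nonneg_nonneg) auto
          also have "\<dots> = inner (?x - z) (dot \<xi> t) + norm (dot \<xi> t) / (2 * (c / lam)) * (norm (?x - z))\<^sup>2"
            unfolding dot \<kappa>(2) using \<kappa>(1) by (simp add: inner_commute algebra_simps)
          finally show ?thesis .
        qed (simp add: dot \<kappa>(2))
      qed
    qed
  qed
  show "\<xi> \<in> Omega T (K1 * \<gamma> / c) \<omega> K1 c a u x0"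
    unfolding Omega_def
  proof (intro CollectI conjI w11 \<xi>0)
    show "AE t in lebesgue. t \<in> {0<..<T} \<longrightarrow> norm (dot \<xi> t) \<le>
      1 / (1 - K1 * \<gamma> / c) * ((1 + \<omega> * K1 / c) * norm (dot u t) + K1 / c * a t)"
      using ae
    proof eventually_elim
      case (elim t)
      show ?case
      proof
        assume t: "t \<in> {0<..<T}"
        then have tT: "t \<in> {0..T}" by auto
        have dot: "dot \<xi> t = m t *\<^sub>R vel \<xi> t" "dot u t = u' t"
          using elim t by (auto simp: dot_def good_def intro: vector_derivative_at)
        obtain \<kappa> where \<kappa>: "\<kappa> \<ge> 0" "m t *\<^sub>R vel \<xi> t = \<kappa> *\<^sub>R Gx (u t - \<xi> t) (W \<xi> t)" "\<kappa> \<noteq> 0 \<Longrightarrow> level \<xi> t = 1"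
          using normal[OF tT] by blast
        show "norm (dot \<xi> t) \<le> 1 / (1 - K1 * \<gamma> / c) * ((1 + \<omega> * K1 / c) * norm (dot u t) + K1 / c * a t)"
          unfolding dot \<delta>_def[symmetric]
          by (rule velocity_bound(1)[OF _ _ \<kappa> le]) (use elim t in auto)
      qed
    qed
  qed
qed

text \<open>Testing with \<open>z = x + t *\<^sub>R v\<close> along admissible v and letting t tend
  to 0 removes the quadratic term, whatever C is. What remains says that d is nonpositive on the
  open half-space of descent directions, hence a nonnegative multiple of the gradient; below the
  level all directions are admissible and d = 0.\<close>

lemma normal_of_variational_inequality:
  assumes x: "G x w \<le> 1"
    and vi: "\<And>z. z \<in> Zset G w \<Longrightarrow> 0 \<le> inner (x - z) d + C * (norm (x - z))\<^sup>2"
  shows "\<exists>\<kappa>\<ge>0. d = \<kappa> *\<^sub>R Gx x w \<and> (\<kappa> \<noteq> 0 \<longrightarrow> G x w = 1)"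
proof -
  have crit: "inner d v \<le> 0" if v: "G x w = 1 \<Longrightarrow> inner (Gx x w) v < 0" for v
  proof (rule le_of_small_multiples[where C="C * (norm v)\<^sup>2"])
    have "\<forall>\<^sub>F t in at_right 0. G (x + t *\<^sub>R v) w \<le> 1" using x v by (rule sublevel.sublevel_direction)
    then show "\<forall>\<^sub>F t in at_right 0. t * inner d v \<le> t * 0 + t\<^sup>2 * (C * (norm v)\<^sup>2)"
    proof eventually_elim
      case (elim t)
      have "0 \<le> inner (x - (x + t *\<^sub>R v)) d + C * (norm (x - (x + t *\<^sub>R v)))\<^sup>2"
        using elim by (intro vi) (simp add: Zset_def)
      then show ?case by (simp add: inner_commute power_mult_distrib mult_ac)
    qed
  qed
  show ?thesis
  proof (cases "G x w = 1")
    case True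
    have "Gx x w \<noteq> 0" using Gx_lower[OF True] pos_consts by auto
    then obtain \<kappa> where "\<kappa> \<ge> 0" "norm (d - \<kappa> *\<^sub>R Gx x w) \<le> 0"
      using approx_normal_halfspace[of "Gx x w" 0 d] crit by auto
    then show ?thesis using True by auto
  next
    case False
    have "inner d d \<le> 0" by (rule crit) (use False in simp)
    then have "d = 0" by (metis inner_gt_zero_iff not_le)
    then show ?thesis by (intro exI[of _ 0]) simp
  qed
qed

text \<open>The density is recovered as |\<nabla>G| |\<xi>'|. It is nonzero only where the level is
  1, so the truncation has no effect and the level itself is the reflected path, which is the
  Skorokhod condition. Uniqueness of fixed points thereby becomes uniqueness of solutions.\<close>

lemma solution_fixed_point:
  assumes sol: "sweeping_solution T G g (c / lam) u x0 \<xi>"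
  obtains m where "adm \<xi> m" "step \<xi> m \<xi> m"
proof -
  obtain d where di: "d integrable_on {0..T}" and dn: "(\<lambda>t. norm (d t)) integrable_on {0..T}"
    and \<xi>eq: "\<And>t. t \<in> {0..T} \<Longrightarrow> \<xi> t = \<xi> 0 + integral {0..t} d"
    and dd: "AE t in lebesgue. t \<in> {0<..<T} \<longrightarrow> (\<xi> has_vector_derivative d t) (at t)"
    using sol unfolding sweeping_solution_def W11_def by blast
  have inZ: "level \<xi> t \<le> 1" if "t \<in> {0..T}" for t
    using sol that unfolding sweeping_solution_def level_def W_def Zset_def by blast
  have vi: "AE t in lebesgue. t \<in> {0<..<T} \<longrightarrow> (\<forall>z\<in>Zset G (W \<xi> t).
        0 \<le> inner (u t - \<xi> t - z) (dot \<xi> t) + norm (dot \<xi> t) / (2 * (c / lam)) * (norm (u t - \<xi> t - z))\<^sup>2)"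
    using sol unfolding sweeping_solution_def W_def by blast
  have \<xi>0: "\<xi> 0 = u 0 - x0" using sol unfolding sweeping_solution_def by (auto simp: algebra_simps)
  have lev0: "level \<xi> 0 = G x0 (g 0 (u 0) (u 0 - x0))" by (simp add: level_def W_def \<xi>0)
  have \<xi>c: "continuous_on {0..T} \<xi>"
  proof -
    have "continuous_on {0..T} (\<lambda>t. \<xi> 0 + integral {0..t} d)"
      by (intro continuous_intros indefinite_integral_continuous_1 di)
    then show ?thesis by (rule continuous_on_eq) (rule \<xi>eq[symmetric])
  qed
  define \<alpha> where "\<alpha> t = norm (Gx (u t - \<xi> t) (W \<xi> t))" for t
  define Q where "Q t \<longleftrightarrow> t \<in> {0<..<T} \<and> good t \<and> (\<xi> has_vector_derivative d t) (at t) \<and>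
     (\<exists>\<kappa>\<ge>0. d t = \<kappa> *\<^sub>R Gx (u t - \<xi> t) (W \<xi> t) \<and> (\<kappa> \<noteq> 0 \<longrightarrow> level \<xi> t = 1))" for t
  have QAE: "AE t in lebesgue. t \<in> {0<..<T} \<longrightarrow> Q t"
    using good_AE dd vi
  proof eventually_elim
    case (elim t)
    show ?case
    proof
      assume t: "t \<in> {0<..<T}"
      have dot: "dot \<xi> t = d t" using elim t by (auto simp: dot_def intro: vector_derivative_at)
      have "\<exists>\<kappa>\<ge>0. d t = \<kappa> *\<^sub>R Gx (u t - \<xi> t) (W \<xi> t) \<and> (\<kappa> \<noteq> 0 \<longrightarrow> G (u t - \<xi> t) (W \<xi> t) = 1)"
      proof (rule normal_of_variational_inequality)
        show "G (u t - \<xi> t) (W \<xi> t) \<le> 1" using inZ[of t] t by (simp add: level_def)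
        show "0 \<le> inner (u t - \<xi> t - z) (d t) + norm (d t) / (2 * (c / lam)) * (norm (u t - \<xi> t - z))\<^sup>2"
          if "z \<in> Zset G (W \<xi> t)" for z using elim(3) t that unfolding dot by blast
      qed
      then show "Q t" using elim t by (simp add: Q_def level_def)
    qed
  qed
  then obtain N where N: "negligible N" "\<And>t. t \<in> {0..T} - N \<Longrightarrow> t \<in> {0<..<T} \<and> Q t"
    by (rule AE_interior_obtain_negligible) blast
  \<comment> \<open>The value 0 off \<open>Q\<close> makes the bound by M and the complementarity
    hold at every time and not just almost everywhere.\<close>
  define m where "m t = (if Q t then norm (d t) * \<alpha> t else 0)" for t
  have m0: "0 \<le> m t" for t by (simp add: m_def \<alpha>_def)
  have m_le: "m t \<le> M t" for t
  proof (cases "Q t")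
    case True
    then obtain \<kappa> where \<kappa>: "\<kappa> \<ge> 0" "d t = \<kappa> *\<^sub>R Gx (u t - \<xi> t) (W \<xi> t)" "\<kappa> \<noteq> 0 \<Longrightarrow> level \<xi> t = 1"
      and g: "good t" "(\<xi> has_vector_derivative d t) (at t)" unfolding Q_def by blast
    show ?thesis using velocity_bound(2)[OF g \<kappa> inZ] True by (simp add: m_def \<alpha>_def mult.commute)
  qed (simp add: m_def M_nonneg)
  have m_lev: "level \<xi> t = 1" if "m t \<noteq> 0" for t
    using that by (auto simp: m_def Q_def split: if_splits)
  have dm: "d t = m t *\<^sub>R vel \<xi> t" if "Q t" for t
  proof -
    obtain \<kappa> where \<kappa>: "\<kappa> \<ge> 0" "d t = \<kappa> *\<^sub>R Gx (u t - \<xi> t) (W \<xi> t)" "\<kappa> \<noteq> 0 \<Longrightarrow> level \<xi> t = 1"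
      using \<open>Q t\<close> by (auto simp: Q_def)
    show ?thesis
    proof (cases "\<kappa> = 0")
      case False
      have \<alpha>: "\<alpha> t \<ge> c" unfolding \<alpha>_def by (rule on_level(1)[OF \<kappa>(3)[OF False]])
      have "m t = \<kappa> * (\<alpha> t)\<^sup>2" using \<open>Q t\<close> \<kappa>(1,2) by (simp add: m_def \<alpha>_def power2_eq_square)
      then show ?thesis using on_level(3)[OF \<kappa>(3)[OF False]] \<kappa>(2) \<alpha> pos_consts by (simp add: \<alpha>_def)
    qed (use \<kappa> \<open>Q t\<close> in \<open>simp add: m_def\<close>)
  qed
  have m_int: "m absolutely_integrable_on {0..T}"
  proof -
    have "(\<lambda>t. norm (d t)) absolutely_integrable_on {0..T}" using dn by (intro nonnegative_absolutely_integrable_1) auto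
    then have "(\<lambda>t. norm (d t) *\<^sub>R \<alpha> t) integrable_on {0..T}"
      unfolding \<alpha>_def by (rule integrable_on_scaleR_continuous) (intro continuous_on_norm compose_cont \<xi>c)
    then have "m integrable_on {0..T}" by (rule integrable_spike[OF _ N(1)]) (use N(2) in \<open>auto simp: m_def\<close>)
    then show ?thesis using m0 by (intro nonnegative_absolutely_integrable_1)
  qed
  have adm: "adm \<xi> m" using \<xi>c m_int m0 m_le by (simp add: adm_def)
  have der: "AE t in lebesgue. t \<in> {0<..<T} \<longrightarrow> (\<xi> has_vector_derivative m t *\<^sub>R vel \<xi> t) (at t)"
    using QAE
  proof eventually_elim
    case (elim t)
    show ?case
    proof
      assume "t \<in> {0<..<T}"
      then have "Q t" using elim by blast
      then have "(\<xi> has_vector_derivative d t) (at t)" unfolding Q_def by blast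
      then show "(\<xi> has_vector_derivative m t *\<^sub>R vel \<xi> t) (at t)" by (simp only: dm[OF \<open>Q t\<close>])
    qed
  qed
  have incr: "norm (\<xi> t - \<xi> s) \<le> integral {s..t} (\<lambda>t. norm (d t))" if st: "0 \<le> s" "s \<le> t" "t \<le> T" for s t
  proof -
    have tT: "t \<in> {0..T}" and sT: "s \<in> {0..T}" using st by auto
    have "\<xi> t - \<xi> s = (\<xi> 0 + integral {0..t} d) - (\<xi> 0 + integral {0..s} d)"
      using \<xi>eq[OF tT] \<xi>eq[OF sT] by (rule arg_cong2[where f="(-)"])
    also have "\<dots> = integral {0..t} d - integral {0..s} d" by simp
    also have "\<dots> = integral {s..t} d" by (rule integral_diff_interval[OF di st])
    finally have eq: "\<xi> t - \<xi> s = integral {s..t} d" .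
    show ?thesis unfolding eq
      by (rule integral_norm_bound_integral) (use di dn st in \<open>auto intro: integrable_subinterval_real\<close>)
  qed
  have Y: "level \<xi> t = level \<xi> 0 + integral {0..t} (drift \<xi> m) - integral {0..t} m" if t: "t \<in> {0..T}" for t
  proof -
    \<comment> \<open>Either m vanishes or s is on the level set, where \<open>align\<close> is
      1.\<close>
    have ma: "m s * align \<xi> s = m s" for s using m_lev[of s] on_level(2)[of \<xi> s] by auto
    have "((\<lambda>s. drift \<xi> m s - m s) has_integral (level \<xi> t - level \<xi> 0)) {0..t}"
      using level_has_integral[OF dn incr der t] by (simp only: ma)
    moreover have "((\<lambda>s. drift \<xi> m s - m s) has_integral (integral {0..t} (drift \<xi> m) - integral {0..t} m)) {0..t}"
      by (intro has_integral_diff integrable_integral abs_int_sub(1)[OF drift_int[OF adm] t] abs_int_sub(1)[OF m_int t])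
    ultimately have "level \<xi> t - level \<xi> 0 = integral {0..t} (drift \<xi> m) - integral {0..t} m"
      by (rule has_integral_unique)
    then show ?thesis by simp
  qed
  have "step \<xi> m \<xi> m"
    unfolding step_def
  proof (intro conjI)
    show "skorokhod T (G x0 (g 0 (u 0) (u 0 - x0))) (drift \<xi> m) m"
      unfolding skorokhod_def lev0[symmetric]
    proof (intro conjI m_int ballI)
      fix t assume t: "t \<in> {0..T}"
      show "0 \<le> m t" by (rule m0)
      show "level \<xi> 0 + integral {0..t} (drift \<xi> m) - integral {0..t} m \<le> 1"
        unfolding Y[OF t, symmetric] by (rule inZ[OF t])
      show "m t \<noteq> 0 \<longrightarrow> level \<xi> 0 + integral {0..t} (drift \<xi> m) - integral {0..t} m = 1"
        unfolding Y[OF t, symmetric] using m_lev by blast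
    qed
    show "\<forall>t. 0 \<le> m t \<and> m t \<le> M t" using m0 m_le by blast
    show "\<forall>t\<in>{0..T}. \<xi> t = u 0 - x0 + integral {0..t} (\<lambda>s. m s *\<^sub>R vel \<xi> s)"
    proof
      fix t assume t: "t \<in> {0..T}"
      have "integral {0..t} (\<lambda>s. m s *\<^sub>R vel \<xi> s) = integral {0..t} d"
        by (rule integral_spike[OF N(1)]) (use N(2) dm t in auto)
      then show "\<xi> t = u 0 - x0 + integral {0..t} (\<lambda>s. m s *\<^sub>R vel \<xi> s)" using \<xi>eq[OF t] \<xi>0 by metis
    qed
  qed
  then show thesis using that adm by blast
qed

end

theorem theorem4p4:
  fixes G :: "'x::{real_inner,banach} \<Rightarrow> 'w::banach \<Rightarrow> real"
    and Gx :: "'x \<Rightarrow> 'w \<Rightarrow> 'x" and Gw :: "'x \<Rightarrow> 'w \<Rightarrow> ('w \<Rightarrow>\<^sub>L real)"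
    and g :: "real \<Rightarrow> 'x \<Rightarrow> 'x \<Rightarrow> 'w" and gt :: "real \<Rightarrow> 'x \<Rightarrow> 'x \<Rightarrow> 'w"
    and gu gxi :: "real \<Rightarrow> 'x \<Rightarrow> 'x \<Rightarrow> ('x \<Rightarrow>\<^sub>L 'w)"
    and a b :: "real \<Rightarrow> real" and u :: "real \<Rightarrow> 'x" and x0 :: 'x
    and T lam c L K0 K1 C0 C1 \<gamma> \<omega> Cxi Cu :: real
  assumes "T > 0"
    and "\<forall>x w. G x w \<ge> 0" and "loc_lipschitz2 G"
    and "hyp_H G Gx lam c L"
    and "hyp_L G Gx Gw K0 K1 C0 C1"
    and "hyp_g T g gt gu gxi a b \<gamma> \<omega> Cxi Cu c K1"
    and "W11 T u"
    and "x0 \<in> Zset G (g 0 (u 0) (u 0 - x0))"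
  shows "\<exists>\<xi>. \<xi> \<in> Omega T (K1 * \<gamma> / c) \<omega> K1 c a u x0
              \<and> sweeping_solution T G g (c / lam) u x0 \<xi>
              \<and> (\<forall>\<xi>'. \<xi>' \<in> Omega T (K1 * \<gamma> / c) \<omega> K1 c a u x0
                      \<and> sweeping_solution T G g (c / lam) u x0 \<xi>'
                      \<longrightarrow> (\<forall>t\<in>{0..T}. \<xi>' t = \<xi> t))"
proof -
  obtain u' where u': "u' integrable_on {0..T}" "(\<lambda>t. norm (u' t)) integrable_on {0..T}"
    "\<And>t. t \<in> {0..T} \<Longrightarrow> u t = u 0 + integral {0..t} u'"
    "AE t in lebesgue. t \<in> {0<..<T} \<longrightarrow> (u has_vector_derivative u' t) (at t)"
    using \<open>W11 T u\<close> unfolding W11_def by blast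
  interpret sweeping_process G Gx Gw g gt gu gxi a b T lam c L K0 K1 C0 C1 \<gamma> \<omega> Cxi Cu u u' x0
  proof
    show "G x0 (g 0 (u 0) (u 0 - x0)) \<le> 1" using assms(8) by (simp add: Zset_def)
  qed (fact assms u')+
  obtain \<xi> m where fp: "adm \<xi> m" "step \<xi> m \<xi> m" by (rule fixed_point_exists)
  show ?thesis
  proof (intro exI[of _ \<xi>] conjI fixed_point_solution[OF fp] allI impI ballI)
    fix \<xi>' t assume "\<xi>' \<in> Omega T (K1 * \<gamma> / c) \<omega> K1 c a u x0 \<and> sweeping_solution T G g (c / lam) u x0 \<xi>'"
      and t: "t \<in> {0..T}"
    then obtain m' where "adm \<xi>' m'" "step \<xi>' m' \<xi>' m'" using solution_fixed_point by blast
    then show "\<xi>' t = \<xi> t" using fixed_point_unique fp t by blast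
  qed
qed

end
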